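(* Let $n\geqslant3$, and let $\psi_0\in H^5(\mathbb{R}^n)\cap L^1(\mathbb{R}^n)$ and $\psi_1\in H^3(\mathbb{R}^n)\cap L^1(\mathbb{R}^n)$ be such that the consistency condition $\psi_2=b\nu\Delta\psi_1+\Delta\psi_0$ holds. Let $\psi$, $\psi^{(0)}$, $\psi^{I,1}$ and $\psi^{L,\kappa}$ be the solutions of the problems written in the context. Then $$\sup_{t\in[0,\infty)}\left\|\psi(t,\cdot)-\left(\psi^{(0)}(t,\cdot)+\kappa\psi^{I,1}(t,\cdot)+\kappa\psi^{L,\kappa}(t,\cdot)\right)\right\|_{L^2}\leqslant C\kappa\sqrt\kappa\left(\|\psi_0\|_{H^5\cap L^1}+\|\psi_1\|_{H^3\cap L^1}\right),$$ where $C$ is a positive constant independent of $\kappa$.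
   Context: Parameters: $b>0$, $\nu>0$, $\gamma\in(1,5/3]$, $\delta:=b\nu+(\gamma-1)\kappa$, and $0<\kappa\ll1$, i.e. $\kappa>0$ is sufficiently small with respect to the other parameters. The initial data are independent of $\kappa$, and $\psi_2$ is nontrivial. $\psi$ solves the linear Blackstock problem ($x\in\mathbb{R}^n$, $t>0$): $$(\partial_t-\kappa\Delta)(\psi_{tt}-\Delta\psi-\delta\Delta\psi_t)+\kappa(\gamma-1)(b\nu-\kappa)\Delta^2\psi_t=0,\quad \psi(0,x)=\psi_0(x),\ \psi_t(0,x)=\psi_1(x),\ \psi_{tt}(0,x)=\psi_2(x).$$ $\psi^{(0)}$ solves $$\psi^{(0)}_{tt}-\Delta\psi^{(0)}-b\nu\Delta\psi^{(0)}_t=0,\quad \psi^{(0)}(0,x)=\psi_0(x),\ \psi^{(0)}_t(0,x)=\psi_1(x).$$ $\psi^{I,1}$ solves $$\partial_t^2\psi^{I,1}-\Delta\psi^{I,1}-b\nu\Delta\partial_t\psi^{I,1}=(\gamma-1)\Delta\left(\partial_t\psi^{(0)}-b\nu\Delta\psi^{(0)}\right),$$ $$\psi^{I,1}(0,x)=(1-\gamma)(\psi_1(x)-b\nu\Delta\psi_0(x)),\quad \partial_t\psi^{I,1}(0,x)=0.$$ $\psi^{L,\kappa}(t,x):=\psi^{L,1}(\kappa t,x)$, where $\psi^{L,1}=\psi^{L,1}(z,x)$ solves the heat equation $\partial_z\psi^{L,1}-\Delta\psi^{L,1}=0$ for $z>0$ with $\psi^{L,1}(0,x)=(\gamma-1)(\psi_1(x)-b\nu\Delta\psi_0(x))$;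 explicitly, $$\psi^{L,\kappa}(t,x)=\frac{\gamma-1}{(4\pi\kappa t)^{\frac n2}}\int_{\mathbb{R}^n}\exp\left(-\tfrac{|x-y|^2}{4\kappa t}\right)(\psi_1(y)-b\nu\Delta\psi_0(y))\,\mathrm{d}y.$$ Solutions are obtained by solving the corresponding linear ODEs in $t$ for the partial Fourier transform with respect to $x$. The constant $C$ does not depend on the data either. The norm of an intersection is the sum of the norms. *)

theory Defs
  imports "HOL-Analysis.Analysis"
begin

text \<open>
  Elements of \<open>L\<^sup>2\<close> and of \<open>H\<^sup>s\<close> are represented by Borel functions; they matter only up to
  null sets. Scalars are complex, which covers real-valued data and solutions.
\<close>

definition square_integrable :: "('a::euclidean_space \<Rightarrow> complex) \<Rightarrow> bool" where
  "square_integrable f \<longleftrightarrow>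
     f \<in> borel_measurable lborel \<and> integrable lborel (\<lambda>x. (norm (f x))\<^sup>2)"

definition L2_norm :: "('a::euclidean_space \<Rightarrow> complex) \<Rightarrow> real" where
  "L2_norm f = sqrt (\<integral>x. (norm (f x))\<^sup>2 \<partial>lborel)"

definition L1_norm :: "('a::euclidean_space \<Rightarrow> complex) \<Rightarrow> real" where
  "L1_norm f = (\<integral>x. norm (f x) \<partial>lborel)"

text \<open>Unitary normalisation, for which Plancherel's identity holds without a constant.\<close>

definition fourier_integral :: "('a::euclidean_space \<Rightarrow> complex) \<Rightarrow> 'a \<Rightarrow> complex" where
  "fourier_integral f \<xi> =
     of_real ((2 * pi) powr (- real DIM('a) / 2)) *
     (\<integral>x. exp (- \<i> * of_real (x \<bullet> \<xi>)) * f x \<partial>lborel)"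

text \<open>
  \<open>F\<close> represents the Fourier--Plancherel transform of \<open>f \<in> L\<^sup>2\<close>, that is, the \<open>L\<^sup>2\<close> limit of the
  transforms of the truncations of \<open>f\<close> to balls. It is unique up to null sets.
\<close>

definition has_fourier ::
    "('a::euclidean_space \<Rightarrow> complex) \<Rightarrow> ('a \<Rightarrow> complex) \<Rightarrow> bool" where
  "has_fourier f F \<longleftrightarrow>
     square_integrable f \<and> square_integrable F \<and>
     ((\<lambda>R. L2_norm (\<lambda>\<xi>. fourier_integral (\<lambda>x. indicator (cball 0 R) x * f x) \<xi> - F \<xi>))
        \<longlongrightarrow> 0) at_top"

definition fourier :: "('a::euclidean_space \<Rightarrow> complex) \<Rightarrow> 'a \<Rightarrow> complex" where
  "fourier f = (SOME F. has_fourier f F)"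

text \<open>\<open>H\<^sup>s\<close> as the Bessel potential space, with norm \<open>\<parallel>(1 + |\<xi>|\<^sup>2)\<^bsup>s/2\<^esup> F\<parallel>\<close> in \<open>L\<^sup>2\<close>.\<close>

definition sobolev :: "real \<Rightarrow> ('a::euclidean_space \<Rightarrow> complex) set" where
  "sobolev s = {f. \<exists>F. has_fourier f F \<and>
     square_integrable (\<lambda>\<xi>. of_real ((1 + (norm \<xi>)\<^sup>2) powr (s / 2)) * F \<xi>)}"

definition sobolev_norm :: "real \<Rightarrow> ('a::euclidean_space \<Rightarrow> complex) \<Rightarrow> real" where
  "sobolev_norm s f = L2_norm (\<lambda>\<xi>. of_real ((1 + (norm \<xi>)\<^sup>2) powr (s / 2)) * fourier f \<xi>)"

definition sobolev_L1_norm :: "real \<Rightarrow> ('a::euclidean_space \<Rightarrow> complex) \<Rightarrow> real" where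
  "sobolev_L1_norm s f = sobolev_norm s f + L1_norm f"

text \<open>The Fourier symbol of the Laplacian.\<close>

definition lap :: "'a::euclidean_space \<Rightarrow> complex" where
  "lap \<xi> = - of_real ((norm \<xi>)\<^sup>2)"

text \<open>\<open>g = \<Delta>f\<close> for \<open>f \<in> H\<^sup>2\<close>; such \<open>g\<close> exists and is unique up to null sets.\<close>

definition has_laplacian ::
    "('a::euclidean_space \<Rightarrow> complex) \<Rightarrow> ('a \<Rightarrow> complex) \<Rightarrow> bool" where
  "has_laplacian f g \<longleftrightarrow> (\<exists>F. has_fourier f F \<and> has_fourier g (\<lambda>\<xi>. lap \<xi> * F \<xi>))"

text \<open>
  Evolution equations on \<open>t \<ge> 0\<close> are solved through the partial Fourier transform in \<open>x\<close>: the
  transform solves, for almost every frequency \<open>\<xi>\<close>, the linear ODE in \<open>t\<close> obtained by replacing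
  \<open>\<Delta>\<close> by \<open>lap \<xi>\<close>. Derivatives at \<open>t = 0\<close> are one-sided. The null set of exceptional frequencies
  does not depend on \<open>t\<close>, so solutions are unique up to null sets in \<open>x\<close> for each \<open>t\<close>.
\<close>

definition partial_fourier ::
    "(real \<Rightarrow> 'a::euclidean_space \<Rightarrow> complex) \<Rightarrow> (real \<Rightarrow> 'a \<Rightarrow> complex) \<Rightarrow> bool" where
  "partial_fourier u v \<longleftrightarrow> (\<forall>t\<ge>0. has_fourier (u t) (v t))"

definition time_derivative ::
    "(real \<Rightarrow> 'a::euclidean_space \<Rightarrow> complex) \<Rightarrow> (real \<Rightarrow> 'a \<Rightarrow> complex) \<Rightarrow> bool" where
  "time_derivative v v' \<longleftrightarrow>
     (AE \<xi> in lborel. \<forall>t\<ge>0. ((\<lambda>s. v s \<xi>) has_vector_derivative v' t \<xi>) (at t within {0..}))"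

definition initially ::
    "(real \<Rightarrow> 'a::euclidean_space \<Rightarrow> complex) \<Rightarrow> ('a \<Rightarrow> complex) \<Rightarrow> bool" where
  "initially v f \<longleftrightarrow> (AE \<xi> in lborel. v 0 \<xi> = fourier f \<xi>)"

text \<open>
  \<open>(\<partial>\<^sub>t - \<kappa>\<Delta>)(\<psi>\<^sub>t\<^sub>t - \<Delta>\<psi> - \<delta>\<Delta>\<psi>\<^sub>t) + \<kappa>(\<gamma>-1)(b\<nu>-\<kappa>)\<Delta>\<^sup>2\<psi>\<^sub>t = 0\<close> with \<open>\<delta> = b\<nu> + (\<gamma>-1)\<kappa>\<close>.
  The first line of the equation is the \<open>\<partial>\<^sub>t\<close> part of the product, the second the \<open>-\<kappa>\<Delta>\<close> part.
\<close>

definition blackstock_solution ::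
    "real \<Rightarrow> real \<Rightarrow> real \<Rightarrow> real \<Rightarrow> ('a::euclidean_space \<Rightarrow> complex) \<Rightarrow> ('a \<Rightarrow> complex) \<Rightarrow>
     ('a \<Rightarrow> complex) \<Rightarrow> (real \<Rightarrow> 'a \<Rightarrow> complex) \<Rightarrow> bool" where
  "blackstock_solution b \<nu> \<gamma> \<kappa> \<psi>0 \<psi>1 \<psi>2 \<psi> \<longleftrightarrow>
     (let \<delta> = b * \<nu> + (\<gamma> - 1) * \<kappa> in
      \<exists>v v1 v2 v3. partial_fourier \<psi> v \<and>
        time_derivative v v1 \<and> time_derivative v1 v2 \<and> time_derivative v2 v3 \<and>
        initially v \<psi>0 \<and> initially v1 \<psi>1 \<and> initially v2 \<psi>2 \<and>
        (AE \<xi> in lborel. \<forall>t\<ge>0.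
           (v3 t \<xi> - lap \<xi> * v1 t \<xi> - of_real \<delta> * lap \<xi> * v2 t \<xi>)
           - of_real \<kappa> * lap \<xi> * (v2 t \<xi> - lap \<xi> * v t \<xi> - of_real \<delta> * lap \<xi> * v1 t \<xi>)
           + of_real (\<kappa> * (\<gamma> - 1) * (b * \<nu> - \<kappa>)) * (lap \<xi>)\<^sup>2 * v1 t \<xi> = 0))"

text \<open>
  \<open>u\<^sub>t\<^sub>t - \<Delta>u - \<beta>\<Delta>u\<^sub>t = S\<close>, where the source is given by its partial Fourier transform \<open>h\<close>.
\<close>

definition damped_wave_solution ::
    "real \<Rightarrow> (real \<Rightarrow> 'a::euclidean_space \<Rightarrow> complex) \<Rightarrow> ('a \<Rightarrow> complex) \<Rightarrow> ('a \<Rightarrow> complex) \<Rightarrow>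
     (real \<Rightarrow> 'a \<Rightarrow> complex) \<Rightarrow> bool" where
  "damped_wave_solution \<beta> h u0 u1 u \<longleftrightarrow>
     (\<exists>v v1 v2. partial_fourier u v \<and> time_derivative v v1 \<and> time_derivative v1 v2 \<and>
        initially v u0 \<and> initially v1 u1 \<and>
        (AE \<xi> in lborel. \<forall>t\<ge>0.
           v2 t \<xi> - lap \<xi> * v t \<xi> - of_real \<beta> * lap \<xi> * v1 t \<xi> = h t \<xi>))"

text \<open>\<open>w0\<close> is the function \<open>\<psi>\<^sub>1 - b\<nu>\<Delta>\<psi>\<^sub>0\<close>, and \<open>\<phi>\<close> is \<open>\<psi>\<^bsup>(0)\<^esup>\<close>.\<close>

definition interior_corrector ::
    "real \<Rightarrow> real \<Rightarrow> real \<Rightarrow> (real \<Rightarrow> 'a::euclidean_space \<Rightarrow> complex) \<Rightarrow> ('a \<Rightarrow> complex) \<Rightarrow>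
     (real \<Rightarrow> 'a \<Rightarrow> complex) \<Rightarrow> bool" where
  "interior_corrector b \<nu> \<gamma> \<phi> w0 u \<longleftrightarrow>
     (\<exists>p p1. partial_fourier \<phi> p \<and> time_derivative p p1 \<and>
        damped_wave_solution (b * \<nu>)
          (\<lambda>t \<xi>. of_real (\<gamma> - 1) * lap \<xi> * (p1 t \<xi> - of_real (b * \<nu>) * lap \<xi> * p t \<xi>))
          (\<lambda>x. of_real (1 - \<gamma>) * w0 x) (\<lambda>x. 0) u)"

definition heat_solution ::
    "('a::euclidean_space \<Rightarrow> complex) \<Rightarrow> (real \<Rightarrow> 'a \<Rightarrow> complex) \<Rightarrow> bool" where
  "heat_solution u0 u \<longleftrightarrow>
     (\<exists>v v1. partial_fourier u v \<and> time_derivative v v1 \<and> initially v u0 \<and>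
        (AE \<xi> in lborel. \<forall>z\<ge>0. v1 z \<xi> - lap \<xi> * v z \<xi> = 0))"

end

theory Submission
  imports Defs "HOL-Probability.Characteristic_Functions"
begin

text \<open>
  On the Fourier side, with \<open>A = |\<xi>|\<^sup>2\<close> and \<open>\<beta> = b\<nu>\<close>, the error \<open>w\<close> satisfies
  \<open>w'' + \<beta>Aw' + (A/\<gamma>)(w - T) = 0\<close> and \<open>T' + \<gamma>\<kappa>AT + (\<gamma>-1)w' = S\<close>, where \<open>S\<close> is of order \<open>\<kappa>\<^sup>2\<close> and
  consists of \<open>\<psi>\<^bsup>(0)\<^esup>\<close>, \<open>\<psi>\<^bsup>I,1\<^esup>\<close> and \<open>\<psi>\<^bsup>L,\<kappa>\<^esup>\<close>. Its natural energy dissipates \<open>\<kappa>A\<^sup>2|T|\<^sup>2\<close>, which absorbs \<open>S\<close>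
  at the price of one factor \<open>1/\<kappa>\<close>; this is the source of the rate \<open>\<kappa>\<^bsup>3/2\<^esup>\<close>. Adding multiples of dissipated
  quadratic forms of \<open>\<psi>\<^bsup>(0)\<^esup>\<close>, \<open>\<psi>\<^bsup>I,1\<^esup>\<close> and \<open>\<psi>\<^bsup>L,\<kappa>\<^esup>\<close> turns the energy into a Lyapunov function, so its initial
  value bounds \<open>w\<close> uniformly in time:
  \<open>|w|\<^sup>2 \<le> C\<kappa>\<^sup>3(1+A)\<^sup>3/A (|F\<^sub>1|\<^sup>2 + (1+A)\<^sup>2|F\<^sub>0|\<^sup>2)\<close>.
  High frequencies are paid for by the Sobolev norms. At low frequencies \<open>|F\<^sub>j|\<close> is bounded by the \<open>L\<^sup>1\<close> norm and
  \<open>1/A\<close> is integrable because \<open>n \<ge> 3\<close>. Plancherel's identity brings the estimate back to \<open>x\<close>.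
\<close>

section \<open>Lyapunov functions at a fixed frequency\<close>

text \<open>The cubic characteristic polynomial is never solved: its roots behave differently at
  small and at large \<open>A\<close>, whereas one energy serves every \<open>A > 0\<close>. The
  price is that \<open>S\<close> must be square integrable in time. It contains \<open>q\<close>,
  the transform of \<psi>^(0)_t - \<beta>\<Delta>\<psi>^(0), and the usual energy
  \<open>A|x|^2 + |q|^2\<close> of the damped wave dissipates only \<open>A^2|x|^2\<close>. A cross
  term \<open>- x \<bullet> q\<close> recovers \<open>|q|^2\<close>, but only if the energy is
  weighted by about \<open>1/(\<beta>A)\<close>, the decay time at low frequencies. This weight
  keeps the initial value of the Lyapunov function from vanishing as \<open>A\<close> tends to 0,
  and so the division by \<open>A\<close> that isolates \<open>|w|^2\<close> leaves the factor
  \<open>1/A\<close>. All coefficients are real, so complex numbers enter the energy estimates only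
  as a real inner product space. For the way back to \<open>x\<close> it is enough to bound the norm
  of a function by that of its transform.\<close>

lemma has_real_derivative_inner:
  fixes f g :: "real \<Rightarrow> 'a::real_inner"
  assumes "(f has_vector_derivative f') (at t within S)"
    and "(g has_vector_derivative g') (at t within S)"
  shows "((\<lambda>s. f s \<bullet> g s) has_real_derivative (f t \<bullet> g' + f' \<bullet> g t)) (at t within S)"
  using bounded_bilinear.has_vector_derivative[OF bounded_bilinear_inner assms]
  unfolding has_real_derivative_iff_has_vector_derivative .

lemma inner_young:
  fixes a b :: "'a::real_inner"
  assumes "e > 0"
  shows "2 * (a \<bullet> b) \<le> e * (a \<bullet> a) + (b \<bullet> b) / e"
proof -
  have "0 \<le> (e *\<^sub>R a - b) \<bullet> (e *\<^sub>R a - b)" by simp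
  also have "\<dots> = e * (e * (a \<bullet> a)) - 2 * e * (a \<bullet> b) + b \<bullet> b"
    by (simp add: inner_diff_left inner_diff_right inner_commute algebra_simps)
  finally have "0 \<le> (e * (e * (a \<bullet> a)) - 2 * e * (a \<bullet> b) + b \<bullet> b) / e"
    using assms by simp
  also have "\<dots> = e * (a \<bullet> a) - 2 * (a \<bullet> b) + (b \<bullet> b) / e"
    using assms by (simp add: add_divide_distrib diff_divide_distrib)
  finally show ?thesis by simp
qed

text \<open>The coefficient is split as \<open>c^2 = e * d\<close>, so that a caller names the
  dissipated share \<open>e\<close> and reads off the price \<open>d\<close>.\<close>

lemma inner_young_scaled:
  fixes a b :: "'a::real_inner"
  assumes "e > 0" "c\<^sup>2 = e * d"
  shows "2 * (a \<bullet> c *\<^sub>R b) \<le> e * (a \<bullet> a) + d * (b \<bullet> b)"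
proof -
  have "2 * (a \<bullet> c *\<^sub>R b) \<le> e * (a \<bullet> a) + (c *\<^sub>R b \<bullet> c *\<^sub>R b) / e"
    by (rule inner_young[OF assms(1)])
  also have "(c *\<^sub>R b \<bullet> c *\<^sub>R b) / e = c\<^sup>2 / e * (b \<bullet> b)"
    by (simp add: power2_eq_square)
  also have "c\<^sup>2 / e = d" using assms by simp
  finally show ?thesis .
qed

text \<open>The derivative at 0 is one-sided. The mean value argument therefore runs on the open
  interval, and the endpoint enters through continuity.\<close>

lemma nonincreasing_on_halfline:
  fixes \<Phi> :: "real \<Rightarrow> real"
  assumes D: "\<And>t. t \<ge> 0 \<Longrightarrow> (\<Phi> has_real_derivative D t) (at t within {0..})"
    and neg: "\<And>t. t \<ge> 0 \<Longrightarrow> D t \<le> 0" and "t \<ge> 0"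
  shows "\<Phi> t \<le> \<Phi> 0"
proof (rule DERIV_nonpos_imp_decreasing_open[OF \<open>t \<ge> 0\<close>])
  fix s :: real assume s: "0 < s" "s < t"
  then have "at s within {0..} = at s"
    by (intro at_within_interior) (simp add: interior_real_atLeast)
  then have "(\<Phi> has_real_derivative D s) (at s)" using D[of s] s by simp
  then show "\<exists>y. DERIV \<Phi> s :> y \<and> y \<le> 0" using neg[of s] s by (intro exI[of _ "D s"]) simp
next
  show "continuous_on {0..t} \<Phi>"
    unfolding continuous_on_eq_continuous_within
  proof
    fix s assume "s \<in> {0..t}"
    then have "0 \<le> s" by simp
    then have "continuous (at s within {0..}) \<Phi>" by (rule DERIV_continuous[OF D])
    then show "continuous (at s within {0..t}) \<Phi>"
      by (rule continuous_within_subset) auto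
  qed
qed

section \<open>Cross energies of the damped wave equation\<close>

definition cross_energy :: "real \<Rightarrow> real \<Rightarrow> 'a::real_inner \<Rightarrow> 'a \<Rightarrow> real" where
  "cross_energy m A x q = 2 * (m * (A * (x \<bullet> x) + q \<bullet> q) - x \<bullet> q)"

text \<open>The weight makes \<open>cross_weight \<beta> A * \<beta> * A\<^sup>2 = \<beta>\<^sup>2A\<^sup>2/4 + A\<close>: the damping term then absorbs everything
  that the derivative of the cross term \<open>- x \<bullet> q\<close> produces in \<open>x\<close>, while the form stays nonnegative.\<close>

definition cross_weight :: "real \<Rightarrow> real \<Rightarrow> real" where
  "cross_weight \<beta> A = \<beta> / 4 + 1 / (\<beta> * A)"

lemma cross_weight_pos: "\<beta> > 0 \<Longrightarrow> A > 0 \<Longrightarrow> cross_weight \<beta> A > 0"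
  by (simp add: cross_weight_def add_pos_pos)

text \<open>AM-GM for the summands \<open>\<beta> / 4\<close> and \<open>1 / (\<beta> * A)\<close>,
  whose product \<open>1 / (4 * A)\<close> is free of \<beta>. This is what makes the cross term
  small relative to the weighted energy.\<close>

lemma cross_weight_sq:
  assumes "\<beta> > 0" "A > 0"
  shows "1 \<le> 4 * (cross_weight \<beta> A)\<^sup>2 * A"
proof -
  have "4 * (cross_weight \<beta> A)\<^sup>2 = 4 * (\<beta> / 4 - 1 / (\<beta> * A))\<^sup>2 + 4 / A"
    using assms by (simp add: cross_weight_def field_simps power2_eq_square)
  then have "4 / A \<le> 4 * (cross_weight \<beta> A)\<^sup>2" by simp
  then show ?thesis using assms by (simp add: field_simps)
qed

lemma cross_weight_le:
  assumes "\<beta> > 0" "A > 0"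
  shows "cross_weight \<beta> A \<le> (\<beta> / 4 + 1 / \<beta>) * ((1 + A) / A)"
  using assms by (simp add: cross_weight_def field_simps)

lemma cross_energy_bounds:
  fixes x q :: "'a::real_inner"
  assumes "\<beta> > 0" "A > 0"
  shows "0 \<le> cross_energy (cross_weight \<beta> A) A x q"
    and "cross_energy (cross_weight \<beta> A) A x q \<le> 4 * cross_weight \<beta> A * (A * (x \<bullet> x) + q \<bullet> q)"
proof -
  let ?m = "cross_weight \<beta> A"
  have m: "?m > 0" by (rule cross_weight_pos[OF assms])
  \<comment> \<open>Taken at \<open>q\<close> this gives nonnegativity, taken at \<open>- q\<close>
    the upper bound.\<close>
  have *: "2 * (x \<bullet> y) \<le> 2 * ?m * (A * (x \<bullet> x) + y \<bullet> y)" for y :: 'a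
  proof -
    have "2 * (x \<bullet> y) \<le> (2 * ?m * A) * (x \<bullet> x) + (y \<bullet> y) / (2 * ?m * A)"
      by (rule inner_young) (use m assms in simp)
    also have "(y \<bullet> y) / (2 * ?m * A) \<le> 2 * ?m * (y \<bullet> y)"
    proof -
      have "1 / (2 * ?m * A) \<le> 2 * ?m"
        using cross_weight_sq[OF assms] m assms by (simp add: field_simps power2_eq_square)
      from mult_right_mono[OF this inner_ge_zero[of y]] show ?thesis by simp
    qed
    finally show ?thesis by (simp add: algebra_simps)
  qed
  show "0 \<le> cross_energy ?m A x q" using *[of q] by (simp add: cross_energy_def algebra_simps)
  show "cross_energy ?m A x q \<le> 4 * ?m * (A * (x \<bullet> x) + q \<bullet> q)"
    using *[of "- q"] by (simp add: cross_energy_def algebra_simps)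
qed

text \<open>With \<open>q = x' + \<beta>Ax\<close> the damped wave equation becomes the first-order
  system of the assumptions, free of second derivatives. The forcing \<open>r\<close> is 0 for
  \<psi>^(0) and \<open>(\<gamma> - 1) *\<^sub>R q\<close> for \<psi>^(I,1).\<close>

lemma has_derivative_cross_energy:
  fixes x q :: "real \<Rightarrow> 'a::real_inner"
  assumes "(x has_vector_derivative q t - (\<beta> * A) *\<^sub>R x t) (at t within S)"
    and "(q has_vector_derivative - A *\<^sub>R (x t + r)) (at t within S)"
  shows "((\<lambda>s. cross_energy m A (x s) (q s)) has_real_derivative
     2 * (- 2 * m * \<beta> * A\<^sup>2 * (x t \<bullet> x t) - 2 * m * A * (q t \<bullet> r) - q t \<bullet> q t
        + \<beta> * A * (x t \<bullet> q t) + A * (x t \<bullet> x t) + A * (x t \<bullet> r))) (at t within S)"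
  unfolding cross_energy_def
  by (rule derivative_eq_intros has_real_derivative_inner assms refl)+
     (simp add: inner_diff_left inner_diff_right inner_add_left inner_add_right inner_commute
        power2_eq_square algebra_simps)

lemma cross_weight_identity:
  fixes x :: "'a::real_inner"
  assumes "\<beta> > 0" "A > 0"
  shows "- 2 * cross_weight \<beta> A * \<beta> * A\<^sup>2 * (x \<bullet> x) = - ((\<beta> * A)\<^sup>2 * (x \<bullet> x)) / 2 - 2 * (A * (x \<bullet> x))"
proof -
  have "2 * cross_weight \<beta> A * \<beta> * A\<^sup>2 = (\<beta> * A)\<^sup>2 / 2 + 2 * A"
    using assms by (simp add: cross_weight_def field_simps power2_eq_square)
  then have "2 * cross_weight \<beta> A * \<beta> * A\<^sup>2 * (x \<bullet> x) = ((\<beta> * A)\<^sup>2 / 2 + 2 * A) * (x \<bullet> x)"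
    by (rule arg_cong)
  then show ?thesis by (simp add: distrib_right)
qed

text \<open>The weighted damping supplies \<open>(\<beta>A)^2|x|^2\<close>, exactly what Young's
  inequality charges for the mixed term \<open>x \<bullet> q\<close>. Half of the
  \<open>- 2|q|^2\<close> produced by the cross term survives.\<close>

lemma cross_energy_dissipation_free:
  fixes x q :: "'a::real_inner"
  assumes "\<beta> > 0" "A > 0"
  shows "2 * (- 2 * cross_weight \<beta> A * \<beta> * A\<^sup>2 * (x \<bullet> x) - q \<bullet> q + \<beta> * A * (x \<bullet> q) + A * (x \<bullet> x))
    \<le> - (q \<bullet> q)"
proof -
  have "2 * (q \<bullet> (\<beta> * A) *\<^sub>R x) \<le> 1 * (q \<bullet> q) + (\<beta> * A)\<^sup>2 * (x \<bullet> x)"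
    by (rule inner_young_scaled) auto
  then have "2 * (\<beta> * A * (x \<bullet> q)) \<le> q \<bullet> q + (\<beta> * A)\<^sup>2 * (x \<bullet> x)"
    by (simp add: inner_commute)
  moreover have "0 \<le> A * (x \<bullet> x)" using assms by simp
  ultimately show ?thesis unfolding cross_weight_identity[OF assms] by argo
qed

text \<open>Here all of \<open>- 2|q|^2\<close> is spent, one half on \<open>x \<bullet> q\<close>
  and the other on the forcing term \<open>q \<bullet> r\<close>. What survives comes from the
  summand \<open>1 / (\<beta> * A)\<close> of the weight: it leaves \<open>- 2A|x|^2\<close>, half
  of which pays for \<open>x \<bullet> r\<close>.\<close>

lemma cross_energy_dissipation_forced:
  fixes x q r :: "'a::real_inner"
  assumes "\<beta> > 0" "A > 0"
  shows "2 * (- 2 * cross_weight \<beta> A * \<beta> * A\<^sup>2 * (x \<bullet> x) - 2 * cross_weight \<beta> A * A * (q \<bullet> r) - q \<bullet> q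
        + \<beta> * A * (x \<bullet> q) + A * (x \<bullet> x) + A * (x \<bullet> r))
    \<le> - A * (x \<bullet> x) + (4 * (cross_weight \<beta> A)\<^sup>2 * A\<^sup>2 + A) * (r \<bullet> r)"
proof -
  let ?m = "cross_weight \<beta> A"
  have "2 * (q \<bullet> (\<beta> * A) *\<^sub>R x) \<le> 1 * (q \<bullet> q) + (\<beta> * A)\<^sup>2 * (x \<bullet> x)"
    by (rule inner_young_scaled) auto
  then have 1: "2 * (\<beta> * A * (x \<bullet> q)) \<le> q \<bullet> q + (\<beta> * A)\<^sup>2 * (x \<bullet> x)"
    by (simp add: inner_commute)
  have "2 * (q \<bullet> (- 2 * ?m * A) *\<^sub>R r) \<le> 1 * (q \<bullet> q) + (4 * ?m\<^sup>2 * A\<^sup>2) * (r \<bullet> r)"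
    by (rule inner_young_scaled) (auto simp: power2_eq_square)
  then have 2: "- (2 * (2 * ?m * A * (q \<bullet> r))) \<le> q \<bullet> q + (4 * ?m\<^sup>2 * A\<^sup>2) * (r \<bullet> r)"
    by simp
  have "A * (2 * (x \<bullet> r)) \<le> A * (1 * (x \<bullet> x) + (r \<bullet> r) / 1)"
    using assms by (intro mult_left_mono inner_young) auto
  then have 3: "2 * (A * (x \<bullet> r)) \<le> A * (x \<bullet> x) + A * (r \<bullet> r)"
    by (simp add: distrib_left)
  show ?thesis
    using 1 2 3 unfolding cross_weight_identity[OF assms] by argo
qed

section \<open>The energy of the error and its Lyapunov correction\<close>

lemma acoustic_energy_deriv:
  fixes w p T :: "real \<Rightarrow> 'a::real_inner"
  assumes "A > 0" "\<gamma> > 1"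
    and "(w has_vector_derivative p t) (at t within S)"
    and "(p has_vector_derivative - (\<beta> * A) *\<^sub>R p t - (A / \<gamma>) *\<^sub>R (w t - T t)) (at t within S)"
    and "(T has_vector_derivative - (\<gamma> * \<kappa> * A) *\<^sub>R T t - (\<gamma> - 1) *\<^sub>R p t
           + (\<gamma> * (\<gamma> - 1)) *\<^sub>R F) (at t within S)"
  shows "((\<lambda>s. p s \<bullet> p s + A / \<gamma> * (w s \<bullet> w s) + A / (\<gamma> * (\<gamma> - 1)) * (T s \<bullet> T s))
    has_real_derivative - 2 * \<beta> * A * (p t \<bullet> p t) - 2 * \<kappa> * A\<^sup>2 / (\<gamma> - 1) * (T t \<bullet> T t)
      + 2 * A * (T t \<bullet> F)) (at t within S)"
proof -
  have g: "\<gamma> * (\<gamma> - 1) \<noteq> 0" "\<gamma> \<noteq> 0" "\<gamma> - 1 \<noteq> 0" using assms by auto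
  show ?thesis
    \<comment> \<open>The coefficient of \<open>T s \<bullet> T s\<close> is the one for which the
      couplings \<open>p \<bullet> T\<close> from the two equations cancel. It also removes the
      factor \<open>\<gamma> * (\<gamma> - 1)\<close> of the source.\<close>
    by (rule derivative_eq_intros has_real_derivative_inner assms refl)+
       (use g in \<open>simp add: inner_diff_left inner_diff_right inner_add_left inner_add_right inner_commute,
         simp add: field_simps power2_eq_square inner_commute\<close>)
qed

text \<open>Since \<open>\<gamma> - 1 \<le> 1\<close>, at least \<open>2\<kappa>A^2|T|^2\<close> is
  dissipated. One half absorbs the source of order \<kappa>^2, the other the layer source of order
  \<kappa>^3. The 6 rounds up \<open>2\<gamma>^2 \<le> 50/9\<close>.\<close>

lemma acoustic_energy_dissipation:
  fixes p T q y l :: "'a::real_inner"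
  assumes "A > 0" "\<beta> > 0" "\<kappa> > 0" "1 < \<gamma>" "\<gamma> \<le> 5 / 3"
  shows "- 2 * \<beta> * A * (p \<bullet> p) - 2 * \<kappa> * A\<^sup>2 / (\<gamma> - 1) * (T \<bullet> T)
      + 2 * A * (T \<bullet> ((\<kappa>\<^sup>2 * A) *\<^sub>R (\<gamma> *\<^sub>R q + y) + (\<kappa>^3 * A\<^sup>2 * (\<beta> - \<kappa>)) *\<^sub>R l))
    \<le> \<kappa>^3 * A\<^sup>2 * (6 * (q \<bullet> q) + 2 * (y \<bullet> y)) + \<kappa>^5 * A^4 * (\<beta> - \<kappa>)\<^sup>2 * (l \<bullet> l)"
proof -
  have 1: "2 * \<kappa> * A\<^sup>2 * (T \<bullet> T) \<le> 2 * \<kappa> * A\<^sup>2 / (\<gamma> - 1) * (T \<bullet> T)"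
  proof -
    have "2 * \<kappa> * A\<^sup>2 * 1 \<le> 2 * \<kappa> * A\<^sup>2 * (1 / (\<gamma> - 1))"
      using assms by (intro mult_left_mono) (auto simp: field_simps)
    from mult_right_mono[OF this inner_ge_zero[of T]] show ?thesis by simp
  qed
  have 2: "2 * (T \<bullet> (\<kappa>\<^sup>2 * A\<^sup>2) *\<^sub>R (\<gamma> *\<^sub>R q + y)) \<le> \<kappa> * A\<^sup>2 * (T \<bullet> T)
      + \<kappa>^3 * A\<^sup>2 * ((\<gamma> *\<^sub>R q + y) \<bullet> (\<gamma> *\<^sub>R q + y))"
    using assms by (intro inner_young_scaled) (auto simp: eval_nat_numeral)
  have 3: "2 * (T \<bullet> (\<kappa>^3 * A^3 * (\<beta> - \<kappa>)) *\<^sub>R l) \<le> \<kappa> * A\<^sup>2 * (T \<bullet> T)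
      + \<kappa>^5 * A^4 * (\<beta> - \<kappa>)\<^sup>2 * (l \<bullet> l)"
    using assms by (intro inner_young_scaled) (auto simp: eval_nat_numeral)
  have 4: "(\<gamma> *\<^sub>R q + y) \<bullet> (\<gamma> *\<^sub>R q + y) \<le> 6 * (q \<bullet> q) + 2 * (y \<bullet> y)"
  proof -
    have "\<gamma>\<^sup>2 \<le> (5/3)\<^sup>2" using assms by (intro power_mono) auto
    then have "2 * \<gamma>\<^sup>2 * (q \<bullet> q) \<le> 6 * (q \<bullet> q)"
      by (intro mult_right_mono) (auto simp: power2_eq_square)
    moreover have "2 * (\<gamma> *\<^sub>R q \<bullet> y) \<le> 1 * (\<gamma> *\<^sub>R q \<bullet> \<gamma> *\<^sub>R q) + (y \<bullet> y) / 1"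
      by (rule inner_young) simp
    ultimately show ?thesis
      by (simp add: inner_add_left inner_add_right inner_commute power2_eq_square)
  qed
  have 5: "\<kappa>^3 * A\<^sup>2 * ((\<gamma> *\<^sub>R q + y) \<bullet> (\<gamma> *\<^sub>R q + y)) \<le> \<kappa>^3 * A\<^sup>2 * (6 * (q \<bullet> q) + 2 * (y \<bullet> y))"
    using assms by (intro mult_left_mono 4) auto
  have 6: "2 * A * (T \<bullet> ((\<kappa>\<^sup>2 * A) *\<^sub>R (\<gamma> *\<^sub>R q + y) + (\<kappa>^3 * A\<^sup>2 * (\<beta> - \<kappa>)) *\<^sub>R l))
     = 2 * (T \<bullet> (\<kappa>\<^sup>2 * A\<^sup>2) *\<^sub>R (\<gamma> *\<^sub>R q + y)) + 2 * (T \<bullet> (\<kappa>^3 * A^3 * (\<beta> - \<kappa>)) *\<^sub>R l)"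
    by (simp add: inner_add_right power2_eq_square power3_eq_cube algebra_simps)
  have "0 \<le> 2 * \<beta> * A * (p \<bullet> p)" using assms by simp
  with 1 2 3 5 6 show ?thesis by linarith
qed

text \<open>The auxiliary forms are coupled triangularly: the one of \<open>y\<close> loses
  \<open>A|y|^2\<close> but gains a multiple of \<open>|q|^2\<close>, which the form of
  \<open>x\<close> dissipates. The coefficients are therefore found backwards. First
  \<open>2 / A\<close> absorbs the \<open>2|y|^2\<close> of the error energy; then
  \<open>8 + 8m^2A\<close> pays for its \<open>6|q|^2\<close> and for the
  \<open>(2 + 8m^2A)|q|^2\<close> just created. As \<open>|l|^2\<close> decays at rate
  \<open>2\<kappa>A\<close>, half of \<open>\<kappa>^4A^3(\<beta> - \<kappa>)^2\<close> suffices for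
  the layer. All remainders cancel exactly.\<close>

lemma corrector_error_decay:
  fixes w p T x q y z l :: "real \<Rightarrow> 'a::real_inner"
  assumes par: "A > 0" "\<beta> > 0" "\<kappa> > 0" "1 < \<gamma>" "\<gamma> \<le> 5 / 3"
    and x: "\<And>t. t \<ge> 0 \<Longrightarrow> (x has_vector_derivative q t - (\<beta> * A) *\<^sub>R x t) (at t within {0..})"
    and q: "\<And>t. t \<ge> 0 \<Longrightarrow> (q has_vector_derivative - A *\<^sub>R x t) (at t within {0..})"
    and y: "\<And>t. t \<ge> 0 \<Longrightarrow> (y has_vector_derivative z t - (\<beta> * A) *\<^sub>R y t) (at t within {0..})"
    and z: "\<And>t. t \<ge> 0 \<Longrightarrow> (z has_vector_derivative - A *\<^sub>R (y t + (\<gamma> - 1) *\<^sub>R q t)) (at t within {0..})"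
    and l: "\<And>t. t \<ge> 0 \<Longrightarrow> (l has_vector_derivative - (\<kappa> * A) *\<^sub>R l t) (at t within {0..})"
    and w: "\<And>t. t \<ge> 0 \<Longrightarrow> (w has_vector_derivative p t) (at t within {0..})"
    and p: "\<And>t. t \<ge> 0 \<Longrightarrow>
      (p has_vector_derivative - (\<beta> * A) *\<^sub>R p t - (A / \<gamma>) *\<^sub>R (w t - T t)) (at t within {0..})"
    and T: "\<And>t. t \<ge> 0 \<Longrightarrow>
      (T has_vector_derivative - (\<gamma> * \<kappa> * A) *\<^sub>R T t - (\<gamma> - 1) *\<^sub>R p t + (\<gamma> * (\<gamma> - 1)) *\<^sub>R
         ((\<kappa>\<^sup>2 * A) *\<^sub>R (\<gamma> *\<^sub>R q t + y t) + (\<kappa>^3 * A\<^sup>2 * (\<beta> - \<kappa>)) *\<^sub>R l t)) (at t within {0..})"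
    and "t \<ge> 0"
  defines "m \<equiv> cross_weight \<beta> A"
  shows "A / \<gamma> * (w t \<bullet> w t) \<le>
     p 0 \<bullet> p 0 + A / \<gamma> * (w 0 \<bullet> w 0) + A / (\<gamma> * (\<gamma> - 1)) * (T 0 \<bullet> T 0)
     + \<kappa>^3 * A\<^sup>2 * (2 / A * cross_energy m A (y 0) (z 0) + (8 + 8 * m\<^sup>2 * A) * cross_energy m A (x 0) (q 0))
     + \<kappa>^4 * A^3 * (\<beta> - \<kappa>)\<^sup>2 / 2 * (l 0 \<bullet> l 0)"
proof -
  define E where "E t = p t \<bullet> p t + A / \<gamma> * (w t \<bullet> w t) + A / (\<gamma> * (\<gamma> - 1)) * (T t \<bullet> T t)" for t
  define R where "R t = \<kappa>^3 * A\<^sup>2 * (2 / A * cross_energy m A (y t) (z t) + (8 + 8 * m\<^sup>2 * A) * cross_energy m A (x t) (q t))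
     + \<kappa>^4 * A^3 * (\<beta> - \<kappa>)\<^sup>2 / 2 * (l t \<bullet> l t)" for t
  define e where "e t = - 2 * \<beta> * A * (p t \<bullet> p t) - 2 * \<kappa> * A\<^sup>2 / (\<gamma> - 1) * (T t \<bullet> T t)
      + 2 * A * (T t \<bullet> ((\<kappa>\<^sup>2 * A) *\<^sub>R (\<gamma> *\<^sub>R q t + y t) + (\<kappa>^3 * A\<^sup>2 * (\<beta> - \<kappa>)) *\<^sub>R l t))" for t
  define dx where "dx t = 2 * (- 2 * m * \<beta> * A\<^sup>2 * (x t \<bullet> x t) - q t \<bullet> q t + \<beta> * A * (x t \<bullet> q t) + A * (x t \<bullet> x t))" for t
  define dy where "dy t = 2 * (- 2 * m * \<beta> * A\<^sup>2 * (y t \<bullet> y t) - 2 * m * A * (z t \<bullet> ((\<gamma> - 1) *\<^sub>R q t)) - z t \<bullet> z t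
        + \<beta> * A * (y t \<bullet> z t) + A * (y t \<bullet> y t) + A * (y t \<bullet> ((\<gamma> - 1) *\<^sub>R q t)))" for t
  define D where "D t = e t + (\<kappa>^3 * A\<^sup>2 * (2 / A * dy t + (8 + 8 * m\<^sup>2 * A) * dx t)
     + \<kappa>^4 * A^3 * (\<beta> - \<kappa>)\<^sup>2 / 2 * (- 2 * \<kappa> * A * (l t \<bullet> l t)))" for t
  have dE: "(E has_real_derivative e t) (at t within {0..})" if "t \<ge> 0" for t
    unfolding E_def e_def by (rule acoustic_energy_deriv[OF par(1,4) w[OF that] p[OF that] T[OF that]])
  have dX: "((\<lambda>s. cross_energy m A (x s) (q s)) has_real_derivative dx t) (at t within {0..})" if "t \<ge> 0" for t
    using has_derivative_cross_energy[of x q t \<beta> A "{0..}" 0 m] x[OF that] q[OF that] by (simp add: dx_def)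
  have dY: "((\<lambda>s. cross_energy m A (y s) (z s)) has_real_derivative dy t) (at t within {0..})" if "t \<ge> 0" for t
    unfolding dy_def by (rule has_derivative_cross_energy[OF y[OF that] z[OF that]])
  have dL: "((\<lambda>s. l s \<bullet> l s) has_real_derivative - 2 * \<kappa> * A * (l t \<bullet> l t)) (at t within {0..})" if "t \<ge> 0" for t
    by (rule has_real_derivative_inner[OF l[OF that] l[OF that], THEN DERIV_cong]) simp
  have dPhi: "((\<lambda>t. E t + R t) has_real_derivative D t) (at t within {0..})" if "t \<ge> 0" for t
    unfolding R_def D_def
    by (intro DERIV_add DERIV_cmult dE dX dY dL that)
  have neg: "D t \<le> 0" for t
  proof -
    have "dx t \<le> - (q t \<bullet> q t)"
      unfolding dx_def m_def by (rule cross_energy_dissipation_free[OF par(2,1)])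
    then have 1: "\<kappa>^3 * A\<^sup>2 * ((8 + 8 * m\<^sup>2 * A) * dx t) \<le> \<kappa>^3 * A\<^sup>2 * ((8 + 8 * m\<^sup>2 * A) * - (q t \<bullet> q t))"
      using par by (intro mult_left_mono) auto
    have "dy t \<le> - A * (y t \<bullet> y t) + (4 * m\<^sup>2 * A\<^sup>2 + A) * (((\<gamma> - 1) *\<^sub>R q t) \<bullet> ((\<gamma> - 1) *\<^sub>R q t))"
      unfolding dy_def m_def by (rule cross_energy_dissipation_forced[OF par(2,1)])
    also have "\<dots> \<le> - A * (y t \<bullet> y t) + (4 * m\<^sup>2 * A\<^sup>2 + A) * (q t \<bullet> q t)"
    proof -
      have "(\<gamma> - 1)\<^sup>2 \<le> 1" using par by (intro power_le_one) auto
      then have "(\<gamma> - 1)\<^sup>2 * (q t \<bullet> q t) \<le> 1 * (q t \<bullet> q t)" by (intro mult_right_mono) auto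
      then show ?thesis
        using par by (intro add_left_mono mult_left_mono) (auto simp: power2_eq_square)
    qed
    finally have "2 / A * dy t \<le> 2 / A * (- A * (y t \<bullet> y t) + (4 * m\<^sup>2 * A\<^sup>2 + A) * (q t \<bullet> q t))"
      using par by (intro mult_left_mono) auto
    also have "\<dots> = - 2 * (y t \<bullet> y t) + (8 * m\<^sup>2 * A + 2) * (q t \<bullet> q t)"
      using par by (simp add: field_simps power2_eq_square)
    finally have 2: "\<kappa>^3 * A\<^sup>2 * (2 / A * dy t) \<le> \<kappa>^3 * A\<^sup>2 * (- 2 * (y t \<bullet> y t) + (8 * m\<^sup>2 * A + 2) * (q t \<bullet> q t))"
      using par by (intro mult_left_mono) auto
    have 3: "e t \<le> \<kappa>^3 * A\<^sup>2 * (6 * (q t \<bullet> q t) + 2 * (y t \<bullet> y t)) + \<kappa>^5 * A^4 * (\<beta> - \<kappa>)\<^sup>2 * (l t \<bullet> l t)"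
      unfolding e_def by (rule acoustic_energy_dissipation[OF par])
    have 4: "\<kappa>^4 * A^3 * (\<beta> - \<kappa>)\<^sup>2 / 2 * (- 2 * \<kappa> * A * (l t \<bullet> l t)) = - (\<kappa>^5 * A^4 * (\<beta> - \<kappa>)\<^sup>2 * (l t \<bullet> l t))"
      by (simp add: eval_nat_numeral)
    have "D t = e t + (\<kappa>^3 * A\<^sup>2 * (2 / A * dy t) + \<kappa>^3 * A\<^sup>2 * ((8 + 8 * m\<^sup>2 * A) * dx t)
       + \<kappa>^4 * A^3 * (\<beta> - \<kappa>)\<^sup>2 / 2 * (- 2 * \<kappa> * A * (l t \<bullet> l t)))"
      unfolding D_def distrib_left ..
    then have "D t \<le> \<kappa>^3 * A\<^sup>2 * (6 * (q t \<bullet> q t) + 2 * (y t \<bullet> y t))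
       + \<kappa>^3 * A\<^sup>2 * (- 2 * (y t \<bullet> y t) + (8 * m\<^sup>2 * A + 2) * (q t \<bullet> q t))
       + \<kappa>^3 * A\<^sup>2 * ((8 + 8 * m\<^sup>2 * A) * - (q t \<bullet> q t))"
      using 1 2 3 4 by linarith
    also have "\<dots> = 0" by (simp add: algebra_simps)
    finally show ?thesis .
  qed
  have "E t + R t \<le> E 0 + R 0"
    by (rule nonincreasing_on_halfline[OF dPhi neg \<open>t \<ge> 0\<close>])
  moreover have "0 \<le> R t"
    unfolding R_def m_def using par
    by (intro add_nonneg_nonneg mult_nonneg_nonneg cross_energy_bounds(1)) auto
  moreover have "A / \<gamma> * (w t \<bullet> w t) \<le> E t"
    unfolding E_def using par by simp
  ultimately show ?thesis unfolding E_def R_def by linarith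
qed

text \<open>The weight \<open>m\<close> blows up like \<open>1 / (\<beta>A)\<close> as
  \<open>A\<close> tends to 0, but the powers of \<open>A\<close> in front of it allow it to be
  grouped into products \<open>m * A \<le> C * (1 + A)\<close>. The form of \<psi>^(0) contains the
  cube of \<open>m * A\<close>, which accounts for the power \<open>(1 + A)^3\<close> and does not
  vanish at low frequencies.\<close>

lemma initial_energy_bound:
  fixes a b :: "'a::real_inner"
  assumes par: "A > 0" "\<beta> > 0" "0 < \<kappa>" "\<kappa> < 1" "1 < \<gamma>" "\<gamma> \<le> 5 / 3"
  defines "W \<equiv> b + (\<beta> * A) *\<^sub>R a"
  defines "c \<equiv> (\<gamma> - 1) *\<^sub>R W"
  defines "m \<equiv> cross_weight \<beta> A"
  defines "C \<equiv> \<beta> / 4 + 1 / \<beta>"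
  shows "(\<kappa>\<^sup>2 * A) *\<^sub>R c \<bullet> (\<kappa>\<^sup>2 * A) *\<^sub>R c
     + A / (\<gamma> * (\<gamma> - 1)) * ((\<gamma> * \<kappa>\<^sup>2 * A * (\<beta> - \<kappa>)) *\<^sub>R c \<bullet> (\<gamma> * \<kappa>\<^sup>2 * A * (\<beta> - \<kappa>)) *\<^sub>R c)
     + \<kappa>^3 * A\<^sup>2 * (2 / A * cross_energy m A (- c) (- (\<beta> * A) *\<^sub>R c) + (8 + 8 * m\<^sup>2 * A) * cross_energy m A a W)
     + \<kappa>^4 * A^3 * (\<beta> - \<kappa>)\<^sup>2 / 2 * (c \<bullet> c)
   \<le> (2 * (1 + \<beta>\<^sup>2) * (1 + 3 * (1 + \<beta>)\<^sup>2 + 4 * C * (1 + \<beta>\<^sup>2)) + 32 * C * (1 + C\<^sup>2) * (1 + 2 * (1 + \<beta>\<^sup>2)))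
       * (\<kappa>^3 * (1 + A)^3 * (b \<bullet> b + (1 + A)\<^sup>2 * (a \<bullet> a)))"
proof -
  define P where "P = 1 + A"
  define B where "B = 1 + \<beta>"
  define N where "N = b \<bullet> b + P\<^sup>2 * (a \<bullet> a)"
  have pos: "P > 0" "B > 0" "C > 0" "m > 0" "A \<le> P" "1 \<le> P" using par
    by (auto simp: P_def B_def C_def m_def cross_weight_pos add_pos_pos)
  have N0: "0 \<le> N" by (simp add: N_def)
  have A2: "A\<^sup>2 * P \<le> P^3" "A * P\<^sup>2 \<le> P^3"
    using par unfolding P_def by (auto simp: eval_nat_numeral algebra_simps)
  have AP3: "A\<^sup>2 \<le> P^3" "A^3 \<le> P^3"
    using par unfolding P_def by (auto simp: eval_nat_numeral algebra_simps)
  have Aa: "A * (a \<bullet> a) \<le> N"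
  proof -
    have "A \<le> P\<^sup>2" using par by (simp add: P_def power2_eq_square algebra_simps)
    from mult_right_mono[OF this inner_ge_zero[of a]] show ?thesis
      by (simp add: N_def add_increasing)
  qed
  have WN: "W \<bullet> W \<le> 2 * (1 + \<beta>\<^sup>2) * N"
  proof -
    have "2 * (b \<bullet> (\<beta> * A) *\<^sub>R a) \<le> 1 * (b \<bullet> b) + (\<beta> * A)\<^sup>2 * (a \<bullet> a)"
      by (rule inner_young_scaled) auto
    then have "W \<bullet> W \<le> 2 * (b \<bullet> b) + 2 * (\<beta> * A)\<^sup>2 * (a \<bullet> a)"
      by (simp add: W_def inner_add_left inner_add_right inner_commute power2_eq_square algebra_simps)
    moreover have "(\<beta> * A)\<^sup>2 * (a \<bullet> a) \<le> \<beta>\<^sup>2 * (P\<^sup>2 * (a \<bullet> a))"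
      using par pos by (simp add: power_mult_distrib mult_left_mono mult_right_mono power_mono)
    moreover have "2 * (b \<bullet> b) + 2 * (\<beta>\<^sup>2 * (P\<^sup>2 * (a \<bullet> a))) \<le> 2 * (1 + \<beta>\<^sup>2) * N"
      by (simp add: N_def algebra_simps)
    ultimately show ?thesis by linarith
  qed
  have g1: "(\<gamma> - 1)\<^sup>2 \<le> 1" using par by (intro power_le_one) auto
  have cW: "c \<bullet> c = (\<gamma> - 1)\<^sup>2 * (W \<bullet> W)" by (simp add: c_def power2_eq_square)
  have cN: "c \<bullet> c \<le> 2 * (1 + \<beta>\<^sup>2) * N"
    using mult_right_mono[OF g1 inner_ge_zero[of W]] WN by (simp add: cW)
  have k4: "\<kappa>^4 \<le> \<kappa>^3" using par by (intro power_decreasing) auto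
  have bk: "(\<beta> - \<kappa>)\<^sup>2 \<le> B\<^sup>2" unfolding B_def using par by (intro abs_le_square_iff[THEN iffD1]) auto
  have kk: "\<kappa>^4 * A^3 * (\<beta> - \<kappa>)\<^sup>2 \<le> \<kappa>^3 * P^3 * B\<^sup>2"
    using par pos k4 bk AP3 by (intro mult_mono) auto
  define J where "J = \<kappa>^3 * P^3 * N"
  define D where "D = 2 * (1 + \<beta>\<^sup>2)"
  have D0: "D > 0" by (simp add: D_def add_pos_nonneg)
  have J0: "0 \<le> J" using par pos N0 by (simp add: J_def)
  have t1: "(\<kappa>\<^sup>2 * A) *\<^sub>R c \<bullet> (\<kappa>\<^sup>2 * A) *\<^sub>R c \<le> D * J"
  proof -
    have "(\<kappa>\<^sup>2 * A) *\<^sub>R c \<bullet> (\<kappa>\<^sup>2 * A) *\<^sub>R c = (\<kappa>^4 * A\<^sup>2) * (c \<bullet> c)" by (simp add: eval_nat_numeral)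
    also have "\<dots> \<le> (\<kappa>^3 * P^3) * (D * N)"
      using par pos k4 AP3 cN by (intro mult_mono) (auto simp: D_def)
    finally show ?thesis by (simp add: J_def mult_ac)
  qed
  have t2: "A / (\<gamma> * (\<gamma> - 1)) * ((\<gamma> * \<kappa>\<^sup>2 * A * (\<beta> - \<kappa>)) *\<^sub>R c \<bullet> (\<gamma> * \<kappa>\<^sup>2 * A * (\<beta> - \<kappa>)) *\<^sub>R c)
      \<le> 2 * B\<^sup>2 * D * J"
  proof -
    \<comment> \<open>\<open>c\<close> carries a factor \<open>\<gamma> - 1\<close>, whose square
      outweighs the singular coefficient. Hence the bound stays uniform as \<gamma> tends to
      1.\<close>
    have "A / (\<gamma> * (\<gamma> - 1)) * ((\<gamma> * \<kappa>\<^sup>2 * A * (\<beta> - \<kappa>)) *\<^sub>R c \<bullet> (\<gamma> * \<kappa>\<^sup>2 * A * (\<beta> - \<kappa>)) *\<^sub>R c)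
        = (\<gamma> * (\<gamma> - 1)) * ((\<kappa>^4 * A^3 * (\<beta> - \<kappa>)\<^sup>2) * (W \<bullet> W))"
    proof -
      have "A / (\<gamma> * (\<gamma> - 1)) * ((\<gamma> * X) *\<^sub>R c \<bullet> (\<gamma> * X) *\<^sub>R c) = (\<gamma> * (\<gamma> - 1)) * (A * X\<^sup>2 * (W \<bullet> W))" for X
        using par by (simp add: c_def power2_eq_square)
      from this[of "\<kappa>\<^sup>2 * A * (\<beta> - \<kappa>)"] show ?thesis
        by (simp add: mult.assoc power_mult_distrib eval_nat_numeral)
    qed
    also have "\<dots> \<le> 2 * ((\<kappa>^3 * P^3 * B\<^sup>2) * (D * N))"
    proof (rule mult_mono')
      have "\<gamma> * (\<gamma> - 1) \<le> (5/3) * (2/3)" using par by (intro mult_mono) auto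
      then show "\<gamma> * (\<gamma> - 1) \<le> 2" by simp
      show "\<kappa>^4 * A^3 * (\<beta> - \<kappa>)\<^sup>2 * (W \<bullet> W) \<le> \<kappa>^3 * P^3 * B\<^sup>2 * (D * N)"
        by (rule mult_mono') (use par kk WN in \<open>auto simp: D_def\<close>)
    qed (use par in auto)
    finally show ?thesis by (simp add: J_def mult_ac)
  qed
  have t4: "\<kappa>^4 * A^3 * (\<beta> - \<kappa>)\<^sup>2 / 2 * (c \<bullet> c) \<le> B\<^sup>2 * D * J"
  proof -
    have "\<kappa>^4 * A^3 * (\<beta> - \<kappa>)\<^sup>2 * (c \<bullet> c) \<le> \<kappa>^3 * P^3 * B\<^sup>2 * (D * N)"
      by (rule mult_mono') (use par kk cN in \<open>auto simp: D_def\<close>)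
    moreover have "0 \<le> \<kappa>^4 * A^3 * (\<beta> - \<kappa>)\<^sup>2 * (c \<bullet> c)" using par by simp
    ultimately have "\<kappa>^4 * A^3 * (\<beta> - \<kappa>)\<^sup>2 * (c \<bullet> c) / 2 \<le> \<kappa>^3 * P^3 * B\<^sup>2 * (D * N)" by linarith
    then show ?thesis by (simp add: J_def mult_ac)
  qed
  have mle: "m \<le> C * (P / A)" unfolding m_def C_def P_def by (rule cross_weight_le[OF par(2,1)])
  have mA: "m * A \<le> C * P" using mle par by (simp add: field_simps)
  have t3: "\<kappa>^3 * A\<^sup>2 * (2 / A * cross_energy m A (- c) (- (\<beta> * A) *\<^sub>R c)) \<le> 4 * C * (1 + \<beta>\<^sup>2) * D * J"
  proof -
    \<comment> \<open>At this pair of arguments the cross term equals \<open>- \<beta>A|c|^2\<close>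
      before doubling; its sign is favourable and it is dropped.\<close>
    have "cross_energy m A (- c) (- (\<beta> * A) *\<^sub>R c) \<le> 2 * m * (A + \<beta>\<^sup>2 * A\<^sup>2) * (c \<bullet> c)"
      using par by (simp add: cross_energy_def algebra_simps power2_eq_square)
    then have "\<kappa>^3 * A\<^sup>2 * (2 / A * cross_energy m A (- c) (- (\<beta> * A) *\<^sub>R c))
        \<le> \<kappa>^3 * A\<^sup>2 * (2 / A * (2 * m * (A + \<beta>\<^sup>2 * A\<^sup>2) * (c \<bullet> c)))"
      using par by (intro mult_left_mono) auto
    also have "\<dots> = 4 * \<kappa>^3 * ((m * A) * (A * (1 + \<beta>\<^sup>2 * A)) * (c \<bullet> c))"
      using par by (simp add: field_simps power2_eq_square)
    also have "\<dots> \<le> 4 * \<kappa>^3 * ((C * P) * (A * ((1 + \<beta>\<^sup>2) * P)) * (D * N))"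
    proof -
      have "1 + \<beta>\<^sup>2 * A \<le> (1 + \<beta>\<^sup>2) * P" using par by (simp add: P_def algebra_simps)
      then have "A * (1 + \<beta>\<^sup>2 * A) \<le> A * ((1 + \<beta>\<^sup>2) * P)"
        using par by (intro mult_left_mono) auto
      with mA have "m * A * (A * (1 + \<beta>\<^sup>2 * A)) \<le> C * P * (A * ((1 + \<beta>\<^sup>2) * P))"
        by (rule mult_mono') (use par pos in auto)
      then have "m * A * (A * (1 + \<beta>\<^sup>2 * A)) * (c \<bullet> c) \<le> C * P * (A * ((1 + \<beta>\<^sup>2) * P)) * (D * N)"
        using cN[folded D_def] by (rule mult_mono') (use par pos in auto)
      then show ?thesis using par by (intro mult_left_mono) auto
    qed
    also have "\<dots> = (4 * C * (1 + \<beta>\<^sup>2) * D * \<kappa>^3 * N) * (A * P\<^sup>2)"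
      by (simp add: power2_eq_square)
    also have "\<dots> \<le> (4 * C * (1 + \<beta>\<^sup>2) * D * \<kappa>^3 * N) * P^3"
      using A2(2) par pos D0 N0 by (intro mult_left_mono) auto
    finally show ?thesis by (simp add: J_def mult_ac)
  qed
  have t5: "\<kappa>^3 * A\<^sup>2 * ((8 + 8 * m\<^sup>2 * A) * cross_energy m A a W) \<le> 32 * C * (1 + C\<^sup>2) * (1 + D) * J"
  proof -
    have "cross_energy m A a W \<le> 4 * m * (A * (a \<bullet> a) + W \<bullet> W)"
      unfolding m_def by (rule cross_energy_bounds(2)[OF par(2,1)])
    also have "\<dots> \<le> 4 * m * ((1 + D) * N)"
      using Aa WN pos by (intro mult_left_mono) (auto simp: D_def algebra_simps)
    finally have "\<kappa>^3 * A\<^sup>2 * ((8 + 8 * m\<^sup>2 * A) * cross_energy m A a W)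
        \<le> \<kappa>^3 * A\<^sup>2 * ((8 + 8 * m\<^sup>2 * A) * (4 * m * ((1 + D) * N)))"
      using par pos by (intro mult_left_mono) auto
    also have "\<dots> = (32 * \<kappa>^3 * (1 + D) * N) * ((m * A) * (A + (m * A)\<^sup>2))"
      by (simp add: power2_eq_square algebra_simps)
    also have "\<dots> \<le> (32 * \<kappa>^3 * (1 + D) * N) * ((C * P) * (P\<^sup>2 + (C * P)\<^sup>2))"
    proof -
      have "A \<le> P\<^sup>2" using par by (simp add: P_def power2_eq_square algebra_simps)
      moreover have "(m * A)\<^sup>2 \<le> (C * P)\<^sup>2" using mA par pos by (intro power_mono) auto
      ultimately have "A + (m * A)\<^sup>2 \<le> P\<^sup>2 + (C * P)\<^sup>2" by (rule add_mono)
      with mA have "m * A * (A + (m * A)\<^sup>2) \<le> C * P * (P\<^sup>2 + (C * P)\<^sup>2)"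
        by (rule mult_mono') (use par pos in auto)
      then show ?thesis using par N0 D0 by (intro mult_left_mono) auto
    qed
    also have "\<dots> = 32 * C * (1 + C\<^sup>2) * (1 + D) * J"
      by (simp add: J_def eval_nat_numeral algebra_simps)
    finally show ?thesis .
  qed
  have "(\<kappa>\<^sup>2 * A) *\<^sub>R c \<bullet> (\<kappa>\<^sup>2 * A) *\<^sub>R c
     + A / (\<gamma> * (\<gamma> - 1)) * ((\<gamma> * \<kappa>\<^sup>2 * A * (\<beta> - \<kappa>)) *\<^sub>R c \<bullet> (\<gamma> * \<kappa>\<^sup>2 * A * (\<beta> - \<kappa>)) *\<^sub>R c)
     + (\<kappa>^3 * A\<^sup>2 * (2 / A * cross_energy m A (- c) (- (\<beta> * A) *\<^sub>R c)) + \<kappa>^3 * A\<^sup>2 * ((8 + 8 * m\<^sup>2 * A) * cross_energy m A a W))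
     + \<kappa>^4 * A^3 * (\<beta> - \<kappa>)\<^sup>2 / 2 * (c \<bullet> c)
     \<le> D * J + 2 * B\<^sup>2 * D * J + (4 * C * (1 + \<beta>\<^sup>2) * D * J + 32 * C * (1 + C\<^sup>2) * (1 + D) * J) + B\<^sup>2 * D * J"
    by (intro add_mono t1 t2 t3 t4 t5)
  also have "\<dots> = (D * (1 + 3 * B\<^sup>2 + 4 * C * (1 + \<beta>\<^sup>2)) + 32 * C * (1 + C\<^sup>2) * (1 + D)) * J"
    by (simp add: algebra_simps)
  finally show ?thesis
    unfolding distrib_left[symmetric] J_def D_def N_def B_def P_def by (simp only: mult.assoc)
qed

text \<open>The constant of \<open>initial_energy_bound\<close>. Neither \<kappa> nor \<gamma>
  enters it.\<close>

definition energy_const :: "real \<Rightarrow> real" where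
  "energy_const \<beta> = (let C = \<beta> / 4 + 1 / \<beta> in
     2 * (1 + \<beta>\<^sup>2) * (1 + 3 * (1 + \<beta>)\<^sup>2 + 4 * C * (1 + \<beta>\<^sup>2)) + 32 * C * (1 + C\<^sup>2) * (1 + 2 * (1 + \<beta>\<^sup>2)))"

lemma energy_const_pos: "\<beta> > 0 \<Longrightarrow> energy_const \<beta> > 0"
  unfolding energy_const_def Let_def
  by (intro add_pos_pos mult_pos_pos add_pos_nonneg mult_nonneg_nonneg divide_pos_pos) auto

text \<open>Write the Blackstock operator as \<open>M = (d/dt + \<gamma>\<kappa>A)(d^2/dt^2 +
  \<beta>A d/dt + A) - (\<gamma> - 1)\<kappa>A^2\<close>. Applied to \<open>x\<close> it leaves
  \<open>- (\<gamma> - 1)\<kappa>A^2 x\<close>. The second factor turns \<open>\<kappa>y\<close>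
  into \<open>- (\<gamma> - 1)\<kappa>A q\<close>, and \<open>q' = - Ax\<close> makes the time
  derivative of this cancel that defect, so only order \<kappa>^2 remains. For the layer the order
  \<kappa>^2 cancels as well, because the heat rate \<open>\<kappa>A\<close> is the leading part of
  the slow root of the cubic.\<close>

lemma blackstock_error_pointwise:
  fixes v v1 v2 v3 x x1 x2 y y1 y2 l l1 :: "real \<Rightarrow> complex" and A \<beta> \<gamma> \<kappa> :: real
  assumes par: "A > 0" "\<beta> > 0" "0 < \<kappa>" "\<kappa> < 1" "1 < \<gamma>" "\<gamma> \<le> 5 / 3"
    and v: "\<And>t. t \<ge> 0 \<Longrightarrow> (v has_vector_derivative v1 t) (at t within {0..})"
      "\<And>t. t \<ge> 0 \<Longrightarrow> (v1 has_vector_derivative v2 t) (at t within {0..})"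
      "\<And>t. t \<ge> 0 \<Longrightarrow> (v2 has_vector_derivative v3 t) (at t within {0..})"
    and x: "\<And>t. t \<ge> 0 \<Longrightarrow> (x has_vector_derivative x1 t) (at t within {0..})"
      "\<And>t. t \<ge> 0 \<Longrightarrow> (x1 has_vector_derivative x2 t) (at t within {0..})"
    and y: "\<And>t. t \<ge> 0 \<Longrightarrow> (y has_vector_derivative y1 t) (at t within {0..})"
      "\<And>t. t \<ge> 0 \<Longrightarrow> (y1 has_vector_derivative y2 t) (at t within {0..})"
    and l: "\<And>t. t \<ge> 0 \<Longrightarrow> (l has_vector_derivative l1 t) (at t within {0..})"
  defines "L \<equiv> - complex_of_real A"
  defines "\<delta> \<equiv> \<beta> + (\<gamma> - 1) * \<kappa>"
  assumes v_eq: "\<And>t. t \<ge> 0 \<Longrightarrow> (v3 t - L * v1 t - of_real \<delta> * L * v2 t)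
       - of_real \<kappa> * L * (v2 t - L * v t - of_real \<delta> * L * v1 t)
       + of_real (\<kappa> * (\<gamma> - 1) * (\<beta> - \<kappa>)) * L\<^sup>2 * v1 t = 0"
    and x_eq: "\<And>t. t \<ge> 0 \<Longrightarrow> x2 t - L * x t - of_real \<beta> * L * x1 t = 0"
    and y_eq: "\<And>t. t \<ge> 0 \<Longrightarrow> y2 t - L * y t - of_real \<beta> * L * y1 t
       = of_real (\<gamma> - 1) * L * (x1 t - of_real \<beta> * L * x t)"
    and l_eq: "\<And>t. t \<ge> 0 \<Longrightarrow> l1 t - L * l t = 0"
    and init: "v 0 = a" "v1 0 = b" "v2 0 = of_real \<beta> * (L * b) + L * a" "x 0 = a" "x1 0 = b"
      "y 0 = of_real (1 - \<gamma>) * (b - of_real \<beta> * (L * a))" "y1 0 = 0"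
      "l 0 = of_real (\<gamma> - 1) * (b - of_real \<beta> * (L * a))"
    and t: "t \<ge> 0"
  shows "(norm (v t - (x t + of_real \<kappa> * y t + of_real \<kappa> * l (\<kappa> * t))))\<^sup>2
    \<le> 2 * energy_const \<beta> * (\<kappa>^3 * ((1 + A)^3 / A * ((norm b)\<^sup>2 + (1 + A)\<^sup>2 * (norm a)\<^sup>2)))"
proof -
  let ?A = "complex_of_real A" and ?\<beta> = "complex_of_real \<beta>" and ?\<gamma> = "complex_of_real \<gamma>"
    and ?\<kappa> = "complex_of_real \<kappa>"
  have nz: "?A \<noteq> 0" "?\<gamma> \<noteq> 0" "?\<gamma> \<noteq> 1" using par by auto
  define q where "q t = x1 t + ?\<beta> * ?A * x t" for t
  define z where "z t = y1 t + ?\<beta> * ?A * y t" for t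
  define h where "h t = l (\<kappa> * t)" for t
  define w where "w t = v t - x t - ?\<kappa> * y t - ?\<kappa> * h t" for t
  define p where "p t = v1 t - x1 t - ?\<kappa> * y1 t + ?\<kappa>\<^sup>2 * ?A * h t" for t
  \<comment> \<open>\<open>G\<close> is \<open>w'' + \<beta>Aw' + Aw\<close> with \<open>x2\<close>, \<open>y2\<close> eliminated by their equations, as these are not known
    to be differentiable. \<open>T\<close> is the combination for which the coupling terms cancel in the energy.\<close>
  define G where "G t = v2 t + ?\<beta> * ?A * v1 t + ?A * v t + ?\<kappa> * (?\<gamma> - 1) * ?A * q t
      - ?\<kappa> * (?\<kappa>\<^sup>2 * ?A\<^sup>2 - ?\<beta> * ?\<kappa> * ?A\<^sup>2 + ?A) * h t" for t
  define T where "T t = ?\<gamma> / ?A * G t - (?\<gamma> - 1) * w t" for t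
  \<comment> \<open>This is the factored form of the operator multiplied out. The coefficient of
    \<open>v1\<close> contains no \<kappa>^2 because the contribution of \<delta> cancels that of
    the last term of the equation.\<close>
  have v3: "v3 t = - ?A * v1 t - (?\<beta> + ?\<gamma> * ?\<kappa>) * ?A * v2 t
      - ?\<gamma> * ?\<beta> * ?\<kappa> * ?A\<^sup>2 * v1 t - ?\<kappa> * ?A\<^sup>2 * v t" if "t \<ge> 0" for t
    using v_eq[OF that] by (simp add: L_def \<delta>_def) algebra
  have x2: "x2 t = - ?A * x t - ?\<beta> * ?A * x1 t" if "t \<ge> 0" for t
    using x_eq[OF that] by (simp add: L_def) algebra
  have y2: "y2 t = - ?A * y t - ?\<beta> * ?A * y1 t - (?\<gamma> - 1) * ?A * q t" if "t \<ge> 0" for t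
    using y_eq[OF that] by (simp add: L_def q_def) algebra
  have h: "(h has_vector_derivative - (\<kappa> * A) *\<^sub>R h t) (at t within {0..})" if "t \<ge> 0" for t
  proof -
    have "(l has_vector_derivative l1 (\<kappa> * t)) (at (\<kappa> * t) within (\<lambda>s. \<kappa> * s) ` {0..})"
      using l[of "\<kappa> * t"] that par by (auto intro: has_vector_derivative_within_subset)
    moreover have "((\<lambda>s. \<kappa> * s) has_vector_derivative \<kappa>) (at t within {0..})"
      by (auto intro!: derivative_eq_intros simp flip: has_real_derivative_iff_has_vector_derivative)
    ultimately have "(h has_vector_derivative \<kappa> *\<^sub>R l1 (\<kappa> * t)) (at t within {0..})"
      using vector_diff_chain_within[of "\<lambda>s. \<kappa> * s" \<kappa> t "{0..}" l] by (simp add: o_def h_def[abs_def])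
    moreover have "l1 (\<kappa> * t) = - ?A * h t"
      using l_eq[of "\<kappa> * t"] that par by (simp add: L_def h_def add_eq_0_iff)
    ultimately show ?thesis by (simp add: scaleR_conv_of_real mult.assoc)
  qed
  note d = has_vector_derivative_add has_vector_derivative_diff has_vector_derivative_mult_right v x y h
  have dq: "(q has_vector_derivative - A *\<^sub>R x t) (at t within {0..})" if "t \<ge> 0" for t
  proof -
    have "(q has_vector_derivative x2 t + ?\<beta> * ?A * x1 t) (at t within {0..})"
      unfolding q_def[abs_def] by (intro d that)
    then show ?thesis by (simp add: x2[OF that] scaleR_conv_of_real)
  qed
  have dx: "(x has_vector_derivative q t - (\<beta> * A) *\<^sub>R x t) (at t within {0..})" if "t \<ge> 0" for t
    using x(1)[OF that] by (simp add: q_def scaleR_conv_of_real)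
  have dy: "(y has_vector_derivative z t - (\<beta> * A) *\<^sub>R y t) (at t within {0..})" if "t \<ge> 0" for t
    using y(1)[OF that] by (simp add: z_def scaleR_conv_of_real)
  have dz: "(z has_vector_derivative - A *\<^sub>R (y t + (\<gamma> - 1) *\<^sub>R q t)) (at t within {0..})" if "t \<ge> 0" for t
  proof -
    have "(z has_vector_derivative y2 t + ?\<beta> * ?A * y1 t) (at t within {0..})"
      unfolding z_def[abs_def] by (intro d that)
    moreover have "y2 t + ?\<beta> * ?A * y1 t = - A *\<^sub>R (y t + (\<gamma> - 1) *\<^sub>R q t)"
      by (simp add: y2[OF that] scaleR_conv_of_real algebra_simps)
    ultimately show ?thesis by simp
  qed
  have dw: "(w has_vector_derivative p t) (at t within {0..})" if "t \<ge> 0" for t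
  proof -
    have "(w has_vector_derivative v1 t - x1 t - ?\<kappa> * y1 t - ?\<kappa> * (- (\<kappa> * A) *\<^sub>R h t)) (at t within {0..})"
      unfolding w_def[abs_def] by (intro d that)
    moreover have "v1 t - x1 t - ?\<kappa> * y1 t - ?\<kappa> * (- (\<kappa> * A) *\<^sub>R h t) = p t"
      by (simp add: p_def scaleR_conv_of_real power2_eq_square)
    ultimately show ?thesis by simp
  qed
  have dp: "(p has_vector_derivative - (\<beta> * A) *\<^sub>R p t - (A / \<gamma>) *\<^sub>R (w t - T t)) (at t within {0..})"
    if "t \<ge> 0" for t
  proof -
    have "(p has_vector_derivative v2 t - x2 t - ?\<kappa> * y2 t + ?\<kappa>\<^sup>2 * ?A * (- (\<kappa> * A) *\<^sub>R h t)) (at t within {0..})"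
      unfolding p_def[abs_def] by (intro d that)
    moreover have "v2 t - x2 t - ?\<kappa> * y2 t + ?\<kappa>\<^sup>2 * ?A * (- (\<kappa> * A) *\<^sub>R h t)
        = - (\<beta> * A) *\<^sub>R p t - (A / \<gamma>) *\<^sub>R (w t - T t)"
    proof -
      have e: "(A / \<gamma>) *\<^sub>R (w t - T t) = ?A * w t - G t"
        using nz by (simp add: T_def scaleR_conv_of_real field_simps)
      show ?thesis
        unfolding e x2[OF that] y2[OF that]
        by (simp add: scaleR_conv_of_real w_def G_def p_def q_def) algebra
    qed
    ultimately show ?thesis by simp
  qed
  have dT: "(T has_vector_derivative - (\<gamma> * \<kappa> * A) *\<^sub>R T t - (\<gamma> - 1) *\<^sub>R p t + (\<gamma> * (\<gamma> - 1)) *\<^sub>R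
         ((\<kappa>\<^sup>2 * A) *\<^sub>R (\<gamma> *\<^sub>R q t + y t) + (\<kappa>^3 * A\<^sup>2 * (\<beta> - \<kappa>)) *\<^sub>R h t)) (at t within {0..})"
    if "t \<ge> 0" for t
  proof -
    let ?G' = "v3 t + ?\<beta> * ?A * v2 t + ?A * v1 t + ?\<kappa> * (?\<gamma> - 1) * ?A * (- A *\<^sub>R x t)
      - ?\<kappa> * (?\<kappa>\<^sup>2 * ?A\<^sup>2 - ?\<beta> * ?\<kappa> * ?A\<^sup>2 + ?A) * (- (\<kappa> * A) *\<^sub>R h t)"
    have "(G has_vector_derivative ?G') (at t within {0..})"
      unfolding G_def[abs_def] by (intro d dq that)
    then have "(T has_vector_derivative ?\<gamma> / ?A * ?G' - (?\<gamma> - 1) * p t) (at t within {0..})"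
      unfolding T_def[abs_def] by (intro d dw that)
    moreover have "?\<gamma> / ?A * ?G' - (?\<gamma> - 1) * p t = - (\<gamma> * \<kappa> * A) *\<^sub>R T t - (\<gamma> - 1) *\<^sub>R p t + (\<gamma> * (\<gamma> - 1)) *\<^sub>R
         ((\<kappa>\<^sup>2 * A) *\<^sub>R (\<gamma> *\<^sub>R q t + y t) + (\<kappa>^3 * A\<^sup>2 * (\<beta> - \<kappa>)) *\<^sub>R h t)"
    proof -
      \<comment> \<open>Multiplied by \<open>\<gamma> / A\<close>, the \<open>G\<close> and
        \<open>w\<close> terms together are exactly \<open>- \<gamma>\<kappa>A T\<close>. This is
        why \<open>T\<close> is the right combination: its equation damps \<open>T\<close> itself
        and sees \<open>w\<close> only through \<open>p\<close>.\<close>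
      have *: "?G' = - ?\<gamma> * ?\<kappa> * ?A * G t + ?\<kappa> * (?\<gamma> - 1) * ?A\<^sup>2 * w t
          + ?\<kappa>\<^sup>2 * (?\<gamma> - 1) * ?A\<^sup>2 * (?\<gamma> * q t + y t) + ?\<kappa>^3 * (?\<gamma> - 1) * ?A^3 * (?\<beta> - ?\<kappa>) * h t"
        unfolding v3[OF that]
        by (simp add: scaleR_conv_of_real w_def G_def q_def) algebra
      have "?\<gamma> / ?A * ?G' = - ?\<gamma> * ?\<kappa> * ?A * T t + ?\<gamma> * (?\<gamma> - 1) *
          (?\<kappa>\<^sup>2 * ?A * (?\<gamma> * q t + y t) + ?\<kappa>^3 * ?A\<^sup>2 * (?\<beta> - ?\<kappa>) * h t)"
        unfolding * T_def using nz(1) by (simp add: divide_simps) (simp add: algebra_simps power2_eq_square power3_eq_cube)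
      then show ?thesis by (simp add: scaleR_conv_of_real algebra_simps)
    qed
    ultimately show ?thesis by simp
  qed
  define W where "W = b + (\<beta> * A) *\<^sub>R a"
  define c where "c = (\<gamma> - 1) *\<^sub>R W"
  have i: "w 0 = 0" "p 0 = (\<kappa>\<^sup>2 * A) *\<^sub>R c" "T 0 = (\<gamma> * \<kappa>\<^sup>2 * A * (\<beta> - \<kappa>)) *\<^sub>R c"
    "y 0 = - c" "z 0 = - (\<beta> * A) *\<^sub>R c" "q 0 = W" "h 0 = c"
  proof -
    show y0: "y 0 = - c" by (simp add: init L_def c_def W_def scaleR_conv_of_real algebra_simps)
    show h0: "h 0 = c" by (simp add: h_def init L_def c_def W_def scaleR_conv_of_real algebra_simps)
    show q0: "q 0 = W" by (simp add: q_def init W_def scaleR_conv_of_real)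
    show z0: "z 0 = - (\<beta> * A) *\<^sub>R c" by (simp add: z_def init(7) y0 scaleR_conv_of_real)
    \<comment> \<open>The initial value of \<psi>^(I,1) is opposite to that of the layer, so the two
      corrections of order \<kappa> cancel at time 0.\<close>
    show w0: "w 0 = 0" by (simp add: w_def y0 h0 init)
    show "p 0 = (\<kappa>\<^sup>2 * A) *\<^sub>R c" by (simp add: p_def init h0 scaleR_conv_of_real)
    have cW: "c = (?\<gamma> - 1) * (b + ?\<beta> * ?A * a)" by (simp add: c_def W_def scaleR_conv_of_real)
    \<comment> \<open>By the consistency condition \<open>v2 + \<beta>A v1 + A v\<close> vanishes at
      0. The terms of order \<kappa> cancel because
      \<open>h 0 = (\<gamma> - 1) *\<^sub>R q 0\<close>, which leaves order \<kappa>^2.\<close>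
    have G0: "G 0 = ?\<kappa>\<^sup>2 * ?A\<^sup>2 * (?\<beta> - ?\<kappa>) * c"
      unfolding G_def h0 q0 by (simp add: init L_def cW W_def scaleR_conv_of_real) algebra
    show "T 0 = (\<gamma> * \<kappa>\<^sup>2 * A * (\<beta> - \<kappa>)) *\<^sub>R c"
      unfolding T_def G0 w0 using nz by (simp add: scaleR_conv_of_real field_simps power2_eq_square)
  qed
  have "A / \<gamma> * (w t \<bullet> w t) \<le> energy_const \<beta> * (\<kappa>^3 * (1 + A)^3 * (b \<bullet> b + (1 + A)\<^sup>2 * (a \<bullet> a)))"
    using corrector_error_decay[OF par(1,2,3,5,6) dx dq dy dz h dw dp dT t]
      initial_energy_bound[OF par, of b a]
    unfolding i init energy_const_def Let_def W_def[symmetric] c_def[symmetric] by simp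
  then have "w t \<bullet> w t \<le> \<gamma> / A * (energy_const \<beta> * (\<kappa>^3 * (1 + A)^3 * (b \<bullet> b + (1 + A)\<^sup>2 * (a \<bullet> a))))"
    using par by (simp add: field_simps)
  also have "\<dots> \<le> 2 / A * (energy_const \<beta> * (\<kappa>^3 * (1 + A)^3 * (b \<bullet> b + (1 + A)\<^sup>2 * (a \<bullet> a))))"
    using par energy_const_pos[OF par(2)] by (intro mult_right_mono divide_right_mono) auto
  finally show ?thesis
    by (simp add: w_def h_def power2_norm_eq_inner diff_diff_add add.assoc)
qed

section \<open>Plancherel's identity\<close>

text \<open>\<open>lborel\<close> is the image of the product of one-dimensional Lebesgue measures
  indexed by \<open>Basis\<close>, so products of functions of single coordinates integrate factor
  by factor.\<close>

lemma has_bochner_integral_prod_Basis: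
  fixes f :: "'a::euclidean_space \<Rightarrow> real \<Rightarrow> complex"
  assumes "\<And>b. b \<in> Basis \<Longrightarrow> integrable lborel (f b)"
  shows "has_bochner_integral (lborel :: 'a measure) (\<lambda>x. \<Prod>b\<in>Basis. f b (x \<bullet> b))
    (\<Prod>b\<in>Basis. integral\<^sup>L lborel (f b))"
proof -
  interpret product_sigma_finite "\<lambda>_::'a. lborel :: real measure" ..
  let ?P = "\<Pi>\<^sub>M b\<in>(Basis::'a set). (lborel :: real measure)"
  let ?h = "\<lambda>g. \<Sum>b\<in>Basis. g b *\<^sub>R b :: 'a"
  have h[measurable]: "?h \<in> measurable ?P borel" by measurable
  have [measurable]: "f b \<in> borel_measurable borel" if "b \<in> Basis" for b
    using borel_measurable_integrable[OF assms[OF that]] by simp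
  have "has_bochner_integral ?P (\<lambda>g. \<Prod>b\<in>Basis. f b (g b)) (\<Prod>b\<in>Basis. integral\<^sup>L lborel (f b))"
    unfolding has_bochner_integral_iff using assms
    by (auto intro!: product_integrable_prod product_integral_prod)
  then have "has_bochner_integral ?P (\<lambda>g. \<Prod>b\<in>Basis. f b (?h g \<bullet> b)) (\<Prod>b\<in>Basis. integral\<^sup>L lborel (f b))"
    by (rule has_bochner_integral_cong[THEN iffD1, rotated -1])
       (auto simp: inner_sum_left inner_Basis if_distrib cong: if_cong)
  then have "has_bochner_integral (distr ?P borel ?h) (\<lambda>x. \<Prod>b\<in>Basis. f b (x \<bullet> b)) (\<Prod>b\<in>Basis. integral\<^sup>L lborel (f b))"
    by (subst has_bochner_integral_distr[OF _ h]) (auto simp: o_def)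
  then show ?thesis unfolding lborel_eq[symmetric] .
qed

text \<open>The characteristic function of the standard normal law at \<open>- x\<close>, freed from
  the factor \<open>1 / sqrt (2 * pi)\<close> of its density.\<close>

lemma gauss_fourier_1:
  fixes x :: real
  shows "has_bochner_integral lborel (\<lambda>t::real. exp (- \<i> * of_real (x * t)) * of_real (exp (- t\<^sup>2 / 2)))
    (of_real (sqrt (2 * pi) * exp (- x\<^sup>2 / 2)) :: complex)"
proof -
  let ?f = "\<lambda>t::real. iexp ((-x) * t)"
  have "char std_normal_distribution (-x) = complex_of_real (exp (- (x^2) / 2))"
    by (simp add: char_std_normal_distribution)
  then have "integral\<^sup>L (density lborel std_normal_density) ?f = complex_of_real (exp (- (x^2) / 2))"
    by (simp add: char_def)
  then have 1: "integral\<^sup>L lborel (\<lambda>t. std_normal_density t *\<^sub>R ?f t) = complex_of_real (exp (- (x^2) / 2))"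
    by (subst (asm) integral_density) auto
  have 2: "integrable lborel (\<lambda>t. std_normal_density t *\<^sub>R ?f t)"
    by (rule Bochner_Integration.integrable_bound[OF integrable_normal_density[of 1 0]])
       auto
  have 3: "has_bochner_integral lborel (\<lambda>t. sqrt (2 * pi) *\<^sub>R (std_normal_density t *\<^sub>R ?f t)) (sqrt (2 * pi) *\<^sub>R complex_of_real (exp (- (x^2) / 2)))"
    using 1 2 by (intro has_bochner_integral_scaleR_right) (simp add: has_bochner_integral_iff)
  have "sqrt (2 * pi) *\<^sub>R (std_normal_density t *\<^sub>R ?f t) = exp (- \<i> * of_real (x * t)) * of_real (exp (- t\<^sup>2 / 2))" for t
    by (simp add: std_normal_density_def scaleR_conv_of_real mult_ac)
  with 3 show ?thesis by (metis (no_types, lifting) has_bochner_integral_cong of_real_mult scaleR_conv_of_real)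
qed

lemma gauss_fourier:
  fixes x :: "'a::euclidean_space"
  shows "has_bochner_integral lborel
      (\<lambda>\<xi>. exp (- \<i> * of_real (x \<bullet> \<xi>)) * of_real (exp (- (norm \<xi>)\<^sup>2 / 2)))
      (of_real (sqrt (2 * pi) ^ DIM('a) * exp (- (norm x)\<^sup>2 / 2)) :: complex)"
proof -
  let ?f = "\<lambda>b t. exp (- \<i> * of_real ((x \<bullet> b) * t)) * of_real (exp (- t\<^sup>2 / 2)) :: complex"
  have n: "(norm z)\<^sup>2 = (\<Sum>b\<in>Basis. (z \<bullet> b)\<^sup>2)" for z :: 'a
    unfolding power2_norm_eq_inner by (subst euclidean_inner) (simp add: power2_eq_square)
  have "has_bochner_integral lborel (\<lambda>\<xi>. \<Prod>b\<in>Basis. ?f b (\<xi> \<bullet> b)) (\<Prod>b\<in>Basis. integral\<^sup>L lborel (?f b))"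
    using gauss_fourier_1 by (intro has_bochner_integral_prod_Basis) (auto simp: has_bochner_integral_iff)
  moreover have "(\<Prod>b\<in>Basis. ?f b (\<xi> \<bullet> b)) = exp (- \<i> * of_real (x \<bullet> \<xi>)) * of_real (exp (- (norm \<xi>)\<^sup>2 / 2))" for \<xi>
  proof -
    have "x \<bullet> \<xi> = (\<Sum>b\<in>Basis. (x \<bullet> b) * (\<xi> \<bullet> b))" by (rule euclidean_inner)
    then show ?thesis
      by (simp add: n prod.distrib exp_sum[symmetric] sum_negf sum_distrib_left sum_divide_distrib
          flip: of_real_prod)
  qed
  moreover have "(\<Prod>b\<in>(Basis::'a set). integral\<^sup>L lborel (?f b)) = of_real (sqrt (2 * pi) ^ DIM('a) * exp (- (norm x)\<^sup>2 / 2))"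
  proof -
    have "integral\<^sup>L lborel (?f b) = of_real (sqrt (2 * pi) * exp (- (x \<bullet> b)\<^sup>2 / 2))" for b
      using gauss_fourier_1[of "x \<bullet> b"] by (rule has_bochner_integral_integral_eq)
    then show ?thesis
      by (simp add: n prod.distrib exp_sum[symmetric] sum_negf sum_divide_distrib flip: of_real_prod)
  qed
  ultimately show ?thesis by simp
qed

section \<open>The Fourier integral of integrable functions\<close>

lemma measurable_cnj [measurable]: "cnj \<in> borel_measurable borel"
  by (intro borel_measurable_continuous_onI continuous_intros)

text \<open>Left without normalisation, so that powers of \<open>2 * pi\<close> are settled once, in
  \<open>fourier_const_sq\<close>.\<close>

definition ft :: "('a::euclidean_space \<Rightarrow> complex) \<Rightarrow> 'a \<Rightarrow> complex" where
  "ft f \<xi> = (\<integral>x. exp (- \<i> * of_real (x \<bullet> \<xi>)) * f x \<partial>lborel)"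

lemma norm_exp_i [simp]: "norm (exp (- \<i> * complex_of_real r)) = 1" "norm (exp (- (\<i> * complex_of_real r))) = 1"
  using norm_exp_i_times[of "-r"] by auto

lemma measurable_ft [measurable]:
  fixes f :: "'a::euclidean_space \<Rightarrow> complex"
  assumes [measurable]: "f \<in> borel_measurable borel"
  shows "ft f \<in> borel_measurable borel"
proof -
  have "(\<lambda>\<xi>. \<integral>x. exp (- \<i> * of_real (x \<bullet> \<xi>)) * f x \<partial>lborel) \<in> borel_measurable borel"
    by measurable
  then show ?thesis by (simp add: ft_def[abs_def])
qed

lemma norm_ft_le:
  fixes f :: "'a::euclidean_space \<Rightarrow> complex"
  shows "norm (ft f \<xi>) \<le> (\<integral>x. norm (f x) \<partial>lborel)"
  unfolding ft_def
  by (rule order_trans[OF integral_norm_bound]) (simp add: norm_mult)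

lemma integrable_exp_mult:
  fixes f :: "'a::euclidean_space \<Rightarrow> complex"
  assumes "integrable lborel f"
  shows "integrable lborel (\<lambda>x. exp (- \<i> * of_real (x \<bullet> \<xi>)) * f x)"
proof (rule Bochner_Integration.integrable_bound[OF assms])
  have [measurable]: "f \<in> borel_measurable borel" using borel_measurable_integrable[OF assms] by simp
  show "(\<lambda>x. exp (- \<i> * of_real (x \<bullet> \<xi>)) * f x) \<in> borel_measurable lborel" by measurable
qed (simp add: norm_mult)

text \<open>Fubini for a kernel symmetric in \<open>x\<close> and \<xi>. Moving the transform onto a
  Gaussian factor in this way does the work of an inversion formula.\<close>

lemma ft_multiplication:
  fixes f g :: "'a::euclidean_space \<Rightarrow> complex"
  assumes f: "integrable lborel f" and g: "integrable lborel g"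
  shows "(\<integral>\<xi>. ft f \<xi> * g \<xi> \<partial>lborel) = (\<integral>x. f x * ft g x \<partial>lborel)"
proof -
  have [measurable]: "f \<in> borel_measurable borel" "g \<in> borel_measurable borel"
    using borel_measurable_integrable[OF f] borel_measurable_integrable[OF g] by auto
  let ?h = "\<lambda>x \<xi>. exp (- \<i> * of_real (x \<bullet> \<xi>)) * f x * g \<xi>"
  have int: "integrable (lborel \<Otimes>\<^sub>M lborel) (case_prod ?h)"
  proof (rule lborel_pair.Fubini_integrable)
    show "case_prod ?h \<in> borel_measurable (lborel \<Otimes>\<^sub>M lborel)" by measurable
    show "integrable lborel (\<lambda>x. \<integral>y. norm (case_prod ?h (x, y)) \<partial>lborel)"
      using f by (simp add: norm_mult)
    show "AE x in lborel. integrable lborel (\<lambda>y. case_prod ?h (x, y))"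
    proof (rule AE_I2)
      fix x
      show "integrable lborel (\<lambda>y. case_prod ?h (x, y))"
        using integrable_mult_right[OF integrable_exp_mult[OF g, of x], of "f x"]
        by (simp add: inner_commute mult_ac)
    qed
  qed
  have "(\<integral>\<xi>. ft f \<xi> * g \<xi> \<partial>lborel) = (\<integral>\<xi>. (\<integral>x. ?h x \<xi> \<partial>lborel) \<partial>lborel)"
    by (simp add: ft_def)
  also have "\<dots> = (\<integral>x. (\<integral>\<xi>. ?h x \<xi> \<partial>lborel) \<partial>lborel)"
    by (rule lborel_pair.Fubini_integral[OF int])
  also have "\<dots> = (\<integral>x. f x * ft g x \<partial>lborel)"
  proof (rule Bochner_Integration.integral_cong[OF refl])
    fix x
    have "(\<integral>\<xi>. ?h x \<xi> \<partial>lborel) = (\<integral>\<xi>. f x * (exp (- \<i> * of_real (\<xi> \<bullet> x)) * g \<xi>) \<partial>lborel)"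
      by (intro Bochner_Integration.integral_cong refl) (simp add: inner_commute mult_ac)
    then show "(\<integral>\<xi>. ?h x \<xi> \<partial>lborel) = f x * ft g x" by (simp add: ft_def)
  qed
  finally show ?thesis .
qed

section \<open>Gaussian kernels and Plancherel's identity\<close>

lemma has_bochner_integral_affine:
  fixes f :: "'a::euclidean_space \<Rightarrow> 'b::{banach, second_countable_topology}"
  assumes "has_bochner_integral lborel f I" and "c > 0"
  shows "has_bochner_integral lborel (\<lambda>x. f (t + c *\<^sub>R x)) (I /\<^sub>R c ^ DIM('a))"
proof -
  have [measurable]: "f \<in> borel_measurable borel"
    using assms(1) by (auto simp: has_bochner_integral_iff dest: borel_measurable_integrable)
  have "has_bochner_integral (density (distr lborel borel (\<lambda>x. t + c *\<^sub>R x)) (\<lambda>_. ennreal (c ^ DIM('a)))) f I"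
    using assms lborel_affine[of c t] by simp
  then have "has_bochner_integral (distr lborel borel (\<lambda>x. t + c *\<^sub>R x)) (\<lambda>x. c ^ DIM('a) *\<^sub>R f x) I"
    using assms(2) by (simp add: has_bochner_integral_iff integrable_density integral_density)
  then have "has_bochner_integral lborel (\<lambda>x. c ^ DIM('a) *\<^sub>R f (t + c *\<^sub>R x)) I"
    by (simp add: has_bochner_integral_iff integrable_distr_eq integral_distr)
  from has_bochner_integral_scaleR_right[OF this, of "inverse (c ^ DIM('a))"] show ?thesis
    using assms(2) by simp
qed

text \<open>The transform of \<open>exp (- s^2 |\<xi>|^2 / 2)\<close>. As \<open>s\<close> tends to
  0 it is an approximate identity, of mass \<open>(2 * pi) ^ n\<close> instead of 1.\<close>

definition gauss_kernel :: "real \<Rightarrow> 'a::euclidean_space \<Rightarrow> real" where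
  "gauss_kernel s x = (sqrt (2 * pi) / s) ^ DIM('a) * exp (- (norm x)\<^sup>2 / (2 * s\<^sup>2))"

lemma measurable_gauss_kernel [measurable]: "gauss_kernel s \<in> borel_measurable borel"
  by (simp add: gauss_kernel_def[abs_def])

lemma gauss_kernel_nonneg: "s > 0 \<Longrightarrow> 0 \<le> gauss_kernel s x"
  by (simp add: gauss_kernel_def)

lemma gauss_kernel_minus: "gauss_kernel s (x - y) = gauss_kernel s (y - x)"
  by (simp add: gauss_kernel_def norm_minus_commute)

lemma gauss_damping_integral:
  fixes x :: "'a::euclidean_space"
  assumes "s > 0"
  shows "has_bochner_integral lborel
      (\<lambda>\<xi>. exp (- \<i> * of_real (x \<bullet> \<xi>)) * of_real (exp (- s\<^sup>2 * (norm \<xi>)\<^sup>2 / 2)))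
      (of_real (gauss_kernel s x) :: complex)"
proof -
  have "has_bochner_integral lborel (\<lambda>\<xi>::'a. exp (- \<i> * of_real ((x /\<^sub>R s) \<bullet> (0 + s *\<^sub>R \<xi>))) *
        of_real (exp (- (norm (0 + s *\<^sub>R \<xi>))\<^sup>2 / 2)))
      (of_real (sqrt (2 * pi) ^ DIM('a) * exp (- (norm (x /\<^sub>R s))\<^sup>2 / 2)) /\<^sub>R s ^ DIM('a) :: complex)"
    by (rule has_bochner_integral_affine[OF gauss_fourier assms])
  moreover have "of_real (sqrt (2 * pi) ^ DIM('a) * exp (- (norm (x /\<^sub>R s))\<^sup>2 / 2)) /\<^sub>R s ^ DIM('a)
      = (of_real (gauss_kernel s x) :: complex)"
    using assms by (simp add: gauss_kernel_def scaleR_conv_of_real power_divide power_mult_distrib field_simps)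
  moreover have "(x /\<^sub>R s) \<bullet> (0 + s *\<^sub>R \<xi>) = x \<bullet> \<xi>" "- (norm (0 + s *\<^sub>R \<xi>))\<^sup>2 / 2 = - s\<^sup>2 * (norm \<xi>)\<^sup>2 / 2" for \<xi> :: 'a
    using assms by (simp_all add: power_mult_distrib)
  ultimately show ?thesis by (simp only:)
qed

lemma integral_gauss:
  "has_bochner_integral lborel (\<lambda>\<xi>::'a::euclidean_space. exp (- (norm \<xi>)\<^sup>2 / 2)) (sqrt (2 * pi) ^ DIM('a))"
proof -
  have 1: "has_bochner_integral lborel (\<lambda>\<xi>::'a. complex_of_real (exp (- (norm \<xi>)\<^sup>2 / 2))) (of_real (sqrt (2 * pi) ^ DIM('a)))"
    using gauss_fourier[of "0::'a"] by simp
  from has_bochner_integral_Re[OF this] show ?thesis by simp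
qed

lemma integral_gauss_kernel:
  assumes "s > 0"
  shows "has_bochner_integral lborel (gauss_kernel s :: 'a::euclidean_space \<Rightarrow> real) ((2 * pi) ^ DIM('a))"
proof -
  have "has_bochner_integral lborel (\<lambda>\<xi>::'a. (sqrt (2 * pi) / s) ^ DIM('a) * exp (- (norm (0 + (1/s) *\<^sub>R \<xi>))\<^sup>2 / 2))
     ((sqrt (2 * pi) / s) ^ DIM('a) * (sqrt (2 * pi) ^ DIM('a) /\<^sub>R (1/s) ^ DIM('a)))"
    using assms by (intro has_bochner_integral_mult_right has_bochner_integral_affine integral_gauss) auto
  moreover have "(sqrt (2 * pi) / s) ^ DIM('a) * (sqrt (2 * pi) ^ DIM('a) /\<^sub>R (1/s) ^ DIM('a)) = (2 * pi) ^ DIM('a)"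
  proof -
    have "sqrt (2 * pi) ^ DIM('a) /\<^sub>R (1/s) ^ DIM('a) = (sqrt (2 * pi) * s) ^ DIM('a)"
      using assms by (simp add: power_divide power_mult_distrib)
    then have "(sqrt (2 * pi) / s) ^ DIM('a) * (sqrt (2 * pi) ^ DIM('a) /\<^sub>R (1/s) ^ DIM('a))
        = (sqrt (2 * pi) / s * (sqrt (2 * pi) * s)) ^ DIM('a)"
      by (simp only: power_mult_distrib)
    also have "sqrt (2 * pi) / s * (sqrt (2 * pi) * s) = 2 * pi" using assms by simp
    finally show ?thesis .
  qed
  moreover have "(\<lambda>\<xi>::'a. (sqrt (2 * pi) / s) ^ DIM('a) * exp (- (norm (0 + (1/s) *\<^sub>R \<xi>))\<^sup>2 / 2)) = gauss_kernel s"
    using assms by (simp add: gauss_kernel_def fun_eq_iff power_divide mult.commute)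
  ultimately show ?thesis by simp
qed

text \<open>The transform of an integrable function is a priori only bounded, so a Gaussian damping
  is inserted to make the square integrable. The damped conjugate transform has as its own transform
  the conjugate of an average of \<open>g\<close> over Gaussian kernels, and the multiplication
  formula applies.\<close>

lemma damped_plancherel:
  fixes g :: "'a::euclidean_space \<Rightarrow> complex"
  assumes g: "integrable lborel g" and s: "s > 0"
  shows "integrable lborel (\<lambda>\<xi>. (norm (ft g \<xi>))\<^sup>2 * exp (- s\<^sup>2 * (norm \<xi>)\<^sup>2 / 2))" (is ?I)
    and "of_real (\<integral>\<xi>. (norm (ft g \<xi>))\<^sup>2 * exp (- s\<^sup>2 * (norm \<xi>)\<^sup>2 / 2) \<partial>lborel)
      = (\<integral>x. g x * cnj (\<integral>y. g y * of_real (gauss_kernel s (y - x)) \<partial>lborel) \<partial>lborel)" (is ?E)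
proof -
  have [measurable]: "g \<in> borel_measurable borel" using borel_measurable_integrable[OF g] by auto
  let ?\<phi> = "\<lambda>\<xi>::'a. complex_of_real (exp (- s\<^sup>2 * (norm \<xi>)\<^sup>2 / 2))"
  have phi: "integrable lborel ?\<phi>"
    using gauss_damping_integral[OF s, of "0::'a"] by (simp add: has_bochner_integral_iff)
  let ?B = "\<integral>x. norm (g x) \<partial>lborel"
  have B: "0 \<le> ?B" by simp
  have u: "integrable lborel (\<lambda>\<xi>. cnj (ft g \<xi>) * ?\<phi> \<xi>)"
  proof (rule Bochner_Integration.integrable_bound[OF integrable_mult_right[OF phi, of "of_real ?B"]])
    show "AE \<xi> in lborel. norm (cnj (ft g \<xi>) * ?\<phi> \<xi>) \<le> norm (of_real ?B * ?\<phi> \<xi>)"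
      using B norm_ft_le[of g] by (auto simp: norm_mult intro!: mult_right_mono)
  qed measurable
  have Ic: "integrable lborel (\<lambda>\<xi>. ft g \<xi> * (cnj (ft g \<xi>) * ?\<phi> \<xi>))"
  proof (rule Bochner_Integration.integrable_bound[OF integrable_mult_right[OF u, of "of_real ?B"]])
    show "AE \<xi> in lborel. norm (ft g \<xi> * (cnj (ft g \<xi>) * ?\<phi> \<xi>)) \<le> norm (of_real ?B * (cnj (ft g \<xi>) * ?\<phi> \<xi>))"
      using B norm_ft_le[of g] by (auto simp: norm_mult intro!: mult_right_mono)
  qed measurable
  have eq: "ft g \<xi> * (cnj (ft g \<xi>) * ?\<phi> \<xi>) = of_real ((norm (ft g \<xi>))\<^sup>2 * exp (- s\<^sup>2 * (norm \<xi>)\<^sup>2 / 2))" for \<xi>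
    by (simp only: of_real_mult complex_norm_square mult.assoc)
  show ?I using Ic unfolding eq by (simp only: complex_of_real_integrable_eq)
  have ftu: "ft (\<lambda>\<xi>. cnj (ft g \<xi>) * ?\<phi> \<xi>) x = cnj (\<integral>y. g y * of_real (gauss_kernel s (y - x)) \<partial>lborel)" for x
  proof -
    let ?e = "\<lambda>\<xi>. exp (- \<i> * of_real (\<xi> \<bullet> (- x))) * ?\<phi> \<xi>"
    have e: "integrable lborel ?e" by (rule integrable_exp_mult[OF phi])
    have k: "ft ?e y = of_real (gauss_kernel s (y - x))" for y
    proof -
      have "ft ?e y = (\<integral>\<xi>. exp (- \<i> * of_real ((y - x) \<bullet> \<xi>)) * ?\<phi> \<xi> \<partial>lborel)"
        unfolding ft_def
        by (intro Bochner_Integration.integral_cong refl)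
           (simp add: inner_commute inner_diff_left mult.assoc[symmetric] exp_add[symmetric] algebra_simps)
      then show ?thesis using gauss_damping_integral[OF s, of "y - x"] by (simp add: has_bochner_integral_iff)
    qed
    have "ft (\<lambda>\<xi>. cnj (ft g \<xi>) * ?\<phi> \<xi>) x = (\<integral>\<xi>. cnj (ft g \<xi> * ?e \<xi>) \<partial>lborel)"
      unfolding ft_def[of "\<lambda>\<xi>. cnj (ft g \<xi>) * ?\<phi> \<xi>"]
      by (intro Bochner_Integration.integral_cong refl) (simp add: exp_cnj mult_ac)
    also have "\<dots> = cnj (\<integral>\<xi>. ft g \<xi> * ?e \<xi> \<partial>lborel)" 
      by (rule integral_bounded_linear'[where T' = cnj]) (auto simp: bounded_linear_cnj intro: exI[of _ 1])
    also have "(\<integral>\<xi>. ft g \<xi> * ?e \<xi> \<partial>lborel) = (\<integral>y. g y * of_real (gauss_kernel s (y - x)) \<partial>lborel)"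
      unfolding ft_multiplication[OF g e] k ..
    finally show ?thesis .
  qed
  show ?E using ft_multiplication[OF g u] unfolding eq ftu by (simp only: integral_complex_of_real)
qed

text \<open>True without integrability, since the Bochner integral is then 0 by convention.\<close>

lemma nn_norm_integral_le:
  fixes f :: "'a \<Rightarrow> 'b::{banach, second_countable_topology}"
  shows "ennreal (norm (integral\<^sup>L M f)) \<le> (\<integral>\<^sup>+x. ennreal (norm (f x)) \<partial>M)"
  by (cases "integrable M f") (auto simp: integral_norm_bound_ennreal not_integrable_integral_eq)

lemma nn_integral_gauss_kernel_shift:
  assumes "s > 0"
  shows "(\<integral>\<^sup>+y. ennreal (gauss_kernel s (y - x :: 'a::euclidean_space)) \<partial>lborel) = ennreal ((2 * pi) ^ DIM('a))"
proof -
  have "has_bochner_integral lborel (\<lambda>y. gauss_kernel s (- x + 1 *\<^sub>R y)) ((2 * pi) ^ DIM('a) /\<^sub>R 1 ^ DIM('a))"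
    by (intro has_bochner_integral_affine integral_gauss_kernel assms) simp
  then have "has_bochner_integral lborel (\<lambda>y. gauss_kernel s (y - x)) ((2 * pi) ^ DIM('a))"
    by simp
  then show ?thesis
    using gauss_kernel_nonneg[OF assms]
    by (subst nn_integral_eq_integral) (auto simp: has_bochner_integral_iff)
qed

text \<open>Schur's test: \<open>|g x| |g y|\<close> is at most the half sum of the squares, and in
  each summand one variable integrates the kernel to its mass. Working in \<open>ennreal\<close>
  permits every exchange of integrals.\<close>

lemma gauss_form_le:
  fixes g :: "'a::euclidean_space \<Rightarrow> complex"
  assumes [measurable]: "g \<in> borel_measurable borel"
    and g2: "integrable lborel (\<lambda>x. (norm (g x))\<^sup>2)" and s: "s > 0"
  shows "norm (\<integral>x. g x * cnj (\<integral>y. g y * of_real (gauss_kernel s (y - x)) \<partial>lborel) \<partial>lborel)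
    \<le> (2 * pi) ^ DIM('a) * (\<integral>x. (norm (g x))\<^sup>2 \<partial>lborel)"
proof -
  let ?N = "\<lambda>x. ennreal (norm (g x))" and ?k = "\<lambda>z::'a. ennreal (gauss_kernel s z)"
    and ?S = "\<lambda>x. ennreal ((norm (g x))\<^sup>2 / 2)"
  let ?c = "ennreal ((2 * pi) ^ DIM('a))"
  note k0 = gauss_kernel_nonneg[OF s]
  have "ennreal (norm (\<integral>x. g x * cnj (\<integral>y. g y * of_real (gauss_kernel s (y - x)) \<partial>lborel) \<partial>lborel))
     \<le> (\<integral>\<^sup>+x. ennreal (norm (g x * cnj (\<integral>y. g y * of_real (gauss_kernel s (y - x)) \<partial>lborel))) \<partial>lborel)"
    by (rule nn_norm_integral_le)
  also have "\<dots> \<le> (\<integral>\<^sup>+x. (\<integral>\<^sup>+y. ?N x * (?N y * ?k (y - x)) \<partial>lborel) \<partial>lborel)"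
  proof (rule nn_integral_mono)
    fix x
    have "ennreal (norm (\<integral>y. g y * of_real (gauss_kernel s (y - x)) \<partial>lborel))
        \<le> (\<integral>\<^sup>+y. ennreal (norm (g y * of_real (gauss_kernel s (y - x)))) \<partial>lborel)"
      by (rule nn_norm_integral_le)
    also have "\<dots> = (\<integral>\<^sup>+y. ?N y * ?k (y - x) \<partial>lborel)"
      by (intro nn_integral_cong) (simp add: norm_mult ennreal_mult k0)
    finally have "?N x * ennreal (norm (\<integral>y. g y * of_real (gauss_kernel s (y - x)) \<partial>lborel))
        \<le> ?N x * (\<integral>\<^sup>+y. ?N y * ?k (y - x) \<partial>lborel)"
      by (rule mult_left_mono) simp
    then show "ennreal (norm (g x * cnj (\<integral>y. g y * of_real (gauss_kernel s (y - x)) \<partial>lborel)))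
        \<le> (\<integral>\<^sup>+y. ?N x * (?N y * ?k (y - x)) \<partial>lborel)"
      by (simp add: norm_mult ennreal_mult nn_integral_cmult)
  qed
  also have "\<dots> \<le> (\<integral>\<^sup>+x. (\<integral>\<^sup>+y. ?S x * ?k (y - x) + ?S y * ?k (y - x) \<partial>lborel) \<partial>lborel)"
  proof (intro nn_integral_mono)
    fix x y
    have "0 \<le> (norm (g x) - norm (g y))\<^sup>2" by simp
    then have "norm (g x) * norm (g y) \<le> (norm (g x))\<^sup>2 / 2 + (norm (g y))\<^sup>2 / 2"
      by (simp add: power2_diff)
    from mult_right_mono[OF this k0[of "y - x"]]
    have "norm (g x) * (norm (g y) * gauss_kernel s (y - x))
        \<le> (norm (g x))\<^sup>2 / 2 * gauss_kernel s (y - x) + (norm (g y))\<^sup>2 / 2 * gauss_kernel s (y - x)"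
      by (simp add: algebra_simps)
    then have "ennreal (norm (g x) * (norm (g y) * gauss_kernel s (y - x)))
        \<le> ennreal ((norm (g x))\<^sup>2 / 2 * gauss_kernel s (y - x) + (norm (g y))\<^sup>2 / 2 * gauss_kernel s (y - x))"
      by (rule ennreal_leI)
    then show "?N x * (?N y * ?k (y - x)) \<le> ?S x * ?k (y - x) + ?S y * ?k (y - x)"
      by (subst (asm) ennreal_plus)
         (simp_all add: k0 ennreal_mult del: times_divide_eq_left)
  qed
  also have "\<dots> = (\<integral>\<^sup>+x. (\<integral>\<^sup>+y. ?S x * ?k (y - x) \<partial>lborel) \<partial>lborel) + (\<integral>\<^sup>+x. (\<integral>\<^sup>+y. ?S y * ?k (y - x) \<partial>lborel) \<partial>lborel)"
    by (simp add: nn_integral_add)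
  also have "(\<integral>\<^sup>+x. (\<integral>\<^sup>+y. ?S y * ?k (y - x) \<partial>lborel) \<partial>lborel) = (\<integral>\<^sup>+y. (\<integral>\<^sup>+x. ?S y * ?k (x - y) \<partial>lborel) \<partial>lborel)"
    \<comment> \<open>Evenness of the kernel puts the new inner integral into the same shifted form
      as in the first summand.\<close>
    by (subst lborel_pair.Fubini') (auto simp: gauss_kernel_minus[of s])
  also have "(\<integral>\<^sup>+x. (\<integral>\<^sup>+y. ?S x * ?k (y - x) \<partial>lborel) \<partial>lborel) = (\<integral>\<^sup>+x. ?S x \<partial>lborel) * ?c"
    by (simp add: nn_integral_cmult nn_integral_gauss_kernel_shift[OF s] nn_integral_multc)
  also have "(\<integral>\<^sup>+x. ?S x \<partial>lborel) = ennreal ((\<integral>x. (norm (g x))\<^sup>2 \<partial>lborel) / 2)"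
    using g2 by (subst nn_integral_eq_integral) auto
  finally have "ennreal (norm (\<integral>x. g x * cnj (\<integral>y. g y * of_real (gauss_kernel s (y - x)) \<partial>lborel) \<partial>lborel))
     \<le> ennreal ((\<integral>x. (norm (g x))\<^sup>2 \<partial>lborel) / 2) * ?c + ennreal ((\<integral>x. (norm (g x))\<^sup>2 \<partial>lborel) / 2) * ?c" .
  also have "\<dots> = ennreal ((2 * pi) ^ DIM('a) * (\<integral>x. (norm (g x))\<^sup>2 \<partial>lborel))"
    by (simp add: ennreal_mult[symmetric] ennreal_plus[symmetric] mult.commute del: ennreal_plus)
  finally show ?thesis by (subst (asm) ennreal_le_iff) auto
qed

text \<open>Along \<open>s = 1 / Suc k\<close> the damping increases to 1 while Schur's bound does
  not depend on \<open>s\<close>; monotone convergence then removes the damping.\<close>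

lemma damped_plancherel_limit:
  fixes g :: "'a::euclidean_space \<Rightarrow> complex"
  assumes g: "integrable lborel g" and g2: "integrable lborel (\<lambda>x. (norm (g x))\<^sup>2)"
  shows "integrable lborel (\<lambda>\<xi>. (norm (ft g \<xi>))\<^sup>2)"
    and "(\<integral>\<xi>. (norm (ft g \<xi>))\<^sup>2 \<partial>lborel) \<le> (2 * pi) ^ DIM('a) * (\<integral>x. (norm (g x))\<^sup>2 \<partial>lborel)"
    and "(\<lambda>k. \<integral>x. g x * cnj (\<integral>y. g y * of_real (gauss_kernel (1 / Suc k) (y - x)) \<partial>lborel) \<partial>lborel)
      \<longlonglongrightarrow> of_real (\<integral>\<xi>. (norm (ft g \<xi>))\<^sup>2 \<partial>lborel)"
proof -
  have [measurable]: "g \<in> borel_measurable borel" using borel_measurable_integrable[OF g] by auto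
  let ?s = "\<lambda>k. 1 / real (Suc k)"
  let ?f = "\<lambda>k \<xi>. (norm (ft g \<xi>))\<^sup>2 * exp (- (?s k)\<^sup>2 * (norm \<xi>)\<^sup>2 / 2)"
  let ?a = "\<lambda>k. \<integral>\<xi>. ?f k \<xi> \<partial>lborel"
  let ?C = "(2 * pi) ^ DIM('a) * (\<integral>x. (norm (g x))\<^sup>2 \<partial>lborel)"
  have s: "?s k > 0" for k by simp
  have int: "integrable lborel (?f k)" for k by (rule damped_plancherel(1)[OF g s])
  have eq: "of_real (?a k) = (\<integral>x. g x * cnj (\<integral>y. g y * of_real (gauss_kernel (?s k) (y - x)) \<partial>lborel) \<partial>lborel)" for k
    by (rule damped_plancherel(2)[OF g s])
  have mono: "?f i \<xi> \<le> ?f j \<xi>" if "i \<le> j" for i j \<xi>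
  proof -
    have "(?s j)\<^sup>2 \<le> (?s i)\<^sup>2" using that by (intro power_mono) (auto simp: field_simps)
    then have "(?s j)\<^sup>2 * (norm \<xi>)\<^sup>2 \<le> (?s i)\<^sup>2 * (norm \<xi>)\<^sup>2" by (rule mult_right_mono) simp
    then show ?thesis by (intro mult_left_mono) auto
  qed
  have inc: "incseq ?a"
    by (rule incseq_SucI, rule integral_mono[OF int int], rule mono) simp
  have ub: "?a k \<le> ?C" for k
  proof -
    have "\<bar>?a k\<bar> = norm (complex_of_real (?a k))" by simp
    also have "\<dots> \<le> ?C" unfolding eq by (rule gauss_form_le[OF _ g2 s]) measurable
    finally show ?thesis by simp
  qed
  obtain l where l: "?a \<longlonglongrightarrow> l" "\<And>k. ?a k \<le> l"
    using incseq_convergent[OF inc, of ?C] ub by blast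
  have lim: "(\<lambda>k. ?f k \<xi>) \<longlonglongrightarrow> (norm (ft g \<xi>))\<^sup>2" for \<xi>
  proof -
    have "?s \<longlonglongrightarrow> 0" using LIMSEQ_inverse_real_of_nat by (simp add: inverse_eq_divide)
    then have "(\<lambda>k. ?f k \<xi>) \<longlonglongrightarrow> (norm (ft g \<xi>))\<^sup>2 * exp (- 0\<^sup>2 * (norm \<xi>)\<^sup>2 / 2)"
      by (intro tendsto_intros) auto
    then show ?thesis by simp
  qed
  have "has_bochner_integral lborel (\<lambda>\<xi>. (norm (ft g \<xi>))\<^sup>2) l"
  proof (rule has_bochner_integral_monotone_convergence[OF int _ _ l(1)])
    show "AE \<xi> in lborel. mono (\<lambda>n. ?f n \<xi>)" using mono by (auto simp: mono_def)
    show "AE \<xi> in lborel. (\<lambda>i. ?f i \<xi>) \<longlonglongrightarrow> (norm (ft g \<xi>))\<^sup>2" using lim by auto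
  qed measurable
  then show "integrable lborel (\<lambda>\<xi>. (norm (ft g \<xi>))\<^sup>2)" and L: "(\<integral>\<xi>. (norm (ft g \<xi>))\<^sup>2 \<partial>lborel) \<le> ?C"
    and "(\<lambda>k. \<integral>x. g x * cnj (\<integral>y. g y * of_real (gauss_kernel (1 / Suc k) (y - x)) \<partial>lborel) \<partial>lborel)
      \<longlonglongrightarrow> of_real (\<integral>\<xi>. (norm (ft g \<xi>))\<^sup>2 \<partial>lborel)"
    using LIMSEQ_le_const2[OF l(1), of ?C] ub l(1) unfolding eq[symmetric]
    by (auto simp: has_bochner_integral_iff intro!: tendsto_of_real)
qed

text \<open>Continuity identifies the limit of the quadratic forms, because the Gaussian averages of
  \<open>h\<close> tend to \<open>(2 * pi) ^ n\<close> times \<open>h\<close> at every point.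
  Bounded support makes \<open>h\<close> bounded and integrable, which provides the dominating
  functions.\<close>

lemma plancherel_continuous:
  fixes h :: "'a::euclidean_space \<Rightarrow> complex"
  assumes cont: "continuous_on UNIV h" and supp: "\<And>x. norm x > R \<Longrightarrow> h x = 0"
  shows "integrable lborel h" and "integrable lborel (\<lambda>x. (norm (h x))\<^sup>2)"
    and "(\<integral>\<xi>. (norm (ft h \<xi>))\<^sup>2 \<partial>lborel) = (2 * pi) ^ DIM('a) * (\<integral>x. (norm (h x))\<^sup>2 \<partial>lborel)"
proof -
  have [measurable]: "h \<in> borel_measurable borel"
    by (rule borel_measurable_continuous_onI[OF cont])
  have "bounded (h ` cball 0 R)"
    by (intro compact_imp_bounded compact_continuous_image continuous_on_subset[OF cont]) auto
  then obtain B0 where "\<forall>z\<in>h ` cball 0 R. norm z \<le> B0"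
    unfolding bounded_iff by blast
  then have "norm (h x) \<le> B0" if "norm x \<le> R" for x
    using that by auto
  with supp have "norm (h x) \<le> max 0 B0" for x
    by (cases "norm x \<le> R") (fastforce simp: not_le)+
  then obtain B where B: "B \<ge> 0" "\<And>x. norm (h x) \<le> B"
    by (meson max.cobounded1)
  have bnd: "norm (h x) \<le> B * indicator (cball 0 R) x" for x
    using B supp[of x] by (auto simp: indicator_def)
  have ind: "integrable lborel (indicator (cball (0::'a) R) :: 'a \<Rightarrow> real)"
    by (rule integrable_real_indicator) (use emeasure_bounded_finite[OF bounded_cball] in auto)
  show hi: "integrable lborel h"
    by (rule Bochner_Integration.integrable_bound[OF integrable_mult_right[OF ind, of B]])
       (use bnd B in \<open>auto simp: abs_mult indicator_def\<close>)
  show h2: "integrable lborel (\<lambda>x. (norm (h x))\<^sup>2)"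
  proof (rule Bochner_Integration.integrable_bound[OF integrable_mult_right[OF ind, of "B\<^sup>2"]])
    show "AE x in lborel. norm ((norm (h x))\<^sup>2) \<le> norm (B\<^sup>2 * indicator (cball 0 R) x)"
    proof (rule AE_I2)
      fix x
      show "norm ((norm (h x))\<^sup>2) \<le> norm (B\<^sup>2 * indicator (cball 0 R) x)"
        using B(2)[of x] supp[of x] by (cases "norm x \<le> R") (auto intro!: power_mono)
    qed
  qed measurable
  let ?s = "\<lambda>k. 1 / real (Suc k)"
  let ?G = "\<lambda>z::'a. sqrt (2 * pi) ^ DIM('a) * exp (- (norm z)\<^sup>2 / 2)"
  let ?J = "\<lambda>k x. \<integral>y. h y * of_real (gauss_kernel (?s k) (y - x)) \<partial>lborel"
  let ?c = "(2 * pi) ^ DIM('a)"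
  have s: "?s k > 0" for k by simp
  have s0: "?s \<longlonglongrightarrow> 0" using LIMSEQ_inverse_real_of_nat by (simp add: inverse_eq_divide)
  have G: "has_bochner_integral lborel ?G ?c"
  proof -
    have "sqrt (2 * pi) ^ DIM('a) * sqrt (2 * pi) ^ DIM('a) = (sqrt (2 * pi) * sqrt (2 * pi)) ^ DIM('a)"
      by (rule power_mult_distrib[symmetric])
    also have "sqrt (2 * pi) * sqrt (2 * pi) = 2 * pi" by simp
    finally have "sqrt (2 * pi) ^ DIM('a) * sqrt (2 * pi) ^ DIM('a) = ?c" .
    moreover have "has_bochner_integral lborel ?G (sqrt (2 * pi) ^ DIM('a) * sqrt (2 * pi) ^ DIM('a))"
      by (intro has_bochner_integral_mult_right integral_gauss)
    ultimately show ?thesis by (simp only:)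
  qed
  have GI: "integrable lborel ?G" using G by (simp add: has_bochner_integral_iff)
  have G0: "0 \<le> ?G z" for z by simp
  have Gb: "norm (h y * of_real (?G z)) \<le> B * ?G z" for y z
    unfolding norm_mult norm_of_real abs_of_nonneg[OF G0] by (rule mult_right_mono[OF B(2) G0])
  \<comment> \<open>The substitution \<open>y = x + s z\<close> moves the dependence on
    \<open>k\<close> from the Gaussian into the argument of \<open>h\<close>.\<close>
  have J: "?J k x = (\<integral>z. h (x + ?s k *\<^sub>R z) * of_real (?G z) \<partial>lborel)" for k x
  proof -
    have K: "integrable lborel (\<lambda>y. gauss_kernel (?s k) (y - x))"
      using has_bochner_integral_affine[OF integral_gauss_kernel[OF s[of k]], of 1 "- x"]
      by (simp add: has_bochner_integral_iff)
    have "integrable lborel (\<lambda>y. h y * of_real (gauss_kernel (?s k) (y - x)))"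
      by (rule Bochner_Integration.integrable_bound[OF integrable_mult_right[OF K, of B]])
         (use B gauss_kernel_nonneg[OF s[of k]] in \<open>auto simp: norm_mult abs_mult intro!: mult_right_mono\<close>)
    then have "has_bochner_integral lborel (\<lambda>y. h y * of_real (gauss_kernel (?s k) (y - x))) (?J k x)"
      by (rule has_bochner_integral_integrable)
    from has_bochner_integral_affine[OF this s[of k], of x]
    have "has_bochner_integral lborel (\<lambda>z. h (x + ?s k *\<^sub>R z) * of_real (gauss_kernel (?s k) (?s k *\<^sub>R z)))
        (?J k x /\<^sub>R ?s k ^ DIM('a))" by simp
    from has_bochner_integral_scaleR_right[OF this, of "?s k ^ DIM('a)"]
    have 1: "has_bochner_integral lborel (\<lambda>z. ?s k ^ DIM('a) *\<^sub>R (h (x + ?s k *\<^sub>R z) * of_real (gauss_kernel (?s k) (?s k *\<^sub>R z))))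
        (?J k x)" by simp
    have "?s k ^ DIM('a) *\<^sub>R (h (x + ?s k *\<^sub>R z) * of_real (gauss_kernel (?s k) (?s k *\<^sub>R z)))
        = h (x + ?s k *\<^sub>R z) * of_real (?G z)" for z
    proof -
      have "?s k ^ DIM('a) * gauss_kernel (?s k) (?s k *\<^sub>R z) = ?G z"
        by (simp add: gauss_kernel_def power_divide power_mult_distrib del: of_nat_Suc)
      then have "complex_of_real (?s k ^ DIM('a)) * of_real (gauss_kernel (?s k) (?s k *\<^sub>R z)) = of_real (?G z)"
        by (simp only: of_real_mult[symmetric])
      then show ?thesis by (simp only: scaleR_conv_of_real mult.left_commute[of "complex_of_real (?s k ^ DIM('a))"])
    qed
    with 1 have "has_bochner_integral lborel (\<lambda>z. h (x + ?s k *\<^sub>R z) * of_real (?G z)) (?J k x)"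
      by (simp only:)
    then show ?thesis by (rule has_bochner_integral_integral_eq[symmetric])
  qed
  have Jb: "norm (?J k x) \<le> B * ?c" for k x
  proof -
    have "norm (?J k x) \<le> (\<integral>z. B * ?G z \<partial>lborel)"
      unfolding J
    proof (rule Bochner_Integration.integral_norm_bound_integral)
      show "integrable lborel (\<lambda>z. h (x + ?s k *\<^sub>R z) * of_real (?G z))"
        by (rule Bochner_Integration.integrable_bound[OF integrable_mult_right[OF GI, of B]])
           (measurable, intro AE_I2 order_trans[OF Gb], simp)
      show "integrable lborel (\<lambda>z. B * ?G z)" using G by (simp add: has_bochner_integral_iff)
      show "norm (h (x + ?s k *\<^sub>R z) * of_real (?G z)) \<le> B * ?G z" for z
        by (rule Gb)
    qed
    also have "\<dots> = B * ?c" using G by (simp add: has_bochner_integral_iff)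
    finally show ?thesis .
  qed
  have Jl: "(\<lambda>k. ?J k x) \<longlonglongrightarrow> h x * of_real ?c" for x
  proof -
    have L: "(\<lambda>k. \<integral>z. h (x + ?s k *\<^sub>R z) * of_real (?G z) \<partial>lborel) \<longlonglongrightarrow> (\<integral>z. h x * of_real (?G z) \<partial>lborel)"
    proof (rule integral_dominated_convergence[where w = "\<lambda>z. B * ?G z"])
      show "integrable lborel (\<lambda>z. B * ?G z)" using G by (simp add: has_bochner_integral_iff)
      show "AE z in lborel. (\<lambda>k. h (x + ?s k *\<^sub>R z) * of_real (?G z)) \<longlonglongrightarrow> h x * of_real (?G z)"
      proof (rule AE_I2)
        fix z
        have "(\<lambda>k. x + ?s k *\<^sub>R z) \<longlonglongrightarrow> x + 0 *\<^sub>R z" by (intro tendsto_intros s0)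
        then have "(\<lambda>k. h (x + ?s k *\<^sub>R z)) \<longlonglongrightarrow> h x"
          by (intro continuous_on_tendsto_compose[OF cont]) auto
        then show "(\<lambda>k. h (x + ?s k *\<^sub>R z) * of_real (?G z)) \<longlonglongrightarrow> h x * of_real (?G z)"
          by (rule tendsto_mult_right)
      qed
      show "AE z in lborel. norm (h (x + ?s k *\<^sub>R z) * of_real (?G z)) \<le> B * ?G z" for k
        by (intro AE_I2 Gb)
    qed measurable
    have "(\<integral>z. h x * of_real (?G z) \<partial>lborel) = h x * of_real ?c"
      by (subst integral_mult_right_zero, subst integral_complex_of_real,
          subst has_bochner_integral_integral_eq[OF G], rule refl)
    then show ?thesis unfolding J using L by (simp only:)
  qed
  have "(\<lambda>k. \<integral>x. h x * cnj (?J k x) \<partial>lborel) \<longlonglongrightarrow> (\<integral>x. h x * cnj (h x * of_real ?c) \<partial>lborel)"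
  proof (rule integral_dominated_convergence[where w = "\<lambda>x. norm (h x) * (B * ?c)"])
    show "integrable lborel (\<lambda>x. norm (h x) * (B * ?c))"
      using hi by (intro integrable_mult_left integrable_norm)
    show "AE x in lborel. (\<lambda>k. h x * cnj (?J k x)) \<longlonglongrightarrow> h x * cnj (h x * of_real ?c)"
      by (intro AE_I2 tendsto_intros Jl)
    show "AE x in lborel. norm (h x * cnj (?J k x)) \<le> norm (h x) * (B * ?c)" for k
      using Jb by (auto simp: norm_mult intro!: mult_left_mono)
  qed measurable
  moreover have "(\<integral>x. h x * cnj (h x * of_real ?c) \<partial>lborel) = of_real (?c * (\<integral>x. (norm (h x))\<^sup>2 \<partial>lborel))"
  proof -
    have "h x * cnj (h x * of_real ?c) = of_real (?c * (norm (h x))\<^sup>2)" for x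
      by (simp only: of_real_mult complex_norm_square complex_cnj_mult complex_cnj_complex_of_real mult_ac)
    then have "(\<integral>x. h x * cnj (h x * of_real ?c) \<partial>lborel) = (\<integral>x. of_real (?c * (norm (h x))\<^sup>2) \<partial>lborel)"
      by (simp only:)
    also have "\<dots> = of_real (?c * (\<integral>x. (norm (h x))\<^sup>2 \<partial>lborel))"
      unfolding integral_complex_of_real by simp
    finally show ?thesis .
  qed
  ultimately have "complex_of_real (\<integral>\<xi>. (norm (ft h \<xi>))\<^sup>2 \<partial>lborel) = of_real (?c * (\<integral>x. (norm (h x))\<^sup>2 \<partial>lborel))"
    using LIMSEQ_unique[OF damped_plancherel_limit(3)[OF hi h2]] by (simp only:)
  then show "(\<integral>\<xi>. (norm (ft h \<xi>))\<^sup>2 \<partial>lborel) = ?c * (\<integral>x. (norm (h x))\<^sup>2 \<partial>lborel)"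
    by (simp only: of_real_eq_iff)
qed

section \<open>The L2 norm and density of continuous functions\<close>

lemma square_integrable_measurable: "square_integrable f \<Longrightarrow> f \<in> borel_measurable borel"
  by (simp add: square_integrable_def)

lemma L2_norm_nonneg [simp]: "0 \<le> L2_norm f"
  by (simp add: L2_norm_def)

lemma L2_norm_sq: "(L2_norm f)\<^sup>2 = (\<integral>x. (norm (f x))\<^sup>2 \<partial>lborel)"
  by (simp add: L2_norm_def)

lemma square_integrable_cmult:
  assumes "square_integrable f"
  shows "square_integrable (\<lambda>x. c * f x)" and "L2_norm (\<lambda>x. c * f x) = norm c * L2_norm f"
  using assms by (auto simp: square_integrable_def L2_norm_def norm_mult power_mult_distrib real_sqrt_mult)

lemma square_integrable_add:
  assumes "square_integrable f" "square_integrable g"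
  shows "square_integrable (\<lambda>x. f x + g x)"
proof -
  have [measurable]: "f \<in> borel_measurable borel" "g \<in> borel_measurable borel"
    using assms by (simp_all add: square_integrable_measurable)
  have "integrable lborel (\<lambda>x. (norm (f x + g x))\<^sup>2)"
  proof (rule Bochner_Integration.integrable_bound)
    show "integrable lborel (\<lambda>x. 2 * (norm (f x))\<^sup>2 + 2 * (norm (g x))\<^sup>2)"
      using assms by (simp add: square_integrable_def)
    show "AE x in lborel. norm ((norm (f x + g x))\<^sup>2) \<le> norm (2 * (norm (f x))\<^sup>2 + 2 * (norm (g x))\<^sup>2)"
    proof (rule AE_I2)
      fix x
      have "(norm (f x + g x))\<^sup>2 \<le> (norm (f x) + norm (g x))\<^sup>2"
        by (intro power_mono norm_triangle_ineq) simp
      also have "\<dots> \<le> 2 * (norm (f x))\<^sup>2 + 2 * (norm (g x))\<^sup>2"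
        using sum_squares_bound[of "norm (f x)" "norm (g x)"] by (simp add: power2_sum)
      finally show "norm ((norm (f x + g x))\<^sup>2) \<le> norm (2 * (norm (f x))\<^sup>2 + 2 * (norm (g x))\<^sup>2)" by simp
    qed
  qed measurable
  then show ?thesis by (simp add: square_integrable_def)
qed

text \<open>Pointwise \<open>|f + g|^2 \<le> (1 + b/a)|f|^2 + (1 + a/b)|g|^2\<close>, and if
  \<open>a\<close>, \<open>b\<close> bound the norms, the integral of the right side is at most
  \<open>(a + b)^2\<close>. Enlarging the norms by \<open>e / 2\<close> keeps the quotients
  meaningful when a norm is 0.\<close>

lemma L2_norm_triangle:
  assumes f: "square_integrable f" and g: "square_integrable g"
  shows "L2_norm (\<lambda>x. f x + g x) \<le> L2_norm f + L2_norm g"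
proof (rule field_le_epsilon)
  fix e :: real assume "e > 0"
  define a where "a = L2_norm f + e / 2"
  define b where "b = L2_norm g + e / 2"
  have ab: "a > 0" "b > 0" using \<open>e > 0\<close> by (auto simp: a_def b_def add_nonneg_pos)
  have le: "(L2_norm f)\<^sup>2 \<le> a\<^sup>2" "(L2_norm g)\<^sup>2 \<le> b\<^sup>2"
    using \<open>e > 0\<close> by (auto simp: a_def b_def intro!: power_mono)
  have int: "integrable lborel (\<lambda>x. (norm (f x))\<^sup>2)" "integrable lborel (\<lambda>x. (norm (g x))\<^sup>2)"
    "integrable lborel (\<lambda>x. (norm (f x + g x))\<^sup>2)"
    using f g square_integrable_add[OF f g] by (simp_all add: square_integrable_def)
  have "(L2_norm (\<lambda>x. f x + g x))\<^sup>2 \<le> (\<integral>x. (1 + b / a) * (norm (f x))\<^sup>2 + (1 + a / b) * (norm (g x))\<^sup>2 \<partial>lborel)"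
    unfolding L2_norm_sq
  proof (intro integral_mono int Bochner_Integration.integrable_add integrable_mult_right)
    fix x
    have "(norm (f x + g x))\<^sup>2 \<le> (norm (f x) + norm (g x))\<^sup>2"
      by (intro power_mono norm_triangle_ineq) simp
    also have "\<dots> \<le> (1 + b / a) * (norm (f x))\<^sup>2 + (1 + a / b) * (norm (g x))\<^sup>2"
    proof -
      have "0 \<le> (b * norm (f x) - a * norm (g x))\<^sup>2 / (a * b)" using ab by simp
      also have "\<dots> = b / a * (norm (f x))\<^sup>2 + a / b * (norm (g x))\<^sup>2 - 2 * norm (f x) * norm (g x)"
        using ab by (simp add: field_simps power2_eq_square)
      finally show ?thesis by (simp add: power2_sum algebra_simps)
    qed
    finally show "(norm (f x + g x))\<^sup>2 \<le> (1 + b / a) * (norm (f x))\<^sup>2 + (1 + a / b) * (norm (g x))\<^sup>2" .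
  qed
  also have "\<dots> = (1 + b / a) * (L2_norm f)\<^sup>2 + (1 + a / b) * (L2_norm g)\<^sup>2"
    unfolding L2_norm_sq using int by simp
  also have "\<dots> \<le> (1 + b / a) * a\<^sup>2 + (1 + a / b) * b\<^sup>2"
    using ab le by (intro add_mono mult_left_mono) auto
  also have "\<dots> = (a + b)\<^sup>2" using ab by (simp add: field_simps power2_eq_square)
  finally have "L2_norm (\<lambda>x. f x + g x) \<le> a + b"
    by (rule power2_le_imp_le) (use ab in simp)
  then show "L2_norm (\<lambda>x. f x + g x) \<le> L2_norm f + L2_norm g + e" by (simp add: a_def b_def)
qed

lemma square_integrable_diff:
  "square_integrable f \<Longrightarrow> square_integrable g \<Longrightarrow> square_integrable (\<lambda>x. f x - g x)"
  using square_integrable_add[of f "\<lambda>x. - 1 * g x"] square_integrable_cmult(1)[of g "- 1"] by simp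

lemma L2_norm_diff_commute: "L2_norm (\<lambda>x. f x - g x) = L2_norm (\<lambda>x. g x - f x)"
  by (simp add: L2_norm_def norm_minus_commute)

lemma L2_norm_le_diff:
  assumes "square_integrable f" "square_integrable g"
  shows "L2_norm f \<le> L2_norm (\<lambda>x. f x - g x) + L2_norm g"
  using L2_norm_triangle[OF square_integrable_diff[OF assms] assms(2)] by simp

lemma L2_dominated_convergence:
  fixes f :: "'a::euclidean_space \<Rightarrow> complex"
  assumes [measurable]: "f \<in> borel_measurable borel" "\<And>n. F n \<in> borel_measurable borel"
    and lim: "AE x in lborel. (\<lambda>n. F n x) \<longlonglongrightarrow> f x"
    and w: "integrable lborel w" and bnd: "\<And>n x. (norm (F n x - f x))\<^sup>2 \<le> w x"
  shows "(\<lambda>n. L2_norm (\<lambda>x. F n x - f x)) \<longlonglongrightarrow> 0"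
proof -
  have "(\<lambda>n. \<integral>x. (norm (F n x - f x))\<^sup>2 \<partial>lborel) \<longlonglongrightarrow> (\<integral>x. 0 \<partial>(lborel :: 'a measure))"
  proof (rule integral_dominated_convergence[OF _ _ w])
    show "AE x in lborel. (\<lambda>n. (norm (F n x - f x))\<^sup>2) \<longlonglongrightarrow> 0"
      using lim
    proof eventually_elim
      fix x assume "(\<lambda>n. F n x) \<longlonglongrightarrow> f x"
      then have "(\<lambda>n. (norm (F n x - f x))\<^sup>2) \<longlonglongrightarrow> (norm (f x - f x))\<^sup>2"
        by (intro tendsto_intros)
      then show "(\<lambda>n. (norm (F n x - f x))\<^sup>2) \<longlonglongrightarrow> 0" by simp
    qed
  qed (use bnd in auto)
  from tendsto_real_sqrt[OF this] show ?thesis by (simp add: L2_norm_def)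
qed

text \<open>A measurable function is an almost everywhere limit of continuous ones. Projecting their
  values onto the ball of radius \<open>M\<close> and multiplying by a cut-off that falls from 1 to
  0 between the radii \<open>R\<close> and \<open>R + 1\<close> preserves continuity and the limit,
  and gives all of them one dominating function.\<close>

lemma continuous_dense_bounded:
  fixes g :: "'a::euclidean_space \<Rightarrow> complex"
  assumes [measurable]: "g \<in> borel_measurable borel"
    and supp: "\<And>x. norm x > R \<Longrightarrow> g x = 0" and bnd: "\<And>x. norm (g x) \<le> M" and "e > 0"
  obtains h where "continuous_on UNIV h" "\<And>x. norm x > R + 1 \<Longrightarrow> h x = 0"
    "L2_norm (\<lambda>x. h x - g x) < e"
proof -
  have M: "M \<ge> 0" using norm_ge_zero bnd order_trans by blast
  have "g \<in> borel_measurable lebesgue"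
    by (rule measurable_completion) simp
  then have "g measurable_on UNIV"
    using lebesgue_measurable_imp_measurable_on[of g UNIV] by simp
  then obtain N f where N: "negligible N" and f: "\<And>n. continuous_on UNIV (f n)"
    and lim: "\<And>x. x \<notin> N \<Longrightarrow> (\<lambda>n. f n x) \<longlonglongrightarrow> g x"
    unfolding measurable_on_def by auto
  define c where "c = closest_point (cball (0::complex) M)"
  define cut where "cut x = max 0 (min 1 (R + 1 - norm x))" for x :: 'a
  define h where "h n x = cut x *\<^sub>R c (f n x)" for n x
  have c_cont: "continuous_on UNIV c"
    unfolding c_def using M by (intro continuous_on_closest_point) auto
  have c_le: "norm (c z) \<le> M" for z
    using closest_point_in_set[of "cball (0::complex) M" z] M by (auto simp: c_def)
  have h_cont: "continuous_on UNIV (h n)" for n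
    unfolding h_def[abs_def] cut_def
    by (intro continuous_intros continuous_on_compose2[OF c_cont f]) auto
  have chi: "0 \<le> cut x" "cut x \<le> 1" for x by (auto simp: cut_def)
  have h_supp: "h n x = 0" if "norm x > R + 1" for n x
    using that by (simp add: h_def cut_def)
  have h_le: "norm (h n x) \<le> M" for n x
    using mult_mono[OF chi(2)[of x] c_le[of "f n x"]] chi[of x] M by (simp add: h_def)
  have h_lim: "(\<lambda>n. h n x) \<longlonglongrightarrow> g x" if "x \<notin> N" for x
  proof (cases "norm x > R")
    case False
    have "c (g x) = g x" unfolding c_def using bnd by (intro closest_point_self) auto
    then have "(\<lambda>n. c (f n x)) \<longlonglongrightarrow> g x"
      using continuous_on_tendsto_compose[OF c_cont lim[OF that]] by simp
    then show ?thesis using False by (simp add: h_def cut_def)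
  next
    case True
    have "(\<lambda>n. c (f n x)) \<longlonglongrightarrow> c (g x)"
      using continuous_on_tendsto_compose[OF c_cont lim[OF that]] by simp
    then have "(\<lambda>n. h n x) \<longlonglongrightarrow> cut x *\<^sub>R c (g x)"
      unfolding h_def by (intro tendsto_intros)
    moreover have "c (g x) = g x" unfolding c_def using bnd by (intro closest_point_self) auto
    ultimately show ?thesis using supp[OF True] by simp
  qed
  have [measurable]: "h n \<in> borel_measurable borel" for n
    by (rule borel_measurable_continuous_onI[OF h_cont])
  have "(\<lambda>n. L2_norm (\<lambda>x. h n x - g x)) \<longlonglongrightarrow> 0"
  proof (rule L2_dominated_convergence[where w = "\<lambda>x. (2 * M)\<^sup>2 * indicator (cball 0 (R + 1)) x"])
    have "AE x in lebesgue. x \<notin> N"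
      using N by (intro AE_not_in) (simp add: negligible_iff_null_sets)
    then have "AE x in lborel. x \<notin> N" by (simp add: AE_completion_iff)
    then show "AE x in lborel. (\<lambda>n. h n x) \<longlonglongrightarrow> g x"
      by eventually_elim (rule h_lim)
    show "integrable lborel (\<lambda>x. (2 * M)\<^sup>2 * indicator (cball (0::'a) (R + 1)) x :: real)"
      by (intro integrable_mult_right integrable_real_indicator) (use emeasure_bounded_finite[OF bounded_cball] in auto)
    show "(norm (h n x - g x))\<^sup>2 \<le> (2 * M)\<^sup>2 * indicator (cball 0 (R + 1)) x" for n x
    proof (cases "norm x > R + 1")
      case True
      then show ?thesis using h_supp[OF True] supp[of x] by simp
    next
      case False
      have "norm (h n x - g x) \<le> M + M"
        using h_le bnd by (intro order_trans[OF norm_triangle_ineq4] add_mono)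
      then have "(norm (h n x - g x))\<^sup>2 \<le> (2 * M)\<^sup>2" by (intro power_mono) auto
      then show ?thesis using False by simp
    qed
  qed simp_all
  then have "eventually (\<lambda>n. L2_norm (\<lambda>x. h n x - g x) < e) sequentially"
    using \<open>e > 0\<close> by (rule order_tendstoD(2))
  then obtain n where "L2_norm (\<lambda>x. h n x - g x) < e"
    by (auto simp: eventually_sequentially)
  with h_cont h_supp that show ?thesis by blast
qed

text \<open>Setting \<open>g\<close> to 0 where it exceeds \<open>n\<close> reduces to bounded
  functions.\<close>

lemma continuous_dense:
  fixes g :: "'a::euclidean_space \<Rightarrow> complex"
  assumes g: "square_integrable g" and supp: "\<And>x. norm x > R \<Longrightarrow> g x = 0" and "e > 0"
  obtains h where "continuous_on UNIV h" "\<And>x. norm x > R + 1 \<Longrightarrow> h x = 0"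
    "square_integrable h" "L2_norm (\<lambda>x. h x - g x) < e"
proof -
  have [measurable]: "g \<in> borel_measurable borel" by (rule square_integrable_measurable[OF g])
  define u where "u n x = (if norm (g x) \<le> real n then g x else 0)" for n x
  have [measurable]: "u n \<in> borel_measurable borel" for n unfolding u_def[abs_def] by measurable
  have gi: "integrable lborel (\<lambda>x. (norm (g x))\<^sup>2)" using g by (simp add: square_integrable_def)
  have u: "square_integrable (u n)" for n
    unfolding square_integrable_def
    by (auto intro!: Bochner_Integration.integrable_bound[OF gi]) (auto simp: u_def)
  have "(\<lambda>n. L2_norm (\<lambda>x. u n x - g x)) \<longlonglongrightarrow> 0"
  proof (rule L2_dominated_convergence[OF _ _ _ gi])
    show "AE x in lborel. (\<lambda>n. u n x) \<longlonglongrightarrow> g x"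
    proof (rule AE_I2)
      fix x
      have "eventually (\<lambda>n. norm (g x) \<le> real n) sequentially"
        using eventually_ge_at_top[of "nat \<lceil>norm (g x)\<rceil>"]
        by eventually_elim linarith
      then have "eventually (\<lambda>n. u n x = g x) sequentially"
        by eventually_elim (simp add: u_def)
      then show "(\<lambda>n. u n x) \<longlonglongrightarrow> g x" by (rule tendsto_eventually)
    qed
  qed (auto simp: u_def)
  then have "eventually (\<lambda>n. L2_norm (\<lambda>x. u n x - g x) < e / 2) sequentially"
    using \<open>e > 0\<close> by (intro order_tendstoD(2)) auto
  then obtain n where n: "L2_norm (\<lambda>x. u n x - g x) < e / 2"
    by (auto simp: eventually_sequentially)
  obtain h where h: "continuous_on UNIV h" "\<And>x. norm x > R + 1 \<Longrightarrow> h x = 0"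
    "L2_norm (\<lambda>x. h x - u n x) < e / 2"
  proof (rule continuous_dense_bounded[of "u n" R "real n" "e / 2"])
    show "u n x = 0" if "norm x > R" for x using supp[OF that] by (simp add: u_def)
  qed (use \<open>e > 0\<close> in \<open>auto simp: u_def\<close>)
  have hs: "square_integrable h"
    using plancherel_continuous(2)[OF h(1,2)] borel_measurable_continuous_onI[OF h(1)]
    by (simp add: square_integrable_def)
  have "L2_norm (\<lambda>x. h x - g x) \<le> L2_norm (\<lambda>x. h x - u n x) + L2_norm (\<lambda>x. u n x - g x)"
    using L2_norm_triangle[OF square_integrable_diff[OF hs u[of n]] square_integrable_diff[OF u[of n] g]] by simp
  with n h(3) have "L2_norm (\<lambda>x. h x - g x) < e" by simp
  with h hs that show ?thesis by blast
qed

section \<open>The unitary Fourier integral on square integrable functions\<close>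

lemma fourier_integral_ft:
  "fourier_integral f \<xi> = of_real ((2 * pi) powr (- real DIM('a) / 2)) * ft f \<xi>"
  for f :: "'a::euclidean_space \<Rightarrow> complex"
  by (simp add: fourier_integral_def ft_def)

lemma fourier_const_sq: "((2 * pi) powr (- real n / 2))\<^sup>2 * (2 * pi) ^ n = 1"
proof -
  have "((2 * pi) powr (- real n / 2))\<^sup>2 = (2 * pi) powr (- real n)"
    by (simp add: power2_eq_square flip: powr_add)
  moreover have "(2 * pi) ^ n = (2 * pi) powr real n" by (simp add: powr_realpow)
  ultimately show ?thesis by (simp flip: powr_add)
qed

lemma norm_fourier_integral_sq:
  fixes f :: "'a::euclidean_space \<Rightarrow> complex"
  shows "(norm (fourier_integral f \<xi>))\<^sup>2 = ((2 * pi) powr (- real DIM('a) / 2))\<^sup>2 * (norm (ft f \<xi>))\<^sup>2"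
  by (simp add: fourier_integral_ft norm_mult power_mult_distrib)

lemma fourier_integral_contraction:
  fixes f :: "'a::euclidean_space \<Rightarrow> complex"
  assumes f: "integrable lborel f" "square_integrable f"
  shows "square_integrable (fourier_integral f)" and "L2_norm (fourier_integral f) \<le> L2_norm f"
proof -
  let ?c = "((2 * pi) powr (- real DIM('a) / 2))\<^sup>2"
  have [measurable]: "f \<in> borel_measurable borel" by (rule square_integrable_measurable[OF f(2)])
  have f2: "integrable lborel (\<lambda>x. (norm (f x))\<^sup>2)" using f by (simp add: square_integrable_def)
  have "fourier_integral f \<in> borel_measurable lborel"
    unfolding fourier_integral_ft[abs_def] by measurable
  then show "square_integrable (fourier_integral f)"
    unfolding square_integrable_def norm_fourier_integral_sq
    using damped_plancherel_limit(1)[OF f(1) f2] by (auto intro!: integrable_mult_right)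
  have "(L2_norm (fourier_integral f))\<^sup>2 = ?c * (\<integral>\<xi>. (norm (ft f \<xi>))\<^sup>2 \<partial>lborel)"
    unfolding L2_norm_sq norm_fourier_integral_sq by simp
  also have "\<dots> \<le> ?c * ((2 * pi) ^ DIM('a) * (L2_norm f)\<^sup>2)"
    unfolding L2_norm_sq by (intro mult_left_mono damped_plancherel_limit(2)[OF f(1) f2]) simp
  also have "\<dots> = (L2_norm f)\<^sup>2"
    using fourier_const_sq[of "DIM('a)"] by (simp add: mult.assoc[symmetric])
  finally show "L2_norm (fourier_integral f) \<le> L2_norm f"
    by (rule power2_le_imp_le) simp
qed

lemma fourier_integral_diff:
  assumes "integrable lborel f" "integrable lborel g"
  shows "fourier_integral (\<lambda>x. f x - g x) \<xi> = fourier_integral f \<xi> - fourier_integral g \<xi>"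
  using integrable_exp_mult[OF assms(1), of \<xi>] integrable_exp_mult[OF assms(2), of \<xi>]
  by (simp add: fourier_integral_def algebra_simps)

text \<open>Equality is known for continuous functions of bounded support. Approximating
  \<open>f\<close> by such an \<open>h\<close> changes its norm by less than \<open>e / 2\<close>,
  and by the contraction property the norm of the transform changes by no more.\<close>

lemma fourier_integral_isometry:
  fixes f :: "'a::euclidean_space \<Rightarrow> complex"
  assumes f: "integrable lborel f" "square_integrable f" and supp: "\<And>x. norm x > R \<Longrightarrow> f x = 0"
  shows "L2_norm f \<le> L2_norm (fourier_integral f)"
proof (rule field_le_epsilon)
  fix e :: real assume "e > 0"
  obtain h where h: "continuous_on UNIV h" "\<And>x. norm x > R + 1 \<Longrightarrow> h x = 0"
    "square_integrable h" "L2_norm (\<lambda>x. h x - f x) < e / 2"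
    using continuous_dense[OF f(2) supp half_gt_zero[OF \<open>e > 0\<close>]] by blast
  let ?c = "((2 * pi) powr (- real DIM('a) / 2))\<^sup>2"
  have hi: "integrable lborel h" by (rule plancherel_continuous(1)[OF h(1,2)])
  have "(L2_norm (fourier_integral h))\<^sup>2 = ?c * (\<integral>\<xi>. (norm (ft h \<xi>))\<^sup>2 \<partial>lborel)"
    unfolding L2_norm_sq norm_fourier_integral_sq by simp
  also have "\<dots> = (L2_norm h)\<^sup>2"
  proof -
    have "(\<integral>\<xi>. (norm (ft h \<xi>))\<^sup>2 \<partial>lborel) = (2 * pi) ^ DIM('a) * (L2_norm h)\<^sup>2"
      unfolding L2_norm_sq by (rule plancherel_continuous(3)[OF h(1,2)])
    then show ?thesis
      using fourier_const_sq[of "DIM('a)"] by (simp only: mult.assoc[symmetric] mult_1)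
  qed
  finally have eq: "L2_norm (fourier_integral h) = L2_norm h"
    by (rule power2_eq_imp_eq) auto
  have "L2_norm f \<le> L2_norm (\<lambda>x. f x - h x) + L2_norm h"
    by (rule L2_norm_le_diff[OF f(2) h(3)])
  also have "L2_norm h \<le> L2_norm (\<lambda>\<xi>. fourier_integral h \<xi> - fourier_integral f \<xi>) + L2_norm (fourier_integral f)"
    unfolding eq[symmetric]
    by (intro L2_norm_le_diff fourier_integral_contraction f hi h)
  also have "L2_norm (\<lambda>\<xi>. fourier_integral h \<xi> - fourier_integral f \<xi>) \<le> L2_norm (\<lambda>x. h x - f x)"
    using fourier_integral_contraction(2)[OF Bochner_Integration.integrable_diff[OF hi f(1)]
        square_integrable_diff[OF h(3) f(2)]]
    unfolding fourier_integral_diff[OF hi f(1)] .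
  finally show "L2_norm f \<le> L2_norm (fourier_integral f) + e"
    using h(4) L2_norm_diff_commute[of f h] by simp
qed

section \<open>Calculus of the Fourier-Plancherel transform\<close>

abbreviation trunc :: "('a::euclidean_space \<Rightarrow> complex) \<Rightarrow> real \<Rightarrow> 'a \<Rightarrow> complex" where
  "trunc f R \<equiv> \<lambda>x. indicator (cball 0 R) x * f x"

lemma measurable_trunc:
  "f \<in> borel_measurable borel \<Longrightarrow> trunc f R \<in> borel_measurable borel"
  by (intro borel_measurable_times borel_measurable_indicator) auto

lemma trunc_integrable:
  fixes f :: "'a::euclidean_space \<Rightarrow> complex"
  assumes f: "square_integrable f"
  shows "integrable lborel (trunc f R)" and "square_integrable (trunc f R)"
proof -
  have [measurable]: "f \<in> borel_measurable borel" by (rule square_integrable_measurable[OF f])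
  have f2: "integrable lborel (\<lambda>x. (norm (f x))\<^sup>2)" using f by (simp add: square_integrable_def)
  have ind: "integrable lborel (indicator (cball (0::'a) R) :: 'a \<Rightarrow> real)"
    by (rule integrable_real_indicator) (use emeasure_bounded_finite[OF bounded_cball] in auto)
  show "integrable lborel (trunc f R)"
  proof (rule Bochner_Integration.integrable_bound[OF Bochner_Integration.integrable_add[OF ind f2]])
    show "AE x in lborel. norm (trunc f R x) \<le> norm (indicator (cball 0 R) x + (norm (f x))\<^sup>2)"
    proof (rule AE_I2)
      fix x
      have "0 \<le> (norm (f x) - 1)\<^sup>2" by simp
      then have "2 * norm (f x) \<le> (norm (f x))\<^sup>2 + 1"
        by (simp add: power2_diff)
      then have "norm (f x) \<le> 1 + (norm (f x))\<^sup>2"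
        using norm_ge_zero[of "f x"] by linarith
      then show "norm (trunc f R x) \<le> norm (indicator (cball 0 R) x + (norm (f x))\<^sup>2)"
        by (auto simp: indicator_def)
    qed
  qed (simp add: measurable_trunc)
  have "integrable lborel (\<lambda>x. (norm (trunc f R x))\<^sup>2)"
    by (rule Bochner_Integration.integrable_bound[OF f2])
       (auto simp: indicator_def intro!: borel_measurable_power borel_measurable_norm measurable_trunc)
  then show "square_integrable (trunc f R)"
    by (simp add: square_integrable_def measurable_trunc)
qed

lemma has_fourier_sq: "has_fourier f F \<Longrightarrow> square_integrable f" "has_fourier f F \<Longrightarrow> square_integrable F"
  by (simp_all add: has_fourier_def)

lemma has_fourier_seq:
  assumes "has_fourier f F"
  shows "(\<lambda>n. L2_norm (\<lambda>\<xi>. fourier_integral (trunc f (real n)) \<xi> - F \<xi>)) \<longlonglongrightarrow> 0"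
  using assms filterlim_compose[OF _ filterlim_real_sequentially] by (auto simp: has_fourier_def)

lemma fourier_trunc_sq:
  assumes "square_integrable f"
  shows "square_integrable (fourier_integral (trunc f R))"
  by (intro fourier_integral_contraction trunc_integrable assms)

text \<open>Truncations converge to \<open>f\<close> while their transforms converge to
  \<open>F\<close>, so the isometry bound passes to the limit. This carries the final estimate from
  frequencies back to space.\<close>

lemma has_fourier_L2_norm_le:
  fixes f :: "'a::euclidean_space \<Rightarrow> complex"
  assumes fF: "has_fourier f F"
  shows "L2_norm f \<le> L2_norm F"
proof -
  note f = has_fourier_sq(1)[OF fF] and F = has_fourier_sq(2)[OF fF]
  have [measurable]: "f \<in> borel_measurable borel" by (rule square_integrable_measurable[OF f])
  have f2: "integrable lborel (\<lambda>x. (norm (f x))\<^sup>2)" using f by (simp add: square_integrable_def)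
  have 1: "(\<lambda>n. L2_norm (\<lambda>x. trunc f (real n) x - f x)) \<longlonglongrightarrow> 0"
  proof (rule L2_dominated_convergence[OF _ _ _ f2])
    show "AE x in lborel. (\<lambda>n. trunc f (real n) x) \<longlonglongrightarrow> f x"
    proof (rule AE_I2)
      fix x :: 'a
      have "eventually (\<lambda>n. norm x \<le> real n) sequentially"
        using eventually_ge_at_top[of "nat \<lceil>norm x\<rceil>"] by eventually_elim linarith
      then have "eventually (\<lambda>n. trunc f (real n) x = f x) sequentially"
        by eventually_elim simp
      then show "(\<lambda>n. trunc f (real n) x) \<longlonglongrightarrow> f x" by (rule tendsto_eventually)
    qed
  qed (auto simp: indicator_def)
  have le: "L2_norm f \<le> L2_norm (\<lambda>x. trunc f (real n) x - f x)
      + (L2_norm (\<lambda>\<xi>. fourier_integral (trunc f (real n)) \<xi> - F \<xi>) + L2_norm F)" for n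
  proof -
    have "L2_norm f \<le> L2_norm (\<lambda>x. f x - trunc f (real n) x) + L2_norm (trunc f (real n))"
      by (intro L2_norm_le_diff f trunc_integrable)
    also have "L2_norm (trunc f (real n)) \<le> L2_norm (fourier_integral (trunc f (real n)))"
      by (rule fourier_integral_isometry[OF trunc_integrable[OF f], of "real n"]) simp
    also have "\<dots> \<le> L2_norm (\<lambda>\<xi>. fourier_integral (trunc f (real n)) \<xi> - F \<xi>) + L2_norm F"
      by (intro L2_norm_le_diff fourier_trunc_sq f F)
    finally show ?thesis using L2_norm_diff_commute[of f] by simp
  qed
  have "(\<lambda>n. L2_norm (\<lambda>x. trunc f (real n) x - f x)
      + (L2_norm (\<lambda>\<xi>. fourier_integral (trunc f (real n)) \<xi> - F \<xi>) + L2_norm F)) \<longlonglongrightarrow> 0 + (0 + L2_norm F)"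
    by (intro tendsto_intros 1 has_fourier_seq fF)
  from LIMSEQ_le_const[OF this] le show ?thesis by auto
qed

lemma L2_norm_zero_AE:
  assumes "square_integrable f" "L2_norm f = 0"
  shows "AE x in lborel. f x = 0"
proof -
  have "(\<integral>x. (norm (f x))\<^sup>2 \<partial>lborel) = 0" using assms(2) by (simp add: L2_norm_def)
  then have "AE x in lborel. (norm (f x))\<^sup>2 = 0"
    using assms(1) by (subst (asm) integral_nonneg_eq_0_iff_AE) (auto simp: square_integrable_def)
  then show ?thesis by simp
qed

lemma has_fourier_unique:
  assumes F: "has_fourier f F" and G: "has_fourier f G"
  shows "AE \<xi> in lborel. F \<xi> = G \<xi>"
proof -
  note sq = has_fourier_sq[OF F] has_fourier_sq(2)[OF G]
  have le: "L2_norm (\<lambda>\<xi>. F \<xi> - G \<xi>) \<le> L2_norm (\<lambda>\<xi>. fourier_integral (trunc f (real n)) \<xi> - F \<xi>)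
      + L2_norm (\<lambda>\<xi>. fourier_integral (trunc f (real n)) \<xi> - G \<xi>)" for n
    using L2_norm_triangle[OF square_integrable_diff[OF sq(2) fourier_trunc_sq[OF sq(1)]]
        square_integrable_diff[OF fourier_trunc_sq[OF sq(1)] sq(3)], of "real n" "real n"]
      L2_norm_diff_commute[of F] by simp
  have lim: "(\<lambda>n. L2_norm (\<lambda>\<xi>. fourier_integral (trunc f (real n)) \<xi> - F \<xi>)
      + L2_norm (\<lambda>\<xi>. fourier_integral (trunc f (real n)) \<xi> - G \<xi>)) \<longlonglongrightarrow> 0 + 0"
    by (intro tendsto_intros has_fourier_seq F G)
  from LIMSEQ_le_const[OF lim] le have "L2_norm (\<lambda>\<xi>. F \<xi> - G \<xi>) \<le> 0" by auto
  then have "L2_norm (\<lambda>\<xi>. F \<xi> - G \<xi>) = 0" by (simp add: antisym)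
  from L2_norm_zero_AE[OF square_integrable_diff[OF sq(2,3)] this] show ?thesis by simp
qed

text \<open>\<open>fourier f\<close> is an arbitrary choice, meaningful only once some transform has
  been exhibited.\<close>

lemma has_fourier_fourier: "has_fourier f F \<Longrightarrow> has_fourier f (fourier f)"
  unfolding fourier_def by (rule someI[of "has_fourier f"])

lemma fourier_eq: "has_fourier f F \<Longrightarrow> AE \<xi> in lborel. fourier f \<xi> = F \<xi>"
  by (rule has_fourier_unique[OF has_fourier_fourier])

lemma has_fourier_cmult:
  assumes "has_fourier f F"
  shows "has_fourier (\<lambda>x. c * f x) (\<lambda>\<xi>. c * F \<xi>)"
proof -
  have "fourier_integral (trunc (\<lambda>x. c * f x) R) \<xi> = c * fourier_integral (trunc f R) \<xi>" for R \<xi>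
  proof -
    have "(\<integral>x. exp (- \<i> * of_real (x \<bullet> \<xi>)) * trunc (\<lambda>x. c * f x) R x \<partial>lborel)
        = (\<integral>x. c * (exp (- \<i> * of_real (x \<bullet> \<xi>)) * trunc f R x) \<partial>lborel)"
      by (intro Bochner_Integration.integral_cong refl) (simp only: mult_ac)
    then show ?thesis by (simp add: fourier_integral_def)
  qed
  then have "L2_norm (\<lambda>\<xi>. fourier_integral (trunc (\<lambda>x. c * f x) R) \<xi> - c * F \<xi>)
      = norm c * L2_norm (\<lambda>\<xi>. fourier_integral (trunc f R) \<xi> - F \<xi>)" for R
    using square_integrable_cmult(2)[OF square_integrable_diff[OF fourier_trunc_sq[OF has_fourier_sq(1)[OF assms], of R]
        has_fourier_sq(2)[OF assms]], of c]
    by (simp add: right_diff_distrib)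
  moreover have "((\<lambda>R. norm c * L2_norm (\<lambda>\<xi>. fourier_integral (trunc f R) \<xi> - F \<xi>)) \<longlongrightarrow> norm c * 0) at_top"
    using assms by (intro tendsto_intros) (simp add: has_fourier_def)
  ultimately show ?thesis
    unfolding has_fourier_def using has_fourier_sq[OF assms] by (auto intro: square_integrable_cmult)
qed

lemma has_fourier_add:
  assumes F: "has_fourier f F" and G: "has_fourier g G"
  shows "has_fourier (\<lambda>x. f x + g x) (\<lambda>\<xi>. F \<xi> + G \<xi>)"
proof -
  note sq = has_fourier_sq[OF F] has_fourier_sq[OF G]
  have eq: "fourier_integral (trunc (\<lambda>x. f x + g x) R) \<xi>
      = fourier_integral (trunc f R) \<xi> + fourier_integral (trunc g R) \<xi>" for R \<xi>
    using integrable_exp_mult[OF trunc_integrable(1)[OF sq(1), of R], of \<xi>]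
      integrable_exp_mult[OF trunc_integrable(1)[OF sq(3), of R], of \<xi>]
    by (simp add: fourier_integral_def distrib_left)
  have le: "L2_norm (\<lambda>\<xi>. fourier_integral (trunc (\<lambda>x. f x + g x) R) \<xi> - (F \<xi> + G \<xi>))
      \<le> L2_norm (\<lambda>\<xi>. fourier_integral (trunc f R) \<xi> - F \<xi>) + L2_norm (\<lambda>\<xi>. fourier_integral (trunc g R) \<xi> - G \<xi>)" for R
    using L2_norm_triangle[OF square_integrable_diff[OF fourier_trunc_sq[OF sq(1), of R] sq(2)]
        square_integrable_diff[OF fourier_trunc_sq[OF sq(3), of R] sq(4)]]
    unfolding eq by (simp add: algebra_simps)
  have lim: "((\<lambda>R. L2_norm (\<lambda>\<xi>. fourier_integral (trunc f R) \<xi> - F \<xi>)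
      + L2_norm (\<lambda>\<xi>. fourier_integral (trunc g R) \<xi> - G \<xi>)) \<longlongrightarrow> 0) at_top"
    using F G by (intro tendsto_add_zero) (simp_all add: has_fourier_def)
  have "((\<lambda>R. L2_norm (\<lambda>\<xi>. fourier_integral (trunc (\<lambda>x. f x + g x) R) \<xi> - (F \<xi> + G \<xi>))) \<longlongrightarrow> 0) at_top"
    by (rule tendsto_sandwich[OF always_eventually always_eventually tendsto_const lim]) (use le in simp_all)
  then show ?thesis
    unfolding has_fourier_def using sq by (simp add: square_integrable_add)
qed

lemma has_fourier_diff:
  assumes "has_fourier f F" and "has_fourier g G"
  shows "has_fourier (\<lambda>x. f x - g x) (\<lambda>\<xi>. F \<xi> - G \<xi>)"
  using has_fourier_add[OF assms(1) has_fourier_cmult[OF assms(2), of "- 1"]] by simp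

lemma square_integrable_cong_AE:
  assumes "square_integrable f" "g \<in> borel_measurable borel" "AE x in lborel. g x = f x"
  shows "square_integrable g"
proof -
  have [measurable]: "f \<in> borel_measurable borel" "g \<in> borel_measurable borel"
    using assms square_integrable_measurable by auto
  have "integrable lborel (\<lambda>x. (norm (g x))\<^sup>2) \<longleftrightarrow> integrable lborel (\<lambda>x. (norm (f x))\<^sup>2)"
    by (intro integrable_cong_AE) (use assms(3) in auto)
  then show ?thesis using assms by (simp add: square_integrable_def)
qed

text \<open>Used for \<psi>2, which the consistency condition determines only up to a null
  set.\<close>

lemma has_fourier_cong_AE:
  assumes F: "has_fourier f F" and g: "g \<in> borel_measurable borel" and eq: "AE x in lborel. g x = f x"
  shows "has_fourier g F"
proof -
  have [measurable]: "f \<in> borel_measurable borel" "g \<in> borel_measurable borel"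
    using has_fourier_sq(1)[OF F] g square_integrable_measurable by auto
  have "fourier_integral (trunc g R) = fourier_integral (trunc f R)" for R
  proof
    fix \<xi>
    have "(\<integral>x. exp (- \<i> * of_real (x \<bullet> \<xi>)) * trunc g R x \<partial>lborel)
        = (\<integral>x. exp (- \<i> * of_real (x \<bullet> \<xi>)) * trunc f R x \<partial>lborel)"
    proof (rule integral_cong_AE)
      show "AE x in lborel. exp (- \<i> * of_real (x \<bullet> \<xi>)) * trunc g R x = exp (- \<i> * of_real (x \<bullet> \<xi>)) * trunc f R x"
        using eq by eventually_elim simp
      show "(\<lambda>x. exp (- \<i> * of_real (x \<bullet> \<xi>)) * trunc g R x) \<in> borel_measurable lborel"
        "(\<lambda>x. exp (- \<i> * of_real (x \<bullet> \<xi>)) * trunc f R x) \<in> borel_measurable lborel"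
        by (simp_all add: borel_measurable_times measurable_trunc)
    qed
    then show "fourier_integral (trunc g R) \<xi> = fourier_integral (trunc f R) \<xi>"
      by (simp add: fourier_integral_def)
  qed
  then show ?thesis
    using F square_integrable_cong_AE[OF has_fourier_sq(1)[OF F] g eq] by (simp add: has_fourier_def)
qed

lemma has_fourier_zero: "has_fourier (\<lambda>x. 0) (\<lambda>\<xi>. 0)"
  by (simp add: has_fourier_def square_integrable_def fourier_integral_def L2_norm_def)

text \<open>The transforms of the truncations obey the bound; it passes to the limit because the excess
  of \<open>|F|\<close> over the bound is dominated by the distance to them.\<close>

lemma has_fourier_bound:
  fixes f :: "'a::euclidean_space \<Rightarrow> complex"
  assumes F: "has_fourier f F" and f: "integrable lborel f"
  shows "AE \<xi> in lborel. norm (F \<xi>) \<le> (2 * pi) powr (- real DIM('a) / 2) * L1_norm f"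
proof -
  let ?c = "(2 * pi) powr (- real DIM('a) / 2)"
  define B where "B = ?c * L1_norm f"
  define E where "E \<xi> = max 0 (norm (F \<xi>) - B)" for \<xi>
  note sq = has_fourier_sq[OF F]
  have [measurable]: "F \<in> borel_measurable borel" "f \<in> borel_measurable borel"
    by (rule square_integrable_measurable, fact sq)+
  have "E \<in> borel_measurable borel" unfolding E_def[abs_def] by measurable
  note [measurable] = this
  have B0: "B \<ge> 0" by (simp add: B_def L1_norm_def)
  have b: "norm (fourier_integral (trunc f R) \<xi>) \<le> B" for R \<xi>
  proof -
    have "norm (ft (trunc f R) \<xi>) \<le> (\<integral>x. norm (trunc f R x) \<partial>lborel)" by (rule norm_ft_le)
    also have "\<dots> \<le> L1_norm f"
      unfolding L1_norm_def using f trunc_integrable(1)[OF sq(1), of R]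
      by (intro integral_mono integrable_norm) (auto simp: indicator_def)
    finally show ?thesis by (simp add: fourier_integral_ft norm_mult B_def)
  qed
  have E2: "integrable lborel (\<lambda>\<xi>. (E \<xi>)\<^sup>2)"
  proof (rule Bochner_Integration.integrable_bound)
    show "integrable lborel (\<lambda>\<xi>. (norm (F \<xi>))\<^sup>2)" using sq by (simp add: square_integrable_def)
    show "AE \<xi> in lborel. norm ((E \<xi>)\<^sup>2) \<le> norm ((norm (F \<xi>))\<^sup>2)"
      using B0 by (auto simp: E_def intro!: power_mono)
  qed measurable
  have le: "(\<integral>\<xi>. (E \<xi>)\<^sup>2 \<partial>lborel) \<le> (L2_norm (\<lambda>\<xi>. fourier_integral (trunc f (real n)) \<xi> - F \<xi>))\<^sup>2" for n
    unfolding L2_norm_sq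
  proof (intro integral_mono E2)
    show "integrable lborel (\<lambda>\<xi>. (norm (fourier_integral (trunc f (real n)) \<xi> - F \<xi>))\<^sup>2)"
      using square_integrable_diff[OF fourier_trunc_sq[OF sq(1)] sq(2)] by (simp add: square_integrable_def)
    fix \<xi>
    have "norm (F \<xi>) \<le> norm (fourier_integral (trunc f (real n)) \<xi> - F \<xi>) + norm (fourier_integral (trunc f (real n)) \<xi>)"
      using norm_triangle_sub[of "F \<xi>" "fourier_integral (trunc f (real n)) \<xi>"]
        norm_minus_commute[of "F \<xi>" "fourier_integral (trunc f (real n)) \<xi>"] by simp
    then have "E \<xi> \<le> norm (fourier_integral (trunc f (real n)) \<xi> - F \<xi>)"
      using b[of "real n" \<xi>] by (simp add: E_def)
    then show "(E \<xi>)\<^sup>2 \<le> (norm (fourier_integral (trunc f (real n)) \<xi> - F \<xi>))\<^sup>2"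
      by (intro power_mono) (auto simp: E_def)
  qed
  have lim: "(\<lambda>n. (L2_norm (\<lambda>\<xi>. fourier_integral (trunc f (real n)) \<xi> - F \<xi>))\<^sup>2) \<longlonglongrightarrow> 0\<^sup>2"
    by (intro tendsto_intros has_fourier_seq F)
  from LIMSEQ_le_const[OF lim] le have "(\<integral>\<xi>. (E \<xi>)\<^sup>2 \<partial>lborel) \<le> 0\<^sup>2" by auto
  then have "(\<integral>\<xi>. (E \<xi>)\<^sup>2 \<partial>lborel) = 0"
    by (simp add: antisym)
  then have "AE \<xi> in lborel. (E \<xi>)\<^sup>2 = 0"
    using E2 by (subst (asm) integral_nonneg_eq_0_iff_AE) auto
  then have "AE \<xi> in lborel. norm (F \<xi>) \<le> B"
    by eventually_elim (simp add: E_def)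
  then show ?thesis by (simp add: B_def)
qed

section \<open>From frequencies to the error estimate\<close>

text \<open>On the dyadic shell between the radii \<open>(1/2) ^ Suc k\<close> and
  \<open>(1/2) ^ k\<close> the integrand is at most \<open>4 ^ Suc k\<close>. Enlarging shells to
  balls costs only a constant and leaves volumes that are known explicitly.\<close>

lemma nn_integral_inverse_square_ball:
  assumes "DIM('a::euclidean_space) \<ge> 3"
  shows "(\<integral>\<^sup>+\<xi>. ennreal (indicator (ball 0 1) \<xi> / (norm \<xi>)\<^sup>2) \<partial>(lborel :: 'a measure)) < \<infinity>"
proof -
  let ?B = "\<lambda>k. cball (0::'a) ((1/2) ^ k)"
  let ?V = "unit_ball_vol (real DIM('a))"
  have V: "0 \<le> ?V" by (simp add: unit_ball_vol_nonneg)
  have "(\<integral>\<^sup>+\<xi>. ennreal (indicator (ball 0 1) \<xi> / (norm \<xi>)\<^sup>2) \<partial>(lborel :: 'a measure))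
      \<le> (\<integral>\<^sup>+\<xi>. (\<Sum>k. ennreal (4 ^ Suc k) * indicator (?B k) \<xi>) \<partial>lborel)"
  proof (rule nn_integral_mono)
    fix \<xi> :: 'a
    show "ennreal (indicator (ball 0 1) \<xi> / (norm \<xi>)\<^sup>2) \<le> (\<Sum>k. ennreal (4 ^ Suc k) * indicator (?B k) \<xi>)"
    proof (cases "\<xi> \<noteq> 0 \<and> norm \<xi> < 1")
      case False
      then have "indicator (ball 0 1) \<xi> / (norm \<xi>)\<^sup>2 = (0 :: real)"
        by (cases "\<xi> = 0") simp_all
      then show ?thesis by (simp only: ennreal_0 zero_le)
    next
      case True
      let ?P = "\<lambda>k. (1/2) ^ Suc k \<le> norm \<xi>"
      obtain n where "(1/2) ^ n < norm \<xi>"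
        using True real_arch_pow_inv[of "norm \<xi>" "1/2"] by auto
      moreover have "(1/2 :: real) ^ Suc n \<le> (1/2) ^ n" by simp
      ultimately have "?P n" by linarith
      \<comment> \<open>Minimality of \<open>k\<close> places \<xi> in the ball of radius
        \<open>(1/2) ^ k\<close>; for \<open>k = 0\<close> this is the case assumption
        \<open>norm \<xi> < 1\<close>.\<close>
      define k where "k = (LEAST k. ?P k)"
      have k: "?P k" unfolding k_def by (rule LeastI[of ?P, OF \<open>?P n\<close>])
      have in_B: "\<xi> \<in> ?B k"
      proof (cases k)
        case 0
        then show ?thesis using True by auto
      next
        case (Suc j)
        then have "\<not> ?P j" using not_less_Least[of j ?P] by (simp add: k_def)
        then show ?thesis using Suc by simp
      qed
      have "1 / (norm \<xi>)\<^sup>2 \<le> 4 ^ Suc k"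
      proof -
        have "((1/2) ^ Suc k)\<^sup>2 \<le> (norm \<xi>)\<^sup>2" using k by (intro power_mono) auto
        also have "((1/2::real) ^ Suc k)\<^sup>2 = ((1/2) * (1/2)) ^ Suc k"
          by (simp only: power2_eq_square power_mult_distrib)
        finally have "inverse ((norm \<xi>)\<^sup>2) \<le> inverse (((1/2) * (1/2)) ^ Suc k)"
          by (rule le_imp_inverse_le) simp
        also have "inverse (((1/2) * (1/2 :: real)) ^ Suc k) = inverse ((1/2) * (1/2)) ^ Suc k"
          by (rule power_inverse[symmetric])
        also have "inverse ((1/2) * (1/2 :: real)) = 4" by simp
        finally show ?thesis by (simp add: inverse_eq_divide)
      qed
      then have "ennreal (indicator (ball 0 1) \<xi> / (norm \<xi>)\<^sup>2) \<le> ennreal (4 ^ Suc k) * indicator (?B k) \<xi>"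
        using True in_B by (auto intro!: ennreal_leI)
      also have "\<dots> = (\<Sum>k\<in>{k}. ennreal (4 ^ Suc k) * indicator (?B k) \<xi>)"
        by (simp only: sum.insert finite.emptyI empty_iff not_False_eq_True sum.empty add_0_right)
      also have "\<dots> \<le> (\<Sum>k. ennreal (4 ^ Suc k) * indicator (?B k) \<xi>)"
        by (rule sum_le_suminf) (simp_all only: summableI finite.insertI finite.emptyI zero_le)
      finally show ?thesis .
    qed
  qed
  also have "\<dots> = (\<Sum>k. \<integral>\<^sup>+\<xi>. ennreal (4 ^ Suc k) * indicator (?B k) \<xi> \<partial>lborel)"
    by (rule nn_integral_suminf) (auto intro!: borel_measurable_times_ennreal borel_measurable_indicator)
  also have "\<dots> \<le> (\<Sum>k. ennreal (4 * ?V * (1/2) ^ k))"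
  proof (rule suminf_le)
    fix k
    have "(\<integral>\<^sup>+\<xi>. ennreal (4 ^ Suc k) * indicator (?B k) \<xi> \<partial>lborel) = ennreal (4 ^ Suc k * (?V * ((1/2) ^ k) ^ DIM('a)))"
      by (simp add: nn_integral_cmult_indicator emeasure_cball V ennreal_mult)
    also have "\<dots> \<le> ennreal (4 * ?V * (1/2) ^ k)"
    proof (rule ennreal_leI)
      \<comment> \<open>The dimension enters here: volumes shrink at least like
        \<open>8^(-k)\<close>, against a growth of \<open>4^k\<close>, and a geometric series of
        ratio 1/2 remains.\<close>
      have "((1/2::real) ^ k) ^ DIM('a) \<le> ((1/2) ^ k) ^ 3"
        using assms by (intro power_decreasing) (auto simp: power_le_one)
      then have "4 ^ Suc k * (?V * ((1/2) ^ k) ^ DIM('a)) \<le> 4 ^ Suc k * (?V * ((1/2) ^ k) ^ 3)"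
        using V by (intro mult_left_mono) auto
      also have "((1/2::real) ^ k) ^ 3 = (1/4) ^ k * (1/2) ^ k"
      proof -
        have "(1/4 :: real) ^ k = (1/2 * (1/2)) ^ k" by simp
        then show ?thesis by (simp only: power3_eq_cube power_mult_distrib)
      qed
      also have "4 ^ Suc k * (?V * ((1/4) ^ k * (1/2) ^ k)) = 4 * ?V * ((4 * (1/4)) ^ k * (1/2) ^ k)"
        unfolding power_mult_distrib by simp
      finally show "4 ^ Suc k * (?V * ((1/2) ^ k) ^ DIM('a)) \<le> 4 * ?V * (1/2) ^ k" by simp
    qed
    finally show "(\<integral>\<^sup>+\<xi>. ennreal (4 ^ Suc k) * indicator (?B k) \<xi> \<partial>lborel) \<le> ennreal (4 * ?V * (1/2) ^ k)" .
  qed auto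
  also have "\<dots> = ennreal (\<Sum>k. 4 * ?V * (1/2) ^ k)"
    using V by (intro suminf_ennreal2) (auto intro!: summable_mult summable_geometric)
  also have "\<dots> < \<infinity>" by simp
  finally show ?thesis .
qed

lemma integrable_inverse_square_ball:
  assumes "DIM('a::euclidean_space) \<ge> 3"
  shows "integrable (lborel :: 'a measure) (\<lambda>\<xi>. indicator (ball 0 1) \<xi> / (norm \<xi>)\<^sup>2)"
proof (rule integrableI_bounded)
  show "(\<lambda>\<xi>::'a. indicator (ball 0 1) \<xi> / (norm \<xi>)\<^sup>2 :: real) \<in> borel_measurable lborel"
    by (intro borel_measurable_divide borel_measurable_indicator) auto
qed (use nn_integral_inverse_square_ball[OF assms] in simp)

text \<open>For \<open>A < 1\<close> the two powers of \<open>1 + A\<close> are at most 8 and 4,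
  whence 32. For \<open>A \<ge> 1\<close> the denominator is absorbed by
  \<open>1 + A \<le> 2A\<close>. The exponents 5 and 3 are those of the Sobolev norms of the
  data.\<close>

lemma frequency_weight_le:
  fixes A u v :: real
  assumes "A > 0" "u \<ge> 0" "v \<ge> 0"
  shows "(1 + A)^3 / A * (u + (1 + A)\<^sup>2 * v)
    \<le> 32 * ((1 + A)^5 * v + (1 + A)^3 * u + (if A < 1 then 1 / A * (u + v) else 0))"
proof (cases "A < 1")
  case True
  have "(1 + A)^3 \<le> 2^3" "(1 + A)\<^sup>2 \<le> 2\<^sup>2" using assms True by (intro power_mono; simp)+
  then have "(1 + A)^3 / A * (u + (1 + A)\<^sup>2 * v) \<le> 8 / A * (4 * u + 4 * v)"
    using assms by (intro mult_mono divide_right_mono add_mono) (auto intro: mult_right_mono)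
  also have "\<dots> = 32 * (1 / A * (u + v))" by (simp add: field_simps)
  also have "\<dots> \<le> 32 * ((1 + A)^5 * v + (1 + A)^3 * u + (if A < 1 then 1 / A * (u + v) else 0))"
    using True assms by simp
  finally show ?thesis .
next
  case False
  have "(1 + A)^3 / A \<le> 2 * (1 + A)\<^sup>2"
  proof -
    have "(1 + A)\<^sup>2 * (1 + A) \<le> (1 + A)\<^sup>2 * (2 * A)" using False by (intro mult_left_mono) auto
    then show ?thesis using assms by (simp add: pos_divide_le_eq power2_eq_square power3_eq_cube mult_ac)
  qed
  also have "\<dots> \<le> 2 * (1 + A)^3" using assms by (intro mult_left_mono power_increasing) auto
  finally have "(1 + A)^3 / A * (u + (1 + A)\<^sup>2 * v) \<le> 2 * (1 + A)^3 * (u + (1 + A)\<^sup>2 * v)"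
    using assms by (intro mult_right_mono) auto
  also have "\<dots> = 2 * ((1 + A)^5 * v + (1 + A)^3 * u)" by (simp add: eval_nat_numeral algebra_simps)
  also have "\<dots> \<le> 32 * ((1 + A)^5 * v + (1 + A)^3 * u)" using assms by (intro mult_right_mono) auto
  finally show ?thesis using False by simp
qed

text \<open>The transform that witnesses membership in the Sobolev space agrees almost everywhere
  with the chosen \<open>fourier f\<close>, to which the weighted bound is transferred.\<close>

lemma sobolev_weight:
  fixes f :: "'a::euclidean_space \<Rightarrow> complex"
  assumes "f \<in> sobolev (real k)"
  shows "has_fourier f (fourier f)"
    and "integrable lborel (\<lambda>\<xi>. (1 + (norm \<xi>)\<^sup>2) ^ k * (norm (fourier f \<xi>))\<^sup>2)"
    and "(\<integral>\<xi>. (1 + (norm \<xi>)\<^sup>2) ^ k * (norm (fourier f \<xi>))\<^sup>2 \<partial>lborel) = (sobolev_norm (real k) f)\<^sup>2"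
proof -
  obtain F where F: "has_fourier f F"
    and w: "square_integrable (\<lambda>\<xi>. of_real ((1 + (norm \<xi>)\<^sup>2) powr (real k / 2)) * F \<xi>)"
    using assms by (auto simp: sobolev_def)
  show ff: "has_fourier f (fourier f)" by (rule has_fourier_fourier[OF F])
  have [measurable]: "fourier f \<in> borel_measurable borel"
    by (rule square_integrable_measurable[OF has_fourier_sq(2)[OF ff]])
  have eq: "(norm (of_real ((1 + (norm \<xi>)\<^sup>2) powr (real k / 2)) * fourier f \<xi>))\<^sup>2
      = (1 + (norm \<xi>)\<^sup>2) ^ k * (norm (fourier f \<xi>))\<^sup>2" for \<xi>
  proof -
    have pos: "0 < 1 + (norm \<xi>)\<^sup>2" by (simp add: add_pos_nonneg)
    have "((1 + (norm \<xi>)\<^sup>2) powr (real k / 2))\<^sup>2 = (1 + (norm \<xi>)\<^sup>2) ^ k"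
      using pos by (simp add: power2_eq_square powr_realpow flip: powr_add)
    then show ?thesis by (simp add: norm_mult power_mult_distrib)
  qed
  have "square_integrable (\<lambda>\<xi>. of_real ((1 + (norm \<xi>)\<^sup>2) powr (real k / 2)) * fourier f \<xi>)"
  proof (rule square_integrable_cong_AE[OF w])
    show "AE \<xi> in lborel. of_real ((1 + (norm \<xi>)\<^sup>2) powr (real k / 2)) * fourier f \<xi>
        = of_real ((1 + (norm \<xi>)\<^sup>2) powr (real k / 2)) * F \<xi>"
      using fourier_eq[OF F] by eventually_elim simp
  qed measurable
  then show "integrable lborel (\<lambda>\<xi>. (1 + (norm \<xi>)\<^sup>2) ^ k * (norm (fourier f \<xi>))\<^sup>2)"
    by (simp only: square_integrable_def eq)
  show "(\<integral>\<xi>. (1 + (norm \<xi>)\<^sup>2) ^ k * (norm (fourier f \<xi>))\<^sup>2 \<partial>lborel) = (sobolev_norm (real k) f)\<^sup>2"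
    unfolding sobolev_norm_def L2_norm_sq eq ..
qed

section \<open>Transforms of the solutions and the error bound\<close>

lemma at_within_Ici_neq_bot: "0 \<le> t \<Longrightarrow> at t within {0::real..} \<noteq> bot"
proof -
  assume "0 \<le> t"
  then have "at_right t \<le> at t within {0..}" by (intro at_le) auto
  then show ?thesis using trivial_limit_at_right_real[of t] by (metis bot.extremum_uniqueI)
qed

text \<open>\<open>interior_corrector\<close> brings its own transform of \<psi>^(0), which agrees
  with the one of the wave equation only off a null set that may depend on \<open>t\<close>.
  Countably many rational times share one null set, and for almost every \<xi> both transforms are
  continuous in time, so agreement spreads to all times and then to the derivatives.\<close>

lemma partial_fourier_unique:
  assumes p: "partial_fourier u p" "time_derivative p p1"
    and x: "partial_fourier u x" "time_derivative x x1"
  shows "AE \<xi> in lborel. \<forall>t\<ge>0. p t \<xi> = x t \<xi> \<and> p1 t \<xi> = x1 t \<xi>"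
proof -
  have "AE \<xi> in lborel. \<forall>r\<in>\<rat> \<inter> {0..}. p r \<xi> = x r \<xi>"
  proof (subst AE_ball_countable)
    show "countable (\<rat> \<inter> {0::real..})" by (rule countable_Int1[OF countable_rat])
    show "\<forall>r\<in>\<rat> \<inter> {0..}. AE \<xi> in lborel. p r \<xi> = x r \<xi>"
    proof
      fix r :: real assume "r \<in> \<rat> \<inter> {0..}"
      then have "has_fourier (u r) (p r)" "has_fourier (u r) (x r)"
        using p(1) x(1) by (auto simp: partial_fourier_def)
      then show "AE \<xi> in lborel. p r \<xi> = x r \<xi>" by (rule has_fourier_unique)
    qed
  qed
  moreover have "AE \<xi> in lborel. \<forall>t\<ge>0. ((\<lambda>s. p s \<xi>) has_vector_derivative p1 t \<xi>) (at t within {0..})"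
    using p(2) by (simp add: time_derivative_def)
  moreover have "AE \<xi> in lborel. \<forall>t\<ge>0. ((\<lambda>s. x s \<xi>) has_vector_derivative x1 t \<xi>) (at t within {0..})"
    using x(2) by (simp add: time_derivative_def)
  ultimately show ?thesis
  proof eventually_elim
    fix \<xi>
    assume r: "\<forall>r\<in>\<rat> \<inter> {0..}. p r \<xi> = x r \<xi>"
      and dp: "\<forall>t\<ge>0. ((\<lambda>s. p s \<xi>) has_vector_derivative p1 t \<xi>) (at t within {0..})"
      and dx: "\<forall>t\<ge>0. ((\<lambda>s. x s \<xi>) has_vector_derivative x1 t \<xi>) (at t within {0..})"
    have eq: "p t \<xi> = x t \<xi>" if "t \<ge> 0" for t
    proof (rule ccontr)
      assume "p t \<xi> \<noteq> x t \<xi>"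
      then have ne: "p t \<xi> - x t \<xi> \<noteq> 0" by simp
      have "((\<lambda>s. p s \<xi> - x s \<xi>) \<longlongrightarrow> p t \<xi> - x t \<xi>) (at t within {0..})"
        using has_vector_derivative_continuous[of _ _ t "{0..}"] dp dx that
        unfolding continuous_within by (intro tendsto_diff) blast+
      from tendsto_imp_eventually_ne[OF this ne]
      obtain d where d: "d > 0" "\<forall>s\<in>{0..}. s \<noteq> t \<and> dist s t < d \<longrightarrow> p s \<xi> - x s \<xi> \<noteq> 0"
        unfolding eventually_at by blast
      \<comment> \<open>A rational to the right of \<open>t\<close> lies in the half-line even for
        \<open>t = 0\<close>.\<close>
      obtain q where "q \<in> \<rat>" "t < q" "q < t + d"
        using Rats_dense_in_real[of t "t + d"] d(1) by auto
      then show False using d(2) r that by (auto simp: dist_real_def)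
    qed
    have "p1 t \<xi> = x1 t \<xi>" if "t \<ge> 0" for t
    proof -
      have "((\<lambda>s. x s \<xi>) has_vector_derivative p1 t \<xi>) (at t within {0..})"
        using dp[rule_format, OF that] that eq
        by (intro has_vector_derivative_transform[of t "{0..}" "\<lambda>s. x s \<xi>" "\<lambda>s. p s \<xi>"]) auto
      then show ?thesis
        using vector_derivative_unique_within[OF at_within_Ici_neq_bot[OF that]] dx that by blast
    qed
    with eq show "\<forall>t\<ge>0. p t \<xi> = x t \<xi> \<and> p1 t \<xi> = x1 t \<xi>" by blast
  qed
qed

lemma lap_eq: "lap \<xi> = - complex_of_real ((norm \<xi>)\<^sup>2)"
  by (simp add: lap_def)

lemma AE_lborel_nonzero: "AE \<xi> in (lborel :: 'a::euclidean_space measure). \<xi> \<noteq> 0"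
  by (rule AE_lborel_singleton)

text \<open>Equations, derivatives and initial values each hold off a null set that does not depend
  on time. Finitely many such sets are discarded together with \<open>\<xi> = 0\<close>, where
  \<open>A\<close> would vanish, and the estimate at a fixed frequency applies to the rest.\<close>

lemma error_transform_bound:
  fixes \<psi>0 :: "'a::euclidean_space \<Rightarrow> complex"
  assumes par: "\<beta> = b * \<nu>" "\<beta> > 0" "1 < \<gamma>" "\<gamma> \<le> 5 / 3" "0 < \<kappa>" "\<kappa> < 1"
    and data: "\<psi>2 \<in> borel_measurable lborel"
      "has_laplacian \<psi>0 lap\<psi>0" "has_laplacian \<psi>1 lap\<psi>1"
      "AE x in lborel. \<psi>2 x = of_real (b * \<nu>) * lap\<psi>1 x + lap\<psi>0 x"
    and wave: "damped_wave_solution (b * \<nu>) (\<lambda>t \<xi>. 0) \<psi>0 \<psi>1 \<psi>00"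
    and corr: "interior_corrector b \<nu> \<gamma> \<psi>00 (\<lambda>x. \<psi>1 x - of_real (b * \<nu>) * lap\<psi>0 x) \<psi>I1"
    and heat: "heat_solution (\<lambda>x. of_real (\<gamma> - 1) * (\<psi>1 x - of_real (b * \<nu>) * lap\<psi>0 x)) \<psi>L1"
    and sol: "blackstock_solution b \<nu> \<gamma> \<kappa> \<psi>0 \<psi>1 \<psi>2 \<psi>"
    and t: "0 \<le> t"
  obtains w where "has_fourier (\<lambda>x. \<psi> t x -
      (\<psi>00 t x + of_real \<kappa> * \<psi>I1 t x + of_real \<kappa> * \<psi>L1 (\<kappa> * t) x)) w"
    and "AE \<xi> in lborel. (norm (w \<xi>))\<^sup>2 \<le> 2 * energy_const \<beta> * (\<kappa>^3 * ((1 + (norm \<xi>)\<^sup>2)^3 / (norm \<xi>)\<^sup>2 *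
      ((norm (fourier \<psi>1 \<xi>))\<^sup>2 + (1 + (norm \<xi>)\<^sup>2)\<^sup>2 * (norm (fourier \<psi>0 \<xi>))\<^sup>2)))"
proof -
  let ?L = "lap :: 'a \<Rightarrow> complex"
  obtain v v1 v2 v3 where v: "partial_fourier \<psi> v" "time_derivative v v1" "time_derivative v1 v2"
      "time_derivative v2 v3" "initially v \<psi>0" "initially v1 \<psi>1" "initially v2 \<psi>2"
      "AE \<xi> in lborel. \<forall>t\<ge>0.
           (v3 t \<xi> - lap \<xi> * v1 t \<xi> - of_real (b * \<nu> + (\<gamma> - 1) * \<kappa>) * lap \<xi> * v2 t \<xi>)
           - of_real \<kappa> * lap \<xi> * (v2 t \<xi> - lap \<xi> * v t \<xi> - of_real (b * \<nu> + (\<gamma> - 1) * \<kappa>) * lap \<xi> * v1 t \<xi>)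
           + of_real (\<kappa> * (\<gamma> - 1) * (b * \<nu> - \<kappa>)) * (lap \<xi>)\<^sup>2 * v1 t \<xi> = 0"
    using sol unfolding blackstock_solution_def Let_def by blast
  obtain x x1 x2 where x: "partial_fourier \<psi>00 x" "time_derivative x x1" "time_derivative x1 x2"
      "initially x \<psi>0" "initially x1 \<psi>1"
      "AE \<xi> in lborel. \<forall>t\<ge>0. x2 t \<xi> - lap \<xi> * x t \<xi> - of_real (b * \<nu>) * lap \<xi> * x1 t \<xi> = 0"
    using wave unfolding damped_wave_solution_def by blast
  obtain p p1 where p: "partial_fourier \<psi>00 p" "time_derivative p p1"
    and "damped_wave_solution (b * \<nu>)
          (\<lambda>t \<xi>. of_real (\<gamma> - 1) * lap \<xi> * (p1 t \<xi> - of_real (b * \<nu>) * lap \<xi> * p t \<xi>))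
          (\<lambda>x. of_real (1 - \<gamma>) * (\<psi>1 x - of_real (b * \<nu>) * lap\<psi>0 x)) (\<lambda>x. 0) \<psi>I1"
    using corr unfolding interior_corrector_def by blast
  then obtain y y1 y2 where y: "partial_fourier \<psi>I1 y" "time_derivative y y1" "time_derivative y1 y2"
      "initially y (\<lambda>x. of_real (1 - \<gamma>) * (\<psi>1 x - of_real (b * \<nu>) * lap\<psi>0 x))" "initially y1 (\<lambda>x. 0)"
      "AE \<xi> in lborel. \<forall>t\<ge>0. y2 t \<xi> - lap \<xi> * y t \<xi> - of_real (b * \<nu>) * lap \<xi> * y1 t \<xi>
         = of_real (\<gamma> - 1) * lap \<xi> * (p1 t \<xi> - of_real (b * \<nu>) * lap \<xi> * p t \<xi>)"
    unfolding damped_wave_solution_def by blast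
  obtain l l1 where l: "partial_fourier \<psi>L1 l" "time_derivative l l1"
      "initially l (\<lambda>x. of_real (\<gamma> - 1) * (\<psi>1 x - of_real (b * \<nu>) * lap\<psi>0 x))"
      "AE \<xi> in lborel. \<forall>z\<ge>0. l1 z \<xi> - lap \<xi> * l z \<xi> = 0"
    using heat unfolding heat_solution_def by blast
  obtain G0 where G0: "has_fourier \<psi>0 G0" "has_fourier lap\<psi>0 (\<lambda>\<xi>. ?L \<xi> * G0 \<xi>)"
    using data(2) unfolding has_laplacian_def by blast
  obtain G1 where G1: "has_fourier \<psi>1 G1" "has_fourier lap\<psi>1 (\<lambda>\<xi>. ?L \<xi> * G1 \<xi>)"
    using data(3) unfolding has_laplacian_def by blast
  let ?W = "\<lambda>\<xi>. G1 \<xi> - of_real (b * \<nu>) * (?L \<xi> * G0 \<xi>)"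
  have W: "has_fourier (\<lambda>x. c * (\<psi>1 x - of_real (b * \<nu>) * lap\<psi>0 x)) (\<lambda>\<xi>. c * ?W \<xi>)" for c
    by (intro has_fourier_cmult has_fourier_diff G0 G1)
  have P2: "has_fourier \<psi>2 (\<lambda>\<xi>. of_real (b * \<nu>) * (?L \<xi> * G1 \<xi>) + ?L \<xi> * G0 \<xi>)"
    by (rule has_fourier_cong_AE[OF has_fourier_add[OF has_fourier_cmult[OF G1(2)] G0(2)] _ data(4)])
       (use data(1) in simp)
  note ae = v(2,3,4,8) x(2,3,6) y(2,3,6) l(2,4) v(5-7)[unfolded initially_def] x(4,5)[unfolded initially_def]
    y(4,5)[unfolded initially_def] l(3)[unfolded initially_def]
  define w where "w \<xi> = v t \<xi> - (x t \<xi> + of_real \<kappa> * y t \<xi> + of_real \<kappa> * l (\<kappa> * t) \<xi>)" for \<xi>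
  have "AE \<xi> in lborel. (norm (w \<xi>))\<^sup>2 \<le> 2 * energy_const \<beta> * (\<kappa>^3 * ((1 + (norm \<xi>)\<^sup>2)^3 / (norm \<xi>)\<^sup>2 *
      ((norm (fourier \<psi>1 \<xi>))\<^sup>2 + (1 + (norm \<xi>)\<^sup>2)\<^sup>2 * (norm (fourier \<psi>0 \<xi>))\<^sup>2)))"
    using ae[unfolded time_derivative_def] partial_fourier_unique[OF p x(1,2)] AE_lborel_nonzero
      fourier_eq[OF G0(1)] fourier_eq[OF G1(1)] fourier_eq[OF P2] fourier_eq[OF W[of "of_real (1 - \<gamma>)"]]
      fourier_eq[OF W[of "of_real (\<gamma> - 1)"]] fourier_eq[OF has_fourier_zero]
  proof eventually_elim
    case (elim \<xi>)
    let ?A = "(norm \<xi>)\<^sup>2"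
    have A: "?A > 0" using \<open>\<xi> \<noteq> 0\<close> by simp
    show ?case
      unfolding w_def
      by (rule blackstock_error_pointwise[where v = "\<lambda>t. v t \<xi>" and ?v1.0 = "\<lambda>t. v1 t \<xi>" and ?v2.0 = "\<lambda>t. v2 t \<xi>"
            and ?v3.0 = "\<lambda>t. v3 t \<xi>" and x = "\<lambda>t. x t \<xi>" and ?x1.0 = "\<lambda>t. x1 t \<xi>" and ?x2.0 = "\<lambda>t. x2 t \<xi>"
            and y = "\<lambda>t. y t \<xi>" and ?y1.0 = "\<lambda>t. y1 t \<xi>" and ?y2.0 = "\<lambda>t. y2 t \<xi>"
            and l = "\<lambda>t. l t \<xi>" and ?l1.0 = "\<lambda>t. l1 t \<xi>" and A = ?A and \<beta> = \<beta> and \<gamma> = \<gamma> and \<kappa> = \<kappa>,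
            OF A par(2,5,6,3,4)])
         (use elim t in \<open>simp_all only: lap_eq[symmetric] par(1)\<close>)
  qed
  moreover have "has_fourier (\<lambda>x. \<psi> t x -
      (\<psi>00 t x + of_real \<kappa> * \<psi>I1 t x + of_real \<kappa> * \<psi>L1 (\<kappa> * t) x)) w"
    unfolding w_def[abs_def]
    by (intro has_fourier_diff has_fourier_add has_fourier_cmult)
       (use v(1) x(1) y(1) l(1) t par(5) in \<open>auto simp: partial_fourier_def\<close>)
  ultimately show ?thesis using that by blast
qed

lemma weighted_L2_bound:
  fixes w f0 f1 :: "'a::euclidean_space \<Rightarrow> complex"
  assumes dim: "DIM('a) \<ge> 3" and D: "D \<ge> 0" and w: "square_integrable w"
    and f: "f0 \<in> sobolev 5" "integrable lborel f0" "f1 \<in> sobolev 3" "integrable lborel f1"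
    and le: "AE \<xi> in lborel. (norm (w \<xi>))\<^sup>2 \<le> D * ((1 + (norm \<xi>)\<^sup>2)^3 / (norm \<xi>)\<^sup>2 *
      ((norm (fourier f1 \<xi>))\<^sup>2 + (1 + (norm \<xi>)\<^sup>2)\<^sup>2 * (norm (fourier f0 \<xi>))\<^sup>2))"
  shows "(L2_norm w)\<^sup>2 \<le> 32 * D *
    (1 + ((2 * pi) powr (- real DIM('a) / 2))\<^sup>2 * (\<integral>\<xi>. indicator (ball 0 1) \<xi> / (norm \<xi>)\<^sup>2 \<partial>(lborel :: 'a measure))) *
    (sobolev_L1_norm 5 f0 + sobolev_L1_norm 3 f1)\<^sup>2"
proof -
  let ?c = "(2 * pi) powr (- real DIM('a) / 2)"
  let ?i = "\<lambda>\<xi>::'a. indicator (ball 0 1) \<xi> / (norm \<xi>)\<^sup>2 :: real"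
  let ?M = "?c\<^sup>2 * ((L1_norm f1)\<^sup>2 + (L1_norm f0)\<^sup>2)"
  let ?R = "\<lambda>\<xi>. (1 + (norm \<xi>)\<^sup>2) ^ 5 * (norm (fourier f0 \<xi>))\<^sup>2 + (1 + (norm \<xi>)\<^sup>2) ^ 3 * (norm (fourier f1 \<xi>))\<^sup>2"
  note s0 = sobolev_weight[where k = 5, simplified, OF f(1)]
  note s1 = sobolev_weight[where k = 3, simplified, OF f(3)]
  note i = integrable_inverse_square_ball[OF dim]
  have RI: "integrable lborel (\<lambda>\<xi>. 32 * D * (?R \<xi> + ?M * ?i \<xi>))"
    by (intro integrable_mult_right Bochner_Integration.integrable_add s0 s1 i)
  have "(L2_norm w)\<^sup>2 \<le> (\<integral>\<xi>. 32 * D * (?R \<xi> + ?M * ?i \<xi>) \<partial>lborel)"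
    unfolding L2_norm_sq
  proof (rule integral_mono_AE[OF _ RI])
    show "integrable lborel (\<lambda>\<xi>. (norm (w \<xi>))\<^sup>2)" using w by (simp add: square_integrable_def)
    show "AE \<xi> in lborel. (norm (w \<xi>))\<^sup>2 \<le> 32 * D * (?R \<xi> + ?M * ?i \<xi>)"
      using le AE_lborel_nonzero has_fourier_bound[OF s0(1) f(2)] has_fourier_bound[OF s1(1) f(4)]
    proof eventually_elim
      case (elim \<xi>)
      let ?A = "(norm \<xi>)\<^sup>2" and ?u = "(norm (fourier f1 \<xi>))\<^sup>2" and ?v = "(norm (fourier f0 \<xi>))\<^sup>2"
      have A: "?A > 0" using elim(2) by simp
      have "(norm (w \<xi>))\<^sup>2 \<le> D * ((1 + ?A)^3 / ?A * (?u + (1 + ?A)\<^sup>2 * ?v))" by (rule elim(1))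
      also have "\<dots> \<le> D * (32 * ((1 + ?A)^5 * ?v + (1 + ?A)^3 * ?u + (if ?A < 1 then 1 / ?A * (?u + ?v) else 0)))"
        by (intro mult_left_mono D frequency_weight_le A) auto
      also have "(if ?A < 1 then 1 / ?A * (?u + ?v) else 0) \<le> ?M * ?i \<xi>"
      proof (cases "?A < 1")
        case True
        then have "norm \<xi> < 1" by (simp add: abs_square_less_1)
        have "?u \<le> (?c * L1_norm f1)\<^sup>2" "?v \<le> (?c * L1_norm f0)\<^sup>2"
          using elim(3,4) by (auto intro!: power_mono)
        then have "?u + ?v \<le> ?M" by (simp add: power_mult_distrib distrib_left)
        then have "1 / ?A * (?u + ?v) \<le> 1 / ?A * ?M" using A by (intro mult_left_mono) auto
        then show ?thesis using True \<open>norm \<xi> < 1\<close> by simp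
      qed (auto simp: L1_norm_def)
      finally show ?case using D by (simp add: mult_ac mult_left_mono)
    qed
  qed
  also have "\<dots> = 32 * D * ((sobolev_norm 5 f0)\<^sup>2 + (sobolev_norm 3 f1)\<^sup>2 + ?M * integral\<^sup>L lborel ?i)"
  proof (rule has_bochner_integral_integral_eq)
    show "has_bochner_integral lborel (\<lambda>\<xi>. 32 * D * (?R \<xi> + ?M * ?i \<xi>))
        (32 * D * ((sobolev_norm 5 f0)\<^sup>2 + (sobolev_norm 3 f1)\<^sup>2 + ?M * integral\<^sup>L lborel ?i))"
      by (intro has_bochner_integral_mult_right has_bochner_integral_add)
         (use s0 s1 i in \<open>simp_all add: has_bochner_integral_iff\<close>)
  qed
  also have "\<dots> \<le> 32 * D * ((1 + ?c\<^sup>2 * integral\<^sup>L lborel ?i) * (sobolev_L1_norm 5 f0 + sobolev_L1_norm 3 f1)\<^sup>2)"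
  proof (intro mult_left_mono)
    let ?S = "(sobolev_L1_norm 5 f0 + sobolev_L1_norm 3 f1)\<^sup>2"
    have nn: "0 \<le> sobolev_norm 5 f0" "0 \<le> sobolev_norm 3 f1" "0 \<le> L1_norm f0" "0 \<le> L1_norm f1"
      by (auto simp: sobolev_norm_def L1_norm_def)
    have I0: "0 \<le> integral\<^sup>L lborel ?i" by (intro Bochner_Integration.integral_nonneg) simp
    have sq: "a\<^sup>2 + d\<^sup>2 \<le> (a + c + (d + e))\<^sup>2" if "0 \<le> a" "0 \<le> c" "0 \<le> d" "0 \<le> e" for a c d e :: real
    proof -
      have "a\<^sup>2 + d\<^sup>2 \<le> (a + d)\<^sup>2" using that by (simp add: power2_sum)
      also have "\<dots> \<le> (a + c + (d + e))\<^sup>2" using that by (intro power_mono) auto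
      finally show ?thesis .
    qed
    have 1: "(sobolev_norm 5 f0)\<^sup>2 + (sobolev_norm 3 f1)\<^sup>2 \<le> ?S"
      unfolding sobolev_L1_norm_def by (rule sq) (use nn in auto)
    have 2: "(L1_norm f1)\<^sup>2 + (L1_norm f0)\<^sup>2 \<le> ?S"
      using sq[of "L1_norm f0" "sobolev_norm 5 f0" "L1_norm f1" "sobolev_norm 3 f1"] nn
      by (simp add: sobolev_L1_norm_def add_ac)
    have "?M * integral\<^sup>L lborel ?i = (?c\<^sup>2 * integral\<^sup>L lborel ?i) * ((L1_norm f1)\<^sup>2 + (L1_norm f0)\<^sup>2)"
      by simp
    also have "\<dots> \<le> (?c\<^sup>2 * integral\<^sup>L lborel ?i) * ?S"
      using I0 by (intro mult_left_mono 2) auto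
    finally have "?M * integral\<^sup>L lborel ?i \<le> (?c\<^sup>2 * integral\<^sup>L lborel ?i) * ?S" .
    then show "(sobolev_norm 5 f0)\<^sup>2 + (sobolev_norm 3 f1)\<^sup>2 + ?M * integral\<^sup>L lborel ?i
        \<le> (1 + ?c\<^sup>2 * integral\<^sup>L lborel ?i) * ?S"
      using 1 unfolding distrib_right mult_1 by linarith
  qed (use D in simp)
  finally show ?thesis by (simp only: mult.assoc)
qed

theorem theorem4p1:
  fixes b \<nu> \<gamma> :: real
  assumes "CARD('n::finite) \<ge> 3" and "b > 0" and "\<nu> > 0" and "1 < \<gamma>" and "\<gamma> \<le> 5 / 3"
  shows "\<exists>\<kappa>0>0. \<exists>C>0.
    \<forall>(\<psi>0 :: real ^ 'n \<Rightarrow> complex) \<psi>1 \<psi>2 lap\<psi>0 lap\<psi>1 \<psi>00 \<psi>I1 \<psi>L1.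
      \<psi>0 \<in> sobolev 5 \<and> integrable lborel \<psi>0 \<and>
      \<psi>1 \<in> sobolev 3 \<and> integrable lborel \<psi>1 \<and>
      \<psi>2 \<in> borel_measurable lborel \<and> \<not> (AE x in lborel. \<psi>2 x = 0) \<and>
      has_laplacian \<psi>0 lap\<psi>0 \<and> has_laplacian \<psi>1 lap\<psi>1 \<and>
      (AE x in lborel. \<psi>2 x = of_real (b * \<nu>) * lap\<psi>1 x + lap\<psi>0 x) \<and>
      damped_wave_solution (b * \<nu>) (\<lambda>t \<xi>. 0) \<psi>0 \<psi>1 \<psi>00 \<and>
      interior_corrector b \<nu> \<gamma> \<psi>00 (\<lambda>x. \<psi>1 x - of_real (b * \<nu>) * lap\<psi>0 x) \<psi>I1 \<and>
      heat_solution (\<lambda>x. of_real (\<gamma> - 1) * (\<psi>1 x - of_real (b * \<nu>) * lap\<psi>0 x)) \<psi>L1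
      \<longrightarrow> (\<forall>\<kappa> \<psi>. 0 < \<kappa> \<and> \<kappa> < \<kappa>0 \<and> blackstock_solution b \<nu> \<gamma> \<kappa> \<psi>0 \<psi>1 \<psi>2 \<psi> \<longrightarrow>
            (SUP t\<in>{0..}. ereal (L2_norm (\<lambda>x. \<psi> t x -
                 (\<psi>00 t x + of_real \<kappa> * \<psi>I1 t x + of_real \<kappa> * \<psi>L1 (\<kappa> * t) x))))
            \<le> ereal (C * \<kappa> * sqrt \<kappa> * (sobolev_L1_norm 5 \<psi>0 + sobolev_L1_norm 3 \<psi>1)))"
proof -
  define \<beta> where "\<beta> = b * \<nu>"
  have \<beta>: "\<beta> > 0" using assms by (simp add: \<beta>_def)
  have dim: "DIM(real ^ 'n) \<ge> 3" using assms(1) by simp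
  define I where "I = 1 + ((2 * pi) powr (- real DIM(real ^ 'n) / 2))\<^sup>2 *
    (\<integral>\<xi>. indicator (ball 0 1) \<xi> / (norm \<xi>)\<^sup>2 \<partial>(lborel :: (real ^ 'n) measure))"
  have "0 \<le> (\<integral>\<xi>. indicator (ball 0 1) \<xi> / (norm \<xi>)\<^sup>2 \<partial>(lborel :: (real ^ 'n) measure))"
    by (intro Bochner_Integration.integral_nonneg) simp
  then have I: "I > 0" by (simp add: I_def add_pos_nonneg)
  \<comment> \<open>64 is 2 times 32: the 2 bounds \<gamma> in the estimate at a fixed frequency,
    the 32 comes from \<open>frequency_weight_le\<close>.\<close>
  define C where "C = sqrt (64 * energy_const \<beta> * I)"
  have C: "C > 0" using energy_const_pos[OF \<beta>] I by (simp add: C_def)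
  have bound: "L2_norm (\<lambda>x. \<psi> t x - (\<psi>00 t x + of_real \<kappa> * \<psi>I1 t x + of_real \<kappa> * \<psi>L1 (\<kappa> * t) x))
      \<le> C * \<kappa> * sqrt \<kappa> * (sobolev_L1_norm 5 \<psi>0 + sobolev_L1_norm 3 \<psi>1)"
    if data: "\<psi>0 \<in> sobolev 5" "integrable lborel \<psi>0" "\<psi>1 \<in> sobolev 3" "integrable lborel \<psi>1"
        "\<psi>2 \<in> borel_measurable lborel" "has_laplacian \<psi>0 lap\<psi>0" "has_laplacian \<psi>1 lap\<psi>1"
        "AE x in lborel. \<psi>2 x = of_real (b * \<nu>) * lap\<psi>1 x + lap\<psi>0 x"
        "damped_wave_solution (b * \<nu>) (\<lambda>t \<xi>. 0) \<psi>0 \<psi>1 \<psi>00"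
        "interior_corrector b \<nu> \<gamma> \<psi>00 (\<lambda>x. \<psi>1 x - of_real (b * \<nu>) * lap\<psi>0 x) \<psi>I1"
        "heat_solution (\<lambda>x. of_real (\<gamma> - 1) * (\<psi>1 x - of_real (b * \<nu>) * lap\<psi>0 x)) \<psi>L1"
      and k: "0 < \<kappa>" "\<kappa> < 1" and sol: "blackstock_solution b \<nu> \<gamma> \<kappa> \<psi>0 \<psi>1 \<psi>2 \<psi>" and t: "0 \<le> t"
    for \<psi>0 \<psi>1 \<psi>2 lap\<psi>0 lap\<psi>1 :: "real ^ 'n \<Rightarrow> complex" and \<psi>00 \<psi>I1 \<psi>L1 \<kappa> \<psi> t
  proof -
    let ?e = "\<lambda>x. \<psi> t x - (\<psi>00 t x + of_real \<kappa> * \<psi>I1 t x + of_real \<kappa> * \<psi>L1 (\<kappa> * t) x)"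
    let ?S = "sobolev_L1_norm 5 \<psi>0 + sobolev_L1_norm 3 \<psi>1"
    obtain w where w: "has_fourier ?e w"
      and le: "AE \<xi> in lborel. (norm (w \<xi>))\<^sup>2 \<le> 2 * energy_const \<beta> * (\<kappa>^3 * ((1 + (norm \<xi>)\<^sup>2)^3 / (norm \<xi>)\<^sup>2 *
        ((norm (fourier \<psi>1 \<xi>))\<^sup>2 + (1 + (norm \<xi>)\<^sup>2)\<^sup>2 * (norm (fourier \<psi>0 \<xi>))\<^sup>2)))"
      by (rule error_transform_bound[OF \<beta>_def \<beta> assms(4,5) k data(5-11) sol t])
    have "(L2_norm w)\<^sup>2 \<le> 32 * (2 * energy_const \<beta> * \<kappa>^3) * I * ?S\<^sup>2"
      unfolding I_def
    proof (rule weighted_L2_bound[OF dim _ has_fourier_sq(2)[OF w] data(1-4)])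
      show "0 \<le> 2 * energy_const \<beta> * \<kappa>^3" using energy_const_pos[OF \<beta>] k by simp
    qed (use le in \<open>simp only: mult.assoc\<close>)
    also have "\<dots> = (C * \<kappa> * sqrt \<kappa> * ?S)\<^sup>2"
    proof -
      have sq: "C\<^sup>2 = 64 * energy_const \<beta> * I" "(sqrt \<kappa>)\<^sup>2 = \<kappa>"
        using energy_const_pos[OF \<beta>] I k by (simp_all add: C_def)
      show ?thesis unfolding power_mult_distrib sq by (simp add: power3_eq_cube power2_eq_square)
    qed
    finally have "L2_norm w \<le> C * \<kappa> * sqrt \<kappa> * ?S"
    proof (rule power2_le_imp_le)
      have "0 \<le> ?S" by (simp add: sobolev_L1_norm_def sobolev_norm_def L1_norm_def)
      then show "0 \<le> C * \<kappa> * sqrt \<kappa> * ?S" using C k by simp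
    qed
    with has_fourier_L2_norm_le[OF w] show ?thesis by simp
  qed
  show ?thesis
    \<comment> \<open>The threshold 1 suffices: smallness of \<kappa> is used only for
      \<open>\<kappa>^4 \<le> \<kappa>^3\<close> and
      \<open>|\<beta> - \<kappa>| \<le> 1 + \<beta>\<close>.\<close>
    by (intro exI[of _ 1] exI[of _ C] conjI C allI impI SUP_least) (auto intro!: bound)
qed

end
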